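(* If a cubic ring over $\mathbf D$ is Gorenstein, then it is a plane curve singularity.
   Context: $\mathbf D$ is a complete discrete valuation ring with field of fractions $\mathbf K$ and maximal ideal $t\mathbf D$. A cubic ring over $\mathbf D$ is a $\mathbf D$-subalgebra $\mathbf C$ of a $3$-dimensional (commutative) semisimple $\mathbf K$-algebra $\mathbf L$ that is a free $\mathbf D$-module of rank $3$. It is assumed that the integral closure $\mathbf A$ of $\mathbf D$ in $\mathbf L$ is a finitely generated $\mathbf D$-module. The embedding dimension of a local noetherian ring $\mathbf C$ with maximal ideal $\mathbf J$ is $\dim_{\mathbf C/\mathbf J}\mathbf J/\mathbf J^2$; a local noetherian ring of Krull dimension $1$ and embedding dimension $2$ is called a plane curve singularity.
   Formalization: The cubic ring is additionally assumed local and not regular (a discrete valuation ring is Gorenstein of embedding dimension 1); for arbitrary Gorenstein cubic rings, the claim is made for each non-regular localization at a maximal ideal. *)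

theory Defs
  imports
    "Jordan_Normal_Form.Missing_VectorSpace"
    "HOL-Library.Extended_Nat"
    "HOL-Algebra.Algebra"
begin

section \<open>Submodules of a commutative ring under multiplication\<close>

text \<open>
  A subset \<open>M\<close> of a ring \<open>L\<close> as a module over a subring of \<open>L\<close>, acting by multiplication.
  In particular \<open>mult_module R (carrier R)\<close> is \<open>R\<close> as a module over itself.
\<close>

definition mult_module :: "('a, 'c) ring_scheme \<Rightarrow> 'a set \<Rightarrow> ('a, 'a) module" where
  "mult_module L M =
     \<lparr>carrier = M, monoid.mult = (\<otimes>\<^bsub>L\<^esub>), monoid.one = \<one>\<^bsub>L\<^esub>,
      ring.zero = \<zero>\<^bsub>L\<^esub>, ring.add = (\<oplus>\<^bsub>L\<^esub>), module.smult = (\<otimes>\<^bsub>L\<^esub>)\<rparr>"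

definition finitely_generated_module :: "('a, 'c) ring_scheme \<Rightarrow> ('a, 'b, 'd) module_scheme \<Rightarrow> bool" where
  "finitely_generated_module R M \<longleftrightarrow>
     Module.module R M \<and> (\<exists>S. finite S \<and> S \<subseteq> carrier M \<and> LinearCombinations.module.span R M S = carrier M)"

definition free_module_of_rank :: "nat \<Rightarrow> ('a, 'c) ring_scheme \<Rightarrow> ('a, 'b, 'd) module_scheme \<Rightarrow> bool" where
  "free_module_of_rank n R M \<longleftrightarrow>
     Module.module R M \<and>
     (\<exists>B. finite B \<and> card B = n \<and> B \<subseteq> carrier M \<and>
        \<not> LinearCombinations.module.lin_dep R M B \<and> LinearCombinations.module.span R M B = carrier M)"


section \<open>Local rings, Krull dimension, embedding dimension\<close>

definition local_ring :: "('a, 'c) ring_scheme \<Rightarrow> bool" where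
  "local_ring R \<longleftrightarrow> cring R \<and> (\<exists>!J. maximalideal J R)"

definition the_maximal_ideal :: "('a, 'c) ring_scheme \<Rightarrow> 'a set" where
  "the_maximal_ideal R = (THE J. maximalideal J R)"

definition krull_dim :: "('a, 'c) ring_scheme \<Rightarrow> enat" where
  "krull_dim R = Sup {enat n | n.
     \<exists>P :: nat \<Rightarrow> 'a set. (\<forall>i\<le>n. primeideal (P i) R) \<and> (\<forall>i<n. P i \<subset> P (Suc i))}"

text \<open>
  The space \<open>J / J\<^sup>2\<close> over \<open>R / J\<close>: vectors are the cosets \<open>J\<^sup>2 + x\<close> with \<open>x \<in> J\<close>, and
  \<open>(J + a) \<odot> (J\<^sup>2 + x) = J\<^sup>2 + a x\<close>.  The components \<open>mult\<close> and \<open>one\<close> play no role.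
\<close>

definition cotangent_space :: "('a, 'c) ring_scheme \<Rightarrow> 'a set \<Rightarrow> ('a set, 'a set) module" where
  "cotangent_space R J = (let J2 = J \<cdot>\<^bsub>R\<^esub> J in
     \<lparr>carrier = (\<lambda>x. J2 +>\<^bsub>R\<^esub> x) ` J,
      monoid.mult = (\<otimes>\<^bsub>R Quot J2\<^esub>), monoid.one = \<one>\<^bsub>R Quot J2\<^esub>,
      ring.zero = \<zero>\<^bsub>R Quot J2\<^esub>, ring.add = (\<oplus>\<^bsub>R Quot J2\<^esub>), module.smult = rcoset_mult R J2\<rparr>)"

definition embedding_dim :: "('a, 'c) ring_scheme \<Rightarrow> nat" where
  "embedding_dim R = (let J = the_maximal_ideal R in
     vectorspace.dim (R Quot J) (cotangent_space R J))"

definition regular_local_ring :: "('a, 'c) ring_scheme \<Rightarrow> bool" where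
  "regular_local_ring R \<longleftrightarrow>
     local_ring R \<and> noetherian_ring R \<and> enat (embedding_dim R) = krull_dim R"

definition plane_curve_singularity :: "('a, 'c) ring_scheme \<Rightarrow> bool" where
  "plane_curve_singularity R \<longleftrightarrow>
     local_ring R \<and> noetherian_ring R \<and> krull_dim R = 1 \<and> embedding_dim R = 2"


section \<open>Complete discrete valuation rings\<close>

definition discrete_valuation_ring :: "('a, 'c) ring_scheme \<Rightarrow> bool" where
  "discrete_valuation_ring R \<longleftrightarrow> principal_domain R \<and> local_ring R \<and> \<not> field R"

primrec ideal_power :: "('a, 'c) ring_scheme \<Rightarrow> 'a set \<Rightarrow> nat \<Rightarrow> 'a set" where
  "ideal_power R I 0 = carrier R"
| "ideal_power R I (Suc n) = I \<cdot>\<^bsub>R\<^esub> ideal_power R I n"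

text \<open>Bijectivity of the canonical map from \<open>R\<close> to the inverse limit of the rings \<open>R / I\<^sup>n\<close>.\<close>

definition adically_complete :: "('a, 'c) ring_scheme \<Rightarrow> 'a set \<Rightarrow> bool" where
  "adically_complete R I \<longleftrightarrow>
     (\<forall>x :: nat \<Rightarrow> 'a.
        (\<forall>n. x n \<in> carrier R \<and> x (Suc n) \<ominus>\<^bsub>R\<^esub> x n \<in> ideal_power R I n) \<longrightarrow>
        (\<exists>!y. y \<in> carrier R \<and> (\<forall>n. y \<ominus>\<^bsub>R\<^esub> x n \<in> ideal_power R I n)))"

definition complete_dvr :: "('a, 'c) ring_scheme \<Rightarrow> bool" where
  "complete_dvr R \<longleftrightarrow>
     discrete_valuation_ring R \<and> adically_complete R (the_maximal_ideal R)"


section \<open>Cubic rings\<close>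

definition is_fraction_field :: "('a, 'c) ring_scheme \<Rightarrow> 'a set \<Rightarrow> 'a set \<Rightarrow> bool" where
  "is_fraction_field L D K \<longleftrightarrow>
     subring D L \<and> subfield K L \<and>
     K = {a \<otimes>\<^bsub>L\<^esub> inv\<^bsub>L\<^esub> b | a b. a \<in> D \<and> b \<in> D - {\<zero>\<^bsub>L\<^esub>}}"

text \<open>Every ideal is a direct summand, that is, the ring is a semisimple module over itself.\<close>

definition semisimple_cring :: "('a, 'c) ring_scheme \<Rightarrow> bool" where
  "semisimple_cring L \<longleftrightarrow>
     cring L \<and>
     (\<forall>I. ideal I L \<longrightarrow> (\<exists>J. ideal J L \<and> I <+>\<^bsub>L\<^esub> J = carrier L \<and> I \<inter> J = {\<zero>\<^bsub>L\<^esub>}))"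

text \<open>Polynomials are coefficient lists with the leading coefficient first.\<close>

definition integral_closure_in :: "('a, 'c) ring_scheme \<Rightarrow> 'a set \<Rightarrow> 'a set" where
  "integral_closure_in L D =
     {x \<in> carrier L. \<exists>p. p \<noteq> [] \<and> set p \<subseteq> D \<and> lead_coeff p = \<one>\<^bsub>L\<^esub> \<and> ring.eval L p x = \<zero>\<^bsub>L\<^esub>}"

text \<open>
  A nonzero algebra over a field contains that field, so \<open>D\<close> and \<open>K\<close> are taken to be
  subsets of the cubic algebra \<open>L\<close>, acting by multiplication.
\<close>

definition cubic_ring :: "('a, 'c) ring_scheme \<Rightarrow> 'a set \<Rightarrow> 'a set \<Rightarrow> 'a set \<Rightarrow> bool" where
  "cubic_ring L K D C \<longleftrightarrow>
     semisimple_cring L \<and> is_fraction_field L D K \<and> ring.dimension L 3 K (carrier L) \<and>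
     subring C L \<and> D \<subseteq> C \<and>
     free_module_of_rank 3 (L\<lparr>carrier := D\<rparr>) (mult_module L C)"


section \<open>Localization at a prime ideal\<close>

text \<open>
  The fraction \<open>a / s\<close> is the set of pairs \<open>(b, u)\<close> with \<open>w (a u - b s) = 0\<close> for some
  \<open>w\<close> outside \<open>P\<close>.  As for the multiplication of cosets in the library, the operations are unions
  over representatives, all of which contribute the same fraction.
\<close>

definition loc_frac :: "('a, 'c) ring_scheme \<Rightarrow> 'a set \<Rightarrow> 'a \<Rightarrow> 'a \<Rightarrow> ('a \<times> 'a) set" where
  "loc_frac R P a s =
     {(b, u). b \<in> carrier R \<and> u \<in> carrier R - P \<and>
        (\<exists>w \<in> carrier R - P. w \<otimes>\<^bsub>R\<^esub> (a \<otimes>\<^bsub>R\<^esub> u \<ominus>\<^bsub>R\<^esub> b \<otimes>\<^bsub>R\<^esub> s) = \<zero>\<^bsub>R\<^esub>)}"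

definition localization_at :: "('a, 'c) ring_scheme \<Rightarrow> 'a set \<Rightarrow> ('a \<times> 'a) set ring" where
  "localization_at R P =
     \<lparr>carrier = {loc_frac R P a s | a s. a \<in> carrier R \<and> s \<in> carrier R - P},
      monoid.mult = (\<lambda>A B. \<Union>(a, s) \<in> A. \<Union>(b, u) \<in> B.
                loc_frac R P (a \<otimes>\<^bsub>R\<^esub> b) (s \<otimes>\<^bsub>R\<^esub> u)),
      monoid.one = loc_frac R P \<one>\<^bsub>R\<^esub> \<one>\<^bsub>R\<^esub>,
      ring.zero = loc_frac R P \<zero>\<^bsub>R\<^esub> \<one>\<^bsub>R\<^esub>,
      ring.add = (\<lambda>A B. \<Union>(a, s) \<in> A. \<Union>(b, u) \<in> B.
                loc_frac R P (a \<otimes>\<^bsub>R\<^esub> u \<oplus>\<^bsub>R\<^esub> b \<otimes>\<^bsub>R\<^esub> s) (s \<otimes>\<^bsub>R\<^esub> u))\<rparr>"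


section \<open>Gorenstein rings\<close>

text \<open>
  The test modules \<open>N\<close> and \<open>N'\<close> have elements in the type of the ring.  This includes the
  inclusions of ideals into the ring, so by Baer's criterion nothing is lost.
\<close>

definition injective_module :: "('a, 'c) ring_scheme \<Rightarrow> ('a, 'b) module \<Rightarrow> bool" where
  "injective_module R M \<longleftrightarrow>
     Module.module R M \<and>
     (\<forall>(N :: ('a, 'a) module) (N' :: ('a, 'a) module) f g.
        Module.module R N \<and> Module.module R N' \<and>
        f \<in> LinearCombinations.module_hom R N N' \<and> inj_on f (carrier N) \<and>
        g \<in> LinearCombinations.module_hom R N M \<longrightarrow>
        (\<exists>h \<in> LinearCombinations.module_hom R N' M. \<forall>x \<in> carrier N. h (f x) = g x))"

text \<open>
  There is an exact sequence \<open>0 \<rightarrow> M \<rightarrow> I 0 \<rightarrow> I 1 \<rightarrow> \<dots>\<close> of injective modules with \<open>I i = 0\<close> for large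
  \<open>i\<close>.  HOL cannot quantify over the type of the elements of the \<open>I i\<close>, so this type \<open>'b\<close> is a
  parameter.  A theorem that assumes finite injective dimension and has \<open>'b\<close> as a type variable
  holds for every choice of \<open>'b\<close>, which amounts to an existential hypothesis.
\<close>

definition finite_injective_dim ::
    "'b itself \<Rightarrow> ('a, 'c) ring_scheme \<Rightarrow> ('a, 'm, 'd) module_scheme \<Rightarrow> bool" where
  "finite_injective_dim U R M \<longleftrightarrow>
     Module.module R M \<and>
     (\<exists>(I :: nat \<Rightarrow> ('a, 'b) module) e d n.
        (\<forall>i. injective_module R (I i)) \<and>
        (\<forall>i>n. carrier (I i) = {\<zero>\<^bsub>I i\<^esub>}) \<and>
        e \<in> LinearCombinations.module_hom R M (I 0) \<and>
        (\<forall>i. d i \<in> LinearCombinations.module_hom R (I i) (I (Suc i))) \<and>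
        inj_on e (carrier M) \<and>
        e ` carrier M = {x \<in> carrier (I 0). d 0 x = \<zero>\<^bsub>I 1\<^esub>} \<and>
        (\<forall>i. d i ` carrier (I i) =
               {x \<in> carrier (I (Suc i)). d (Suc i) x = \<zero>\<^bsub>I (Suc (Suc i))\<^esub>}))"

definition gorenstein_local_ring :: "'b itself \<Rightarrow> ('a, 'c) ring_scheme \<Rightarrow> bool" where
  "gorenstein_local_ring U R \<longleftrightarrow>
     local_ring R \<and> noetherian_ring R \<and> finite_injective_dim U R (mult_module R (carrier R))"

definition gorenstein_ring :: "'b itself \<Rightarrow> ('a, 'c) ring_scheme \<Rightarrow> bool" where
  "gorenstein_ring U R \<longleftrightarrow>
     cring R \<and> noetherian_ring R \<and>
     (\<forall>P. maximalideal P R \<longrightarrow> gorenstein_local_ring U (localization_at R P))"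

end

theory Submission
  imports Defs
begin

text \<open>
  Let \<open>R\<close> be a localization of \<open>\<^bold>C\<close> at a maximal ideal, \<open>J\<close> its maximal ideal and \<open>t\<close> the uniformizer of
  \<open>\<^bold>D\<close>.  By Nakayama's lemma \<open>t\<close> lies in \<open>J\<close>.  Any four elements of \<open>R\<close> satisfy a linear relation over
  \<open>\<^bold>D\<close> with a unit coefficient.  Applied to \<open>1, x, x\<^sup>2, x\<^sup>3\<close> this gives Krull dimension 1.  If \<open>J/J\<^sup>2\<close> is
  not spanned by two elements, choose \<open>a\<close>, \<open>b\<close> in \<open>J\<close> such that \<open>t, a, b\<close> are irredundant modulo
  \<open>J\<^sup>2\<close>; the relations between \<open>1, a, b, x\<close> with \<open>x\<close> in \<open>J\<close> give \<open>J = (t, a, b)\<close> and \<open>J\<^sup>2 \<subseteq> tR\<close>.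

  In this situation \<open>R\<close> has infinite injective dimension.  Otherwise, going down a finite injective
  resolution, \<open>Ext\<^sup>1(R/J, Z) = 0\<close> for each cosyzygy \<open>Z\<close> of \<open>R\<close> from the first on.  For the first one this
  contradicts the fact that the socle of \<open>R/tR\<close> is not simple.
\<close>

section \<open>Extension of homomorphisms from ideals\<close>

text \<open>The descent takes the place of change of rings for Ext. Put k = R/J and let Z be a
  cosyzygy in an injective module M with quotient W. Then Ext^1(k, W) = Ext^2(k, Z), so going down
  means deducing the vanishing of a lower Ext from that of a higher one, which is false in general.
  It works here because J/tR is a nonzero sum of copies of k: k is a quotient of J, and an
  obstruction found in W can be fed back as a homomorphism from J to W. The step also needs tZ = Z.
  Injective modules and their images satisfy this, as \<open>t\<close> is a nonzerodivisor, but R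
  itself does not; so the descent ends at the first cosyzygy. The Gorenstein property thus only
  bounds the embedding dimension by 2. The value 0 is impossible by Nakayama's lemma, and the value
  1 is the regular case. The unit coefficient comes from a linear dependence over \<open>K\<close>
  of four elements of a 3-dimensional space: clear denominators, then divide by a coefficient that
  divides all others.\<close>

text \<open>
  For a submodule \<open>Z\<close> of \<open>M\<close> this says \<open>Ext\<^sup>1(R/(x, y, w), Z) = 0\<close>: a homomorphism from the ideal
  \<open>(x, y, w)\<close> to \<open>Z\<close> is a triple of values that respects all relations between the generators, and
  it extends to \<open>R\<close> iff it is multiplication by an element of \<open>Z\<close>.
\<close>

definition hom_extends ::
    "('a, 'c) ring_scheme \<Rightarrow> ('a, 'b, 'd) module_scheme \<Rightarrow> 'b set \<Rightarrow> 'a \<Rightarrow> 'a \<Rightarrow> 'a \<Rightarrow> bool" where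
  "hom_extends R M Z x y w \<longleftrightarrow>
     (\<forall>z1\<in>Z. \<forall>z2\<in>Z. \<forall>z3\<in>Z.
        (\<forall>r1\<in>carrier R. \<forall>r2\<in>carrier R. \<forall>r3\<in>carrier R.
           r1 \<otimes>\<^bsub>R\<^esub> x \<oplus>\<^bsub>R\<^esub> r2 \<otimes>\<^bsub>R\<^esub> y \<oplus>\<^bsub>R\<^esub> r3 \<otimes>\<^bsub>R\<^esub> w = \<zero>\<^bsub>R\<^esub> \<longrightarrow>
           r1 \<odot>\<^bsub>M\<^esub> z1 \<oplus>\<^bsub>M\<^esub> r2 \<odot>\<^bsub>M\<^esub> z2 \<oplus>\<^bsub>M\<^esub> r3 \<odot>\<^bsub>M\<^esub> z3 = \<zero>\<^bsub>M\<^esub>) \<longrightarrow>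
        (\<exists>z\<in>Z. x \<odot>\<^bsub>M\<^esub> z = z1 \<and> y \<odot>\<^bsub>M\<^esub> z = z2 \<and> w \<odot>\<^bsub>M\<^esub> z = z3))"

lemma (in cring) mult_module_ideal:
  assumes "ideal I R"
  shows "Module.module R (mult_module R I)"
proof -
  interpret I: ideal I R by fact
  show ?thesis
  proof (rule moduleI)
    show "abelian_group (mult_module R I)"
    proof (rule abelian_groupI)
      fix x assume "x \<in> carrier (mult_module R I)"
      then have x: "x \<in> I" by (simp add: mult_module_def)
      show "\<exists>y\<in>carrier (mult_module R I). y \<oplus>\<^bsub>mult_module R I\<^esub> x = \<zero>\<^bsub>mult_module R I\<^esub>"
        using x I.a_inv_closed[OF x] I.Icarr[OF x] by (auto simp: mult_module_def l_neg intro!: bexI[of _ "\<ominus> x"])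
    qed (auto simp: mult_module_def I.Icarr add.m_ac)
  qed (auto simp: mult_module_def I.I_l_closed I.Icarr l_distr r_distr m_assoc is_cring)
qed

lemma (in Module.module) smult_l_diff:
  assumes "a \<in> carrier R" "b \<in> carrier R" "x \<in> carrier M"
  shows "(a \<ominus>\<^bsub>R\<^esub> b) \<odot>\<^bsub>M\<^esub> x = a \<odot>\<^bsub>M\<^esub> x \<ominus>\<^bsub>M\<^esub> b \<odot>\<^bsub>M\<^esub> x"
  using assms by (simp add: a_minus_def  smult_l_distr smult_l_minus)

lemma (in Module.module) comb3_diff:
  assumes "r1 \<in> carrier R" "r2 \<in> carrier R" "r3 \<in> carrier R"
    "s1 \<in> carrier R" "s2 \<in> carrier R" "s3 \<in> carrier R"
    "z1 \<in> carrier M" "z2 \<in> carrier M" "z3 \<in> carrier M"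
  shows "(r1 \<ominus>\<^bsub>R\<^esub> s1) \<odot>\<^bsub>M\<^esub> z1 \<oplus>\<^bsub>M\<^esub> (r2 \<ominus>\<^bsub>R\<^esub> s2) \<odot>\<^bsub>M\<^esub> z2 \<oplus>\<^bsub>M\<^esub> (r3 \<ominus>\<^bsub>R\<^esub> s3) \<odot>\<^bsub>M\<^esub> z3 =
    (r1 \<odot>\<^bsub>M\<^esub> z1 \<oplus>\<^bsub>M\<^esub> r2 \<odot>\<^bsub>M\<^esub> z2 \<oplus>\<^bsub>M\<^esub> r3 \<odot>\<^bsub>M\<^esub> z3) \<ominus>\<^bsub>M\<^esub> (s1 \<odot>\<^bsub>M\<^esub> z1 \<oplus>\<^bsub>M\<^esub> s2 \<odot>\<^bsub>M\<^esub> z2 \<oplus>\<^bsub>M\<^esub> s3 \<odot>\<^bsub>M\<^esub> z3)"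
  using assms
  by (simp add: a_minus_def smult_l_distr smult_l_minus M.minus_add M.a_ac)

text \<open>Well-definedness of the map that a triple of values induces on the ideal
  \<open>(x, y, w)\<close>: two presentations of one element differ by a relation.\<close>

lemma (in Module.module) comb3_eqI:
  assumes "r1 \<in> carrier R" "r2 \<in> carrier R" "r3 \<in> carrier R"
    "s1 \<in> carrier R" "s2 \<in> carrier R" "s3 \<in> carrier R"
    and x: "x \<in> carrier R" "y \<in> carrier R" "w \<in> carrier R"
    and z: "z1 \<in> carrier M" "z2 \<in> carrier M" "z3 \<in> carrier M"
    and eq: "r1 \<otimes>\<^bsub>R\<^esub> x \<oplus>\<^bsub>R\<^esub> r2 \<otimes>\<^bsub>R\<^esub> y \<oplus>\<^bsub>R\<^esub> r3 \<otimes>\<^bsub>R\<^esub> w = s1 \<otimes>\<^bsub>R\<^esub> x \<oplus>\<^bsub>R\<^esub> s2 \<otimes>\<^bsub>R\<^esub> y \<oplus>\<^bsub>R\<^esub> s3 \<otimes>\<^bsub>R\<^esub> w"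
    and rel: "\<And>r1 r2 r3. r1 \<in> carrier R \<Longrightarrow> r2 \<in> carrier R \<Longrightarrow> r3 \<in> carrier R \<Longrightarrow>
      r1 \<otimes>\<^bsub>R\<^esub> x \<oplus>\<^bsub>R\<^esub> r2 \<otimes>\<^bsub>R\<^esub> y \<oplus>\<^bsub>R\<^esub> r3 \<otimes>\<^bsub>R\<^esub> w = \<zero>\<^bsub>R\<^esub> \<Longrightarrow>
      r1 \<odot>\<^bsub>M\<^esub> z1 \<oplus>\<^bsub>M\<^esub> r2 \<odot>\<^bsub>M\<^esub> z2 \<oplus>\<^bsub>M\<^esub> r3 \<odot>\<^bsub>M\<^esub> z3 = \<zero>\<^bsub>M\<^esub>"
  shows "r1 \<odot>\<^bsub>M\<^esub> z1 \<oplus>\<^bsub>M\<^esub> r2 \<odot>\<^bsub>M\<^esub> z2 \<oplus>\<^bsub>M\<^esub> r3 \<odot>\<^bsub>M\<^esub> z3 =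
    s1 \<odot>\<^bsub>M\<^esub> z1 \<oplus>\<^bsub>M\<^esub> s2 \<odot>\<^bsub>M\<^esub> z2 \<oplus>\<^bsub>M\<^esub> s3 \<odot>\<^bsub>M\<^esub> z3"
proof -
  have "(r1 \<ominus>\<^bsub>R\<^esub> s1) \<otimes>\<^bsub>R\<^esub> x \<oplus>\<^bsub>R\<^esub> (r2 \<ominus>\<^bsub>R\<^esub> s2) \<otimes>\<^bsub>R\<^esub> y \<oplus>\<^bsub>R\<^esub> (r3 \<ominus>\<^bsub>R\<^esub> s3) \<otimes>\<^bsub>R\<^esub> w =
     (r1 \<otimes>\<^bsub>R\<^esub> x \<oplus>\<^bsub>R\<^esub> r2 \<otimes>\<^bsub>R\<^esub> y \<oplus>\<^bsub>R\<^esub> r3 \<otimes>\<^bsub>R\<^esub> w) \<ominus>\<^bsub>R\<^esub> (s1 \<otimes>\<^bsub>R\<^esub> x \<oplus>\<^bsub>R\<^esub> s2 \<otimes>\<^bsub>R\<^esub> y \<oplus>\<^bsub>R\<^esub> s3 \<otimes>\<^bsub>R\<^esub> w)"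
    using assms(1-6) x by algebra
  also have "\<dots> = \<zero>\<^bsub>R\<^esub>"
    unfolding eq using assms(1-6) x by (simp add: R.r_neg a_minus_def)
  finally have "(r1 \<ominus>\<^bsub>R\<^esub> s1) \<odot>\<^bsub>M\<^esub> z1 \<oplus>\<^bsub>M\<^esub> (r2 \<ominus>\<^bsub>R\<^esub> s2) \<odot>\<^bsub>M\<^esub> z2 \<oplus>\<^bsub>M\<^esub> (r3 \<ominus>\<^bsub>R\<^esub> s3) \<odot>\<^bsub>M\<^esub> z3 = \<zero>\<^bsub>M\<^esub>"
    using assms(1-6) by (intro rel) auto
  then show ?thesis
    unfolding comb3_diff[OF assms(1-6) z] using assms(1-6) z by simp
qed

lemma (in cring) ideal_comb3:
  assumes "x \<in> carrier R" "y \<in> carrier R" "w \<in> carrier R"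
  shows "ideal {r1 \<otimes> x \<oplus> r2 \<otimes> y \<oplus> r3 \<otimes> w | r1 r2 r3.
    r1 \<in> carrier R \<and> r2 \<in> carrier R \<and> r3 \<in> carrier R} R" (is "ideal ?I R")
proof -
  have add: "u \<oplus> v \<in> ?I" if "u \<in> ?I" "v \<in> ?I" for u v
  proof -
    from that obtain r1 r2 r3 s1 s2 s3 where
      c: "r1 \<in> carrier R" "r2 \<in> carrier R" "r3 \<in> carrier R"
      "s1 \<in> carrier R" "s2 \<in> carrier R" "s3 \<in> carrier R"
      and u: "u = r1 \<otimes> x \<oplus> r2 \<otimes> y \<oplus> r3 \<otimes> w" and v: "v = s1 \<otimes> x \<oplus> s2 \<otimes> y \<oplus> s3 \<otimes> w"
      by blast
    have "u \<oplus> v = (r1 \<oplus> s1) \<otimes> x \<oplus> (r2 \<oplus> s2) \<otimes> y \<oplus> (r3 \<oplus> s3) \<otimes> w"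
      unfolding u v using c assms by algebra
    with c show ?thesis by blast
  qed
  have mult: "q \<otimes> u \<in> ?I" if "u \<in> ?I" "q \<in> carrier R" for u q
  proof -
    from that obtain r1 r2 r3 where
      c: "r1 \<in> carrier R" "r2 \<in> carrier R" "r3 \<in> carrier R" 
      and u: "u = r1 \<otimes> x \<oplus> r2 \<otimes> y \<oplus> r3 \<otimes> w"
      by blast
    have "q \<otimes> u = (q \<otimes> r1) \<otimes> x \<oplus> (q \<otimes> r2) \<otimes> y \<oplus> (q \<otimes> r3) \<otimes> w"
      unfolding u using c assms that by algebra
    with c that show ?thesis by blast
  qed
  have sub: "u \<in> carrier R" if "u \<in> ?I" for u using that assms by auto
  show ?thesis
  proof (rule idealI[OF ring_axioms])
    show "subgroup ?I (add_monoid R)"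
    proof (rule add.subgroupI)
      show "?I \<subseteq> carrier R" using sub by (rule subsetI)
      have "\<zero> \<otimes> x \<oplus> \<zero> \<otimes> y \<oplus> \<zero> \<otimes> w \<in> ?I" by blast
      then show "?I \<noteq> {}" by blast
      show "\<ominus> u \<in> ?I" if "u \<in> ?I" for u
      proof -
        have "\<ominus> u = (\<ominus> \<one>) \<otimes> u" using sub[OF that] by (simp add: l_minus)
        then show ?thesis using mult[OF that, of "\<ominus> \<one>"] by simp
      qed
    qed (rule add)
  next
    fix u q assume uq: "u \<in> ?I" "q \<in> carrier R"
    show "q \<otimes> u \<in> ?I" by (rule mult[OF uq])
    then show "u \<otimes> q \<in> ?I" unfolding m_comm[OF sub[OF uq(1)] uq(2)] .
  qed
qed

text \<open>A triple of values defines a homomorphism on the ideal, and its extension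
  \<open>h\<close> to \<open>R\<close> is multiplication by \<open>h \<one>\<close>. The test
  modules are the ideal and \<open>R\<close>, so their elements have the type over which
  \<open>injective_module\<close> quantifies.\<close>

lemma injective_hom_extends:
  assumes R: "cring R" and inj: "injective_module R M"
    and x: "x \<in> carrier R" "y \<in> carrier R" "w \<in> carrier R"
  shows "hom_extends R M (carrier M) x y w"
  unfolding hom_extends_def
proof (intro ballI impI)
  interpret cring R by fact
  interpret Module.module R M using inj by (simp add: injective_module_def)
  fix z1 z2 z3
  assume z: "z1 \<in> carrier M" "z2 \<in> carrier M" "z3 \<in> carrier M"
    and "\<forall>r1\<in>carrier R. \<forall>r2\<in>carrier R. \<forall>r3\<in>carrier R.
           r1 \<otimes>\<^bsub>R\<^esub> x \<oplus>\<^bsub>R\<^esub> r2 \<otimes>\<^bsub>R\<^esub> y \<oplus>\<^bsub>R\<^esub> r3 \<otimes>\<^bsub>R\<^esub> w = \<zero>\<^bsub>R\<^esub> \<longrightarrow>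
           r1 \<odot>\<^bsub>M\<^esub> z1 \<oplus>\<^bsub>M\<^esub> r2 \<odot>\<^bsub>M\<^esub> z2 \<oplus>\<^bsub>M\<^esub> r3 \<odot>\<^bsub>M\<^esub> z3 = \<zero>\<^bsub>M\<^esub>"
  then have rel: "\<And>r1 r2 r3. r1 \<in> carrier R \<Longrightarrow> r2 \<in> carrier R \<Longrightarrow> r3 \<in> carrier R \<Longrightarrow>
      r1 \<otimes>\<^bsub>R\<^esub> x \<oplus>\<^bsub>R\<^esub> r2 \<otimes>\<^bsub>R\<^esub> y \<oplus>\<^bsub>R\<^esub> r3 \<otimes>\<^bsub>R\<^esub> w = \<zero>\<^bsub>R\<^esub> \<Longrightarrow>
      r1 \<odot>\<^bsub>M\<^esub> z1 \<oplus>\<^bsub>M\<^esub> r2 \<odot>\<^bsub>M\<^esub> z2 \<oplus>\<^bsub>M\<^esub> r3 \<odot>\<^bsub>M\<^esub> z3 = \<zero>\<^bsub>M\<^esub>" by blast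
  define I where "I = {r1 \<otimes>\<^bsub>R\<^esub> x \<oplus>\<^bsub>R\<^esub> r2 \<otimes>\<^bsub>R\<^esub> y \<oplus>\<^bsub>R\<^esub> r3 \<otimes>\<^bsub>R\<^esub> w | r1 r2 r3.
    r1 \<in> carrier R \<and> r2 \<in> carrier R \<and> r3 \<in> carrier R}"
  have I: "ideal I R" unfolding I_def by (rule ideal_comb3[OF x])
  \<comment> \<open>The value is picked from any presentation of \<open>u\<close>;
    \<open>comb3_eqI\<close> shows that all presentations agree.\<close>
  define g where "g u = (SOME v. \<exists>r1 r2 r3. r1 \<in> carrier R \<and> r2 \<in> carrier R \<and> r3 \<in> carrier R \<and>
    u = r1 \<otimes>\<^bsub>R\<^esub> x \<oplus>\<^bsub>R\<^esub> r2 \<otimes>\<^bsub>R\<^esub> y \<oplus>\<^bsub>R\<^esub> r3 \<otimes>\<^bsub>R\<^esub> w \<and>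
    v = r1 \<odot>\<^bsub>M\<^esub> z1 \<oplus>\<^bsub>M\<^esub> r2 \<odot>\<^bsub>M\<^esub> z2 \<oplus>\<^bsub>M\<^esub> r3 \<odot>\<^bsub>M\<^esub> z3)" for u
  have g: "g (r1 \<otimes>\<^bsub>R\<^esub> x \<oplus>\<^bsub>R\<^esub> r2 \<otimes>\<^bsub>R\<^esub> y \<oplus>\<^bsub>R\<^esub> r3 \<otimes>\<^bsub>R\<^esub> w) = r1 \<odot>\<^bsub>M\<^esub> z1 \<oplus>\<^bsub>M\<^esub> r2 \<odot>\<^bsub>M\<^esub> z2 \<oplus>\<^bsub>M\<^esub> r3 \<odot>\<^bsub>M\<^esub> z3"
    if r: "r1 \<in> carrier R" "r2 \<in> carrier R" "r3 \<in> carrier R" for r1 r2 r3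
    unfolding g_def
  proof (rule some_equality)
    fix v assume "\<exists>s1 s2 s3. s1 \<in> carrier R \<and> s2 \<in> carrier R \<and> s3 \<in> carrier R \<and>
      r1 \<otimes>\<^bsub>R\<^esub> x \<oplus>\<^bsub>R\<^esub> r2 \<otimes>\<^bsub>R\<^esub> y \<oplus>\<^bsub>R\<^esub> r3 \<otimes>\<^bsub>R\<^esub> w = s1 \<otimes>\<^bsub>R\<^esub> x \<oplus>\<^bsub>R\<^esub> s2 \<otimes>\<^bsub>R\<^esub> y \<oplus>\<^bsub>R\<^esub> s3 \<otimes>\<^bsub>R\<^esub> w \<and>
      v = s1 \<odot>\<^bsub>M\<^esub> z1 \<oplus>\<^bsub>M\<^esub> s2 \<odot>\<^bsub>M\<^esub> z2 \<oplus>\<^bsub>M\<^esub> s3 \<odot>\<^bsub>M\<^esub> z3"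
    then obtain s1 s2 s3 where s: "s1 \<in> carrier R" "s2 \<in> carrier R" "s3 \<in> carrier R"
      and eq: "r1 \<otimes>\<^bsub>R\<^esub> x \<oplus>\<^bsub>R\<^esub> r2 \<otimes>\<^bsub>R\<^esub> y \<oplus>\<^bsub>R\<^esub> r3 \<otimes>\<^bsub>R\<^esub> w = s1 \<otimes>\<^bsub>R\<^esub> x \<oplus>\<^bsub>R\<^esub> s2 \<otimes>\<^bsub>R\<^esub> y \<oplus>\<^bsub>R\<^esub> s3 \<otimes>\<^bsub>R\<^esub> w"
      and v: "v = s1 \<odot>\<^bsub>M\<^esub> z1 \<oplus>\<^bsub>M\<^esub> s2 \<odot>\<^bsub>M\<^esub> z2 \<oplus>\<^bsub>M\<^esub> s3 \<odot>\<^bsub>M\<^esub> z3" by blast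
    show "v = r1 \<odot>\<^bsub>M\<^esub> z1 \<oplus>\<^bsub>M\<^esub> r2 \<odot>\<^bsub>M\<^esub> z2 \<oplus>\<^bsub>M\<^esub> r3 \<odot>\<^bsub>M\<^esub> z3"
      unfolding v by (rule comb3_eqI[OF r s x z eq rel, symmetric])
  qed (use r in blast)
  have g_hom: "g \<in> LinearCombinations.module_hom R (mult_module R I) M"
    unfolding LinearCombinations.module_hom_def
  proof (intro CollectI conjI allI impI)
    show "g \<in> carrier (mult_module R I) \<rightarrow> carrier M"
      unfolding mult_module_def I_def using z by (auto simp: g)
  next
    fix u v assume "u \<in> carrier (mult_module R I) \<and> v \<in> carrier (mult_module R I)"
    then obtain r1 r2 r3 s1 s2 s3 where
      c: "r1 \<in> carrier R" "r2 \<in> carrier R" "r3 \<in> carrier R"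
      "s1 \<in> carrier R" "s2 \<in> carrier R" "s3 \<in> carrier R"
      and u: "u = r1 \<otimes>\<^bsub>R\<^esub> x \<oplus>\<^bsub>R\<^esub> r2 \<otimes>\<^bsub>R\<^esub> y \<oplus>\<^bsub>R\<^esub> r3 \<otimes>\<^bsub>R\<^esub> w"
      and v: "v = s1 \<otimes>\<^bsub>R\<^esub> x \<oplus>\<^bsub>R\<^esub> s2 \<otimes>\<^bsub>R\<^esub> y \<oplus>\<^bsub>R\<^esub> s3 \<otimes>\<^bsub>R\<^esub> w"
      unfolding mult_module_def I_def by auto
    have uv: "u \<oplus>\<^bsub>R\<^esub> v = (r1 \<oplus>\<^bsub>R\<^esub> s1) \<otimes>\<^bsub>R\<^esub> x \<oplus>\<^bsub>R\<^esub> (r2 \<oplus>\<^bsub>R\<^esub> s2) \<otimes>\<^bsub>R\<^esub> y \<oplus>\<^bsub>R\<^esub> (r3 \<oplus>\<^bsub>R\<^esub> s3) \<otimes>\<^bsub>R\<^esub> w"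
      unfolding u v using c x by algebra
    have "g (u \<oplus>\<^bsub>R\<^esub> v) = g u \<oplus>\<^bsub>M\<^esub> g v"
      unfolding uv unfolding u v using c z
      by (simp add: g smult_l_distr M.a_assoc M.a_comm M.a_lcomm)
    then show "g (u \<oplus>\<^bsub>mult_module R I\<^esub> v) = g u \<oplus>\<^bsub>M\<^esub> g v" by (simp add: mult_module_def)
  next
    fix q u assume q: "q \<in> carrier R \<and> u \<in> carrier (mult_module R I)"
    then obtain r1 r2 r3 where
      c: "r1 \<in> carrier R" "r2 \<in> carrier R" "r3 \<in> carrier R"
      and u: "u = r1 \<otimes>\<^bsub>R\<^esub> x \<oplus>\<^bsub>R\<^esub> r2 \<otimes>\<^bsub>R\<^esub> y \<oplus>\<^bsub>R\<^esub> r3 \<otimes>\<^bsub>R\<^esub> w"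
      unfolding mult_module_def I_def by auto
    have qu: "q \<otimes>\<^bsub>R\<^esub> u = (q \<otimes>\<^bsub>R\<^esub> r1) \<otimes>\<^bsub>R\<^esub> x \<oplus>\<^bsub>R\<^esub> (q \<otimes>\<^bsub>R\<^esub> r2) \<otimes>\<^bsub>R\<^esub> y \<oplus>\<^bsub>R\<^esub> (q \<otimes>\<^bsub>R\<^esub> r3) \<otimes>\<^bsub>R\<^esub> w"
      unfolding u using c x q by algebra
    have "g (q \<otimes>\<^bsub>R\<^esub> u) = q \<odot>\<^bsub>M\<^esub> g u"
      unfolding qu unfolding u using c z q
      by (simp add: g smult_r_distr smult_assoc1)
    then show "g (q \<odot>\<^bsub>mult_module R I\<^esub> u) = q \<odot>\<^bsub>M\<^esub> g u" by (simp add: mult_module_def)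
  qed
  have incl: "(\<lambda>u. u) \<in> LinearCombinations.module_hom R (mult_module R I) (mult_module R (carrier R))"
    using ideal.Icarr[OF I] by (auto simp: LinearCombinations.module_hom_def mult_module_def)
  have "\<exists>h\<in>LinearCombinations.module_hom R (mult_module R (carrier R)) M.
      \<forall>u\<in>carrier (mult_module R I). h u = g u"
    using inj mult_module_ideal[OF I] mult_module_ideal[OF oneideal] g_hom incl inj_on_id2
    unfolding injective_module_def by blast
  then obtain h where h: "h \<in> LinearCombinations.module_hom R (mult_module R (carrier R)) M"
    and hg: "\<And>u. u \<in> I \<Longrightarrow> h u = g u"
    by (auto simp: mult_module_def)
  have hc: "h \<one>\<^bsub>R\<^esub> \<in> carrier M"
    using LinearCombinations.module_hom_closed[OF h] by (auto simp: mult_module_def)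
  have hs: "h u = u \<odot>\<^bsub>M\<^esub> h \<one>\<^bsub>R\<^esub>" if "u \<in> carrier R" for u
    using LinearCombinations.module_hom_smult[OF h that, of "\<one>\<^bsub>R\<^esub>"] that by (simp add: mult_module_def)
  have "x = \<one>\<^bsub>R\<^esub> \<otimes>\<^bsub>R\<^esub> x \<oplus>\<^bsub>R\<^esub> \<zero>\<^bsub>R\<^esub> \<otimes>\<^bsub>R\<^esub> y \<oplus>\<^bsub>R\<^esub> \<zero>\<^bsub>R\<^esub> \<otimes>\<^bsub>R\<^esub> w"
    "y = \<zero>\<^bsub>R\<^esub> \<otimes>\<^bsub>R\<^esub> x \<oplus>\<^bsub>R\<^esub> \<one>\<^bsub>R\<^esub> \<otimes>\<^bsub>R\<^esub> y \<oplus>\<^bsub>R\<^esub> \<zero>\<^bsub>R\<^esub> \<otimes>\<^bsub>R\<^esub> w"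
    "w = \<zero>\<^bsub>R\<^esub> \<otimes>\<^bsub>R\<^esub> x \<oplus>\<^bsub>R\<^esub> \<zero>\<^bsub>R\<^esub> \<otimes>\<^bsub>R\<^esub> y \<oplus>\<^bsub>R\<^esub> \<one>\<^bsub>R\<^esub> \<otimes>\<^bsub>R\<^esub> w"
    using x by auto
  note e = this
  have "x \<in> I" "y \<in> I" "w \<in> I" unfolding I_def using e by blast+
  moreover have "g x = z1" "g y = z2" "g w = z3"
    using g[of "\<one>\<^bsub>R\<^esub>" "\<zero>\<^bsub>R\<^esub>" "\<zero>\<^bsub>R\<^esub>"] g[of "\<zero>\<^bsub>R\<^esub>" "\<one>\<^bsub>R\<^esub>" "\<zero>\<^bsub>R\<^esub>"] g[of "\<zero>\<^bsub>R\<^esub>" "\<zero>\<^bsub>R\<^esub>" "\<one>\<^bsub>R\<^esub>"] x z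
    by simp_all
  ultimately show "\<exists>z\<in>carrier M. x \<odot>\<^bsub>M\<^esub> z = z1 \<and> y \<odot>\<^bsub>M\<^esub> z = z2 \<and> w \<odot>\<^bsub>M\<^esub> z = z3"
    using hs[OF x(1)] hs[OF x(2)] hs[OF x(3)] hg hc by (intro bexI[of _ "h \<one>\<^bsub>R\<^esub>"]) auto
qed


section \<open>Rings of infinite injective dimension\<close>

lemma hom_extendsD:
  assumes "hom_extends R M Z x y w" "z1 \<in> Z" "z2 \<in> Z" "z3 \<in> Z"
    and "\<And>r1 r2 r3. r1 \<in> carrier R \<Longrightarrow> r2 \<in> carrier R \<Longrightarrow> r3 \<in> carrier R \<Longrightarrow>
      r1 \<otimes>\<^bsub>R\<^esub> x \<oplus>\<^bsub>R\<^esub> r2 \<otimes>\<^bsub>R\<^esub> y \<oplus>\<^bsub>R\<^esub> r3 \<otimes>\<^bsub>R\<^esub> w = \<zero>\<^bsub>R\<^esub> \<Longrightarrow>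
      r1 \<odot>\<^bsub>M\<^esub> z1 \<oplus>\<^bsub>M\<^esub> r2 \<odot>\<^bsub>M\<^esub> z2 \<oplus>\<^bsub>M\<^esub> r3 \<odot>\<^bsub>M\<^esub> z3 = \<zero>\<^bsub>M\<^esub>"
  shows "\<exists>z\<in>Z. x \<odot>\<^bsub>M\<^esub> z = z1 \<and> y \<odot>\<^bsub>M\<^esub> z = z2 \<and> w \<odot>\<^bsub>M\<^esub> z = z3"
  using assms unfolding hom_extends_def by simp

text \<open>
  \<open>J = (t, a, b)\<close> with \<open>J\<^sup>2 \<subseteq> tR\<close>, so that \<open>R/tR\<close> has a socle spanned by the independent classes of
  \<open>a\<close> and \<open>b\<close>.
\<close>

locale minimal_multiplicity_triple = cring R + ideal J R for J and R (structure) +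
  fixes t a b
  assumes one_notin: "\<one> \<notin> J"
    and mem: "t \<in> J" "a \<in> J" "b \<in> J"
    and gen: "\<And>x. x \<in> J \<Longrightarrow> \<exists>r1\<in>carrier R. \<exists>r2\<in>carrier R. \<exists>r3\<in>carrier R.
      x = r1 \<otimes> t \<oplus> r2 \<otimes> a \<oplus> r3 \<otimes> b"
    and sq: "\<And>x y. x \<in> J \<Longrightarrow> y \<in> J \<Longrightarrow> \<exists>r\<in>carrier R. x \<otimes> y = r \<otimes> t"
    and nzd: "\<And>r. r \<in> carrier R \<Longrightarrow> r \<otimes> t = \<zero> \<Longrightarrow> r = \<zero>"
    and rel: "\<And>r1 r2 r3. r1 \<in> carrier R \<Longrightarrow> r2 \<in> carrier R \<Longrightarrow> r3 \<in> carrier R \<Longrightarrow>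
      r1 \<otimes> t \<oplus> r2 \<otimes> a \<oplus> r3 \<otimes> b = \<zero> \<Longrightarrow> r2 \<in> J \<and> r3 \<in> J"
begin

lemma carr: "t \<in> carrier R" "a \<in> carrier R" "b \<in> carrier R"
  using mem Icarr by auto

text \<open>As \<open>t\<close> is a nonzerodivisor, \<open>tR\<close> is free on \<open>t\<close>,
  so \<open>t\<close> may be sent to any \<open>z\<close>. The two zeros pad the generators of
  \<open>tR\<close> to a triple.\<close>

lemma divisible_if_hom_extends:
  assumes "Module.module R M" "hom_extends R M (carrier M) t \<zero> \<zero>" "z \<in> carrier M"
  shows "\<exists>y\<in>carrier M. t \<odot>\<^bsub>M\<^esub> y = z"
proof -
  interpret M: Module.module R M by fact
  have "\<exists>y\<in>carrier M. t \<odot>\<^bsub>M\<^esub> y = z \<and> \<zero> \<odot>\<^bsub>M\<^esub> y = \<zero>\<^bsub>M\<^esub> \<and> \<zero> \<odot>\<^bsub>M\<^esub> y = \<zero>\<^bsub>M\<^esub>"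
  proof (rule hom_extendsD[OF assms(2)])
    fix r1 r2 r3 assume r: "r1 \<in> carrier R" "r2 \<in> carrier R" "r3 \<in> carrier R"
      and "r1 \<otimes> t \<oplus> r2 \<otimes> \<zero> \<oplus> r3 \<otimes> \<zero> = \<zero>"
    then have "r1 = \<zero>" using nzd[of r1] carr by simp
    then show "r1 \<odot>\<^bsub>M\<^esub> z \<oplus>\<^bsub>M\<^esub> r2 \<odot>\<^bsub>M\<^esub> \<zero>\<^bsub>M\<^esub> \<oplus>\<^bsub>M\<^esub> r3 \<odot>\<^bsub>M\<^esub> \<zero>\<^bsub>M\<^esub> = \<zero>\<^bsub>M\<^esub>"
      using r assms(3) by simp
  qed (use assms(3) in auto)
  then show ?thesis by blast
qed

text \<open>
  Write \<open>Z\<close> for the kernel and \<open>W\<close> for the image of \<open>d\<close>.  A homomorphism \<open>J \<rightarrow> Z\<close> is multiplication by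
  some \<open>u\<close> in \<open>M\<close>.  As \<open>J d(u) = 0\<close>, sending \<open>a\<close> to \<open>d(u)\<close> and \<open>t\<close>, \<open>b\<close> to \<open>0\<close> is a homomorphism
  \<open>J \<rightarrow> W\<close>, so \<open>d(u) = a d(v)\<close>, where divisibility of \<open>Z\<close> allows \<open>t v = 0\<close>.  Then \<open>u - a v\<close> lies
  in \<open>Z\<close> and acts on \<open>J\<close> like \<open>u\<close>, because \<open>J a \<subseteq> tR\<close>.
\<close>

lemma hom_extends_kernel:
  assumes M: "Module.module R M" and N: "Module.module R N"
    and d: "d \<in> LinearCombinations.module_hom R M N"
    and ext_M: "hom_extends R M (carrier M) t a b"
    and ext_N: "hom_extends R N (d ` carrier M) t a b"
    and div: "\<And>z. z \<in> carrier M \<Longrightarrow> d z = \<zero>\<^bsub>N\<^esub> \<Longrightarrow> \<exists>y\<in>carrier M. d y = \<zero>\<^bsub>N\<^esub> \<and> t \<odot>\<^bsub>M\<^esub> y = z"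
  shows "hom_extends R M {x \<in> carrier M. d x = \<zero>\<^bsub>N\<^esub>} t a b"
  unfolding hom_extends_def
proof (intro ballI impI)
  interpret M: Module.module R M by fact
  interpret N: Module.module R N by fact
  interpret d: mod_hom R M N d using d by unfold_locales
  let ?Z = "{x \<in> carrier M. d x = \<zero>\<^bsub>N\<^esub>}"
  fix z1 z2 z3
  assume z: "z1 \<in> ?Z" "z2 \<in> ?Z" "z3 \<in> ?Z"
    and "\<forall>r1\<in>carrier R. \<forall>r2\<in>carrier R. \<forall>r3\<in>carrier R.
           r1 \<otimes> t \<oplus> r2 \<otimes> a \<oplus> r3 \<otimes> b = \<zero> \<longrightarrow>
           r1 \<odot>\<^bsub>M\<^esub> z1 \<oplus>\<^bsub>M\<^esub> r2 \<odot>\<^bsub>M\<^esub> z2 \<oplus>\<^bsub>M\<^esub> r3 \<odot>\<^bsub>M\<^esub> z3 = \<zero>\<^bsub>M\<^esub>"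
  then obtain u where u: "u \<in> carrier M"
    and uz: "t \<odot>\<^bsub>M\<^esub> u = z1" "a \<odot>\<^bsub>M\<^esub> u = z2" "b \<odot>\<^bsub>M\<^esub> u = z3"
    using hom_extendsD[OF ext_M, of z1 z2 z3] by auto
  have du: "t \<odot>\<^bsub>N\<^esub> d u = \<zero>\<^bsub>N\<^esub>" "a \<odot>\<^bsub>N\<^esub> d u = \<zero>\<^bsub>N\<^esub>" "b \<odot>\<^bsub>N\<^esub> d u = \<zero>\<^bsub>N\<^esub>"
    using d.f_smult[OF carr(1) u] d.f_smult[OF carr(2) u] d.f_smult[OF carr(3) u] uz z by simp_all
  have duc: "d u \<in> carrier N" using u by simp
  have J_du: "x \<odot>\<^bsub>N\<^esub> d u = \<zero>\<^bsub>N\<^esub>" if "x \<in> J" for x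
  proof -
    obtain r1 r2 r3 where "r1 \<in> carrier R" "r2 \<in> carrier R" "r3 \<in> carrier R"
      "x = r1 \<otimes> t \<oplus> r2 \<otimes> a \<oplus> r3 \<otimes> b" using gen[OF \<open>x \<in> J\<close>] by blast
    with carr du duc show ?thesis by (simp add: N.smult_l_distr N.smult_assoc1)
  qed
  have "\<exists>w\<in>d ` carrier M. t \<odot>\<^bsub>N\<^esub> w = \<zero>\<^bsub>N\<^esub> \<and> a \<odot>\<^bsub>N\<^esub> w = d u \<and> b \<odot>\<^bsub>N\<^esub> w = \<zero>\<^bsub>N\<^esub>"
  proof (rule hom_extendsD[OF ext_N])
    show "\<zero>\<^bsub>N\<^esub> \<in> d ` carrier M" "\<zero>\<^bsub>N\<^esub> \<in> d ` carrier M"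
      using imageI[OF M.zero_closed, of d] unfolding d.f0_is_0 by auto
    show "d u \<in> d ` carrier M" using u by simp
    fix r1 r2 r3 assume r: "r1 \<in> carrier R" "r2 \<in> carrier R" "r3 \<in> carrier R"
      "r1 \<otimes> t \<oplus> r2 \<otimes> a \<oplus> r3 \<otimes> b = \<zero>"
    then show "r1 \<odot>\<^bsub>N\<^esub> \<zero>\<^bsub>N\<^esub> \<oplus>\<^bsub>N\<^esub> r2 \<odot>\<^bsub>N\<^esub> d u \<oplus>\<^bsub>N\<^esub> r3 \<odot>\<^bsub>N\<^esub> \<zero>\<^bsub>N\<^esub> = \<zero>\<^bsub>N\<^esub>"
      using J_du rel[OF r] by simp
  qed
  then obtain u1 where u1: "u1 \<in> carrier M"
    and du1: "t \<odot>\<^bsub>N\<^esub> d u1 = \<zero>\<^bsub>N\<^esub>" "a \<odot>\<^bsub>N\<^esub> d u1 = d u" by blast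
  have "d (t \<odot>\<^bsub>M\<^esub> u1) = \<zero>\<^bsub>N\<^esub>" using u1 du1 carr by simp
  then obtain y where y: "y \<in> carrier M" "d y = \<zero>\<^bsub>N\<^esub>" "t \<odot>\<^bsub>M\<^esub> y = t \<odot>\<^bsub>M\<^esub> u1"
    using div[of "t \<odot>\<^bsub>M\<^esub> u1"] u1 carr by auto
  define v where "v = u1 \<ominus>\<^bsub>M\<^esub> y"
  have v: "v \<in> carrier M" "d v = d u1" "t \<odot>\<^bsub>M\<^esub> v = \<zero>\<^bsub>M\<^esub>"
    using u1 y carr by (simp_all add: v_def a_minus_def M.smult_r_distr M.smult_r_minus M.r_neg)
  define z where "z = u \<ominus>\<^bsub>M\<^esub> a \<odot>\<^bsub>M\<^esub> v"
  have zc: "z \<in> carrier M" using u v carr by (simp add: z_def)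
  have "d z = \<zero>\<^bsub>N\<^esub>"
    using u v carr du1 duc by (simp add: z_def a_minus_def N.r_neg)
  have xz: "x \<odot>\<^bsub>M\<^esub> z = x \<odot>\<^bsub>M\<^esub> u" if "x \<in> J" for x
  proof -
    obtain r where r: "r \<in> carrier R" "x \<otimes> a = r \<otimes> t"
      using sq[OF \<open>x \<in> J\<close> mem(2)] by blast
    have "x \<odot>\<^bsub>M\<^esub> (a \<odot>\<^bsub>M\<^esub> v) = (x \<otimes> a) \<odot>\<^bsub>M\<^esub> v"
      using v carr Icarr[OF \<open>x \<in> J\<close>] by (simp add: M.smult_assoc1)
    also have "\<dots> = \<zero>\<^bsub>M\<^esub>" unfolding r(2) using r(1) v carr by (simp add: M.smult_assoc1)
    finally have "x \<odot>\<^bsub>M\<^esub> (a \<odot>\<^bsub>M\<^esub> v) = \<zero>\<^bsub>M\<^esub>" .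
    then show ?thesis
      using u v carr Icarr[OF that] by (simp add: z_def a_minus_def M.smult_r_distr M.smult_r_minus)
  qed
  show "\<exists>z\<in>?Z. t \<odot>\<^bsub>M\<^esub> z = z1 \<and> a \<odot>\<^bsub>M\<^esub> z = z2 \<and> b \<odot>\<^bsub>M\<^esub> z = z3"
  proof (intro bexI conjI)
    show "z \<in> ?Z" using zc \<open>d z = \<zero>\<^bsub>N\<^esub>\<close> by simp
  qed (simp_all only: xz[OF mem(1)] xz[OF mem(2)] xz[OF mem(3)] uz)
qed

text \<open>
  With \<open>t u\<^sub>0 = e\<close>, the map \<open>r \<mapsto> r d(u\<^sub>0)\<close> embeds \<open>R/tR\<close> into the cokernel of \<open>R \<rightarrow> M\<close>.  Composed with it,
  the homomorphism \<open>J \<rightarrow> R/tR\<close> that fixes \<open>a\<close> and kills \<open>t\<close> and \<open>b\<close> does not extend: a multiplier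
  \<open>r\<close> would satisfy both \<open>r - 1 \<in> J\<close> and \<open>r \<in> J\<close>.
\<close>

lemma first_cosyzygy_not_hom_extends:
  assumes M: "Module.module R M" and N: "Module.module R N"
    and d: "d \<in> LinearCombinations.module_hom R M N"
    and e: "e \<in> carrier M" "d e = \<zero>\<^bsub>N\<^esub>"
    and faithful: "\<And>r. r \<in> carrier R \<Longrightarrow> r \<odot>\<^bsub>M\<^esub> e = \<zero>\<^bsub>M\<^esub> \<Longrightarrow> r = \<zero>"
    and exact: "\<And>x. x \<in> carrier M \<Longrightarrow> d x = \<zero>\<^bsub>N\<^esub> \<Longrightarrow> \<exists>r\<in>carrier R. x = r \<odot>\<^bsub>M\<^esub> e"
    and ext_M: "hom_extends R M (carrier M) t \<zero> \<zero>"
  shows "\<not> hom_extends R N (d ` carrier M) t a b"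
proof
  assume ext_N: "hom_extends R N (d ` carrier M) t a b"
  interpret M: Module.module R M by fact
  interpret N: Module.module R N by fact
  interpret d: mod_hom R M N d using d by unfold_locales
  obtain u0 where u0: "u0 \<in> carrier M" "t \<odot>\<^bsub>M\<^esub> u0 = e"
    using divisible_if_hom_extends[OF M ext_M e(1)] by blast
  have tdu0: "t \<odot>\<^bsub>N\<^esub> d u0 = \<zero>\<^bsub>N\<^esub>" using u0 e d.f_smult[OF carr(1) u0(1)] by simp
  have duc: "d u0 \<in> carrier N" using u0 by simp
  have "\<exists>w\<in>d ` carrier M. t \<odot>\<^bsub>N\<^esub> w = \<zero>\<^bsub>N\<^esub> \<and> a \<odot>\<^bsub>N\<^esub> w = a \<odot>\<^bsub>N\<^esub> d u0 \<and> b \<odot>\<^bsub>N\<^esub> w = \<zero>\<^bsub>N\<^esub>"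
  proof (rule hom_extendsD[OF ext_N])
    show "\<zero>\<^bsub>N\<^esub> \<in> d ` carrier M" "\<zero>\<^bsub>N\<^esub> \<in> d ` carrier M"
      using imageI[OF M.zero_closed, of d] unfolding d.f0_is_0 by auto
    have "d (a \<odot>\<^bsub>M\<^esub> u0) = a \<odot>\<^bsub>N\<^esub> d u0" using u0 carr by simp
    then show "a \<odot>\<^bsub>N\<^esub> d u0 \<in> d ` carrier M"
      using imageI[OF M.smult_closed[OF carr(2) u0(1)], of d] by (simp only:)
    fix r1 r2 r3 assume r: "r1 \<in> carrier R" "r2 \<in> carrier R" "r3 \<in> carrier R"
      "r1 \<otimes> t \<oplus> r2 \<otimes> a \<oplus> r3 \<otimes> b = \<zero>"
    obtain s where s: "s \<in> carrier R" "r2 \<otimes> a = s \<otimes> t"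
      using rel[OF r] sq mem by blast
    have "r2 \<odot>\<^bsub>N\<^esub> (a \<odot>\<^bsub>N\<^esub> d u0) = (r2 \<otimes> a) \<odot>\<^bsub>N\<^esub> d u0"
      using r carr duc by (simp add: N.smult_assoc1)
    also have "\<dots> = \<zero>\<^bsub>N\<^esub>"
      unfolding s using s carr duc tdu0 by (simp add: N.smult_assoc1)
    finally show "r1 \<odot>\<^bsub>N\<^esub> \<zero>\<^bsub>N\<^esub> \<oplus>\<^bsub>N\<^esub> r2 \<odot>\<^bsub>N\<^esub> (a \<odot>\<^bsub>N\<^esub> d u0) \<oplus>\<^bsub>N\<^esub> r3 \<odot>\<^bsub>N\<^esub> \<zero>\<^bsub>N\<^esub> = \<zero>\<^bsub>N\<^esub>"
      using r by simp
  qed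
  then obtain u where u: "u \<in> carrier M" and du: "t \<odot>\<^bsub>N\<^esub> d u = \<zero>\<^bsub>N\<^esub>"
    "a \<odot>\<^bsub>N\<^esub> d u = a \<odot>\<^bsub>N\<^esub> d u0" "b \<odot>\<^bsub>N\<^esub> d u = \<zero>\<^bsub>N\<^esub>" by blast
  have "d (t \<odot>\<^bsub>M\<^esub> u) = \<zero>\<^bsub>N\<^esub>" using u du carr by simp
  then obtain r where r: "r \<in> carrier R" "t \<odot>\<^bsub>M\<^esub> u = r \<odot>\<^bsub>M\<^esub> e"
    using exact[of "t \<odot>\<^bsub>M\<^esub> u"] u carr by auto
  have t_swap: "t \<odot>\<^bsub>M\<^esub> (x \<odot>\<^bsub>M\<^esub> y) = x \<odot>\<^bsub>M\<^esub> (t \<odot>\<^bsub>M\<^esub> y)" if "x \<in> carrier R" "y \<in> carrier M" for x y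
    using that carr by (metis M.smult_assoc1 m_comm)
  have "d (a \<odot>\<^bsub>M\<^esub> u \<ominus>\<^bsub>M\<^esub> a \<odot>\<^bsub>M\<^esub> u0) = \<zero>\<^bsub>N\<^esub>"
    using u u0 du carr duc by (simp add: a_minus_def N.r_neg)
  then obtain s where s: "s \<in> carrier R" "a \<odot>\<^bsub>M\<^esub> u \<ominus>\<^bsub>M\<^esub> a \<odot>\<^bsub>M\<^esub> u0 = s \<odot>\<^bsub>M\<^esub> e"
    using exact[of "a \<odot>\<^bsub>M\<^esub> u \<ominus>\<^bsub>M\<^esub> a \<odot>\<^bsub>M\<^esub> u0"] u u0 carr by auto
  \<comment> \<open>Since \<open>r e = t u\<close> and \<open>e = t u0\<close>, the elements
    \<open>a r e\<close> and \<open>a e\<close> are multiples of \<open>t\<close> in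
    \<open>M\<close>, and their difference is \<open>t s e\<close>. Cancelling the faithful
    \<open>e\<close> leaves a relation between \<open>t\<close> and \<open>a\<close>, to which
    \<open>rel\<close> applies.\<close>
  have "(a \<otimes> r \<ominus> a \<ominus> t \<otimes> s) \<odot>\<^bsub>M\<^esub> e =
      a \<odot>\<^bsub>M\<^esub> (r \<odot>\<^bsub>M\<^esub> e) \<ominus>\<^bsub>M\<^esub> a \<odot>\<^bsub>M\<^esub> e \<ominus>\<^bsub>M\<^esub> t \<odot>\<^bsub>M\<^esub> (s \<odot>\<^bsub>M\<^esub> e)"
    using carr r s e by (simp add: M.smult_l_diff M.smult_assoc1)
  also have "a \<odot>\<^bsub>M\<^esub> (r \<odot>\<^bsub>M\<^esub> e) \<ominus>\<^bsub>M\<^esub> a \<odot>\<^bsub>M\<^esub> e = t \<odot>\<^bsub>M\<^esub> (a \<odot>\<^bsub>M\<^esub> u \<ominus>\<^bsub>M\<^esub> a \<odot>\<^bsub>M\<^esub> u0)"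
    using carr u u0 by (simp add: t_swap a_minus_def M.smult_r_distr M.smult_r_minus r(2))
  also have "\<dots> \<ominus>\<^bsub>M\<^esub> t \<odot>\<^bsub>M\<^esub> (s \<odot>\<^bsub>M\<^esub> e) = \<zero>\<^bsub>M\<^esub>" unfolding s(2) using carr s e by (simp add: a_minus_def M.r_neg)
  finally have "a \<otimes> r \<ominus> a \<ominus> t \<otimes> s = \<zero>"
    using faithful carr r s by simp
  moreover have "(\<ominus> s) \<otimes> t \<oplus> (r \<ominus> \<one>) \<otimes> a \<oplus> \<zero> \<otimes> b = a \<otimes> r \<ominus> a \<ominus> t \<otimes> s"
    using carr r s by algebra
  ultimately have rJ1: "r \<ominus> \<one> \<in> J"
    using rel[of "\<ominus> s" "r \<ominus> \<one>" \<zero>] r s by simp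
  have "d (b \<odot>\<^bsub>M\<^esub> u) = \<zero>\<^bsub>N\<^esub>" using u du carr by simp
  then obtain q where q: "q \<in> carrier R" "b \<odot>\<^bsub>M\<^esub> u = q \<odot>\<^bsub>M\<^esub> e"
    using exact[of "b \<odot>\<^bsub>M\<^esub> u"] u carr by auto
  have "(b \<otimes> r \<ominus> t \<otimes> q) \<odot>\<^bsub>M\<^esub> e = b \<odot>\<^bsub>M\<^esub> (r \<odot>\<^bsub>M\<^esub> e) \<ominus>\<^bsub>M\<^esub> t \<odot>\<^bsub>M\<^esub> (q \<odot>\<^bsub>M\<^esub> e)"
    using carr r q e by (simp add: M.smult_l_diff M.smult_assoc1)
  also have "\<dots> = \<zero>\<^bsub>M\<^esub>"
    unfolding r(2)[symmetric] q(2)[symmetric]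
    using carr u by (simp add: t_swap a_minus_def M.r_neg)
  finally have "b \<otimes> r \<ominus> t \<otimes> q = \<zero>"
    using faithful carr r q by simp
  moreover have "(\<ominus> q) \<otimes> t \<oplus> \<zero> \<otimes> a \<oplus> r \<otimes> b = b \<otimes> r \<ominus> t \<otimes> q"
    using carr r q by algebra
  ultimately have "r \<in> J"
    using rel[of "\<ominus> q" \<zero> r] r q by simp
  with rJ1 have "r \<ominus> (r \<ominus> \<one>) \<in> J" by (simp add: a_minus_def a_closed a_inv_closed)
  moreover have "r \<ominus> (r \<ominus> \<one>) = \<one>" using r(1) by algebra
  ultimately show False using one_notin by simp
qed

text \<open>Each cosyzygy is used in two ways: as the image of \<open>d i\<close> it inherits
  divisibility by \<open>t\<close> from an injective module, and as the kernel of
  \<open>d (Suc i)\<close> it fits \<open>hom_extends_kernel\<close>. The descent arrives at the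
  image of \<open>d 0\<close>, where \<open>first_cosyzygy_not_hom_extends\<close> contradicts
  it.\<close>

theorem not_finite_injective_dim:
  fixes U :: "'i itself"
  shows "\<not> finite_injective_dim U R (mult_module R (carrier R))"
proof
  assume "finite_injective_dim U R (mult_module R (carrier R))"
  then obtain I :: "nat \<Rightarrow> ('a, 'i) module" and e d n where inj: "\<And>i. injective_module R (I i)"
    and zero: "\<And>i. i > n \<Longrightarrow> carrier (I i) = {\<zero>\<^bsub>I i\<^esub>}"
    and e: "e \<in> LinearCombinations.module_hom R (mult_module R (carrier R)) (I 0)"
    and d: "\<And>i. d i \<in> LinearCombinations.module_hom R (I i) (I (Suc i))"
    and e_inj: "inj_on e (carrier (mult_module R (carrier R)))"
    and e_im: "e ` carrier (mult_module R (carrier R)) = {x \<in> carrier (I 0). d 0 x = \<zero>\<^bsub>I 1\<^esub>}"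
    and d_im: "\<And>i. d i ` carrier (I i) =
               {x \<in> carrier (I (Suc i)). d (Suc i) x = \<zero>\<^bsub>I (Suc (Suc i))\<^esub>}"
    unfolding finite_injective_dim_def
    by (elim conjE exE, intro that) (assumption | erule spec | (erule allE, erule mp, assumption))+
  have carr_R: "carrier (mult_module R (carrier R)) = carrier R" by (simp add: mult_module_def)
  note e_inj = e_inj[unfolded carr_R] and e_im = e_im[unfolded carr_R]
  have mod: "Module.module R (I i)" for i using inj by (simp add: injective_module_def)
  have ext: "hom_extends R (I i) (carrier (I i)) x y w"
    if "x \<in> carrier R" "y \<in> carrier R" "w \<in> carrier R" for i x y w
    by (rule injective_hom_extends[OF is_cring inj that])
  have ext_t: "hom_extends R (I i) (carrier (I i)) t \<zero> \<zero>" for i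
    by (rule ext) (use carr in auto)
  have ker: "hom_extends R (I (Suc i)) (d i ` carrier (I i)) t a b" for i
  \<comment> \<open>Truncated subtraction puts every \<open>i > n\<close> into the base case, where
    \<open>I (Suc i)\<close> is zero.\<close>
  proof (induction "Suc n - i" arbitrary: i)
    case 0
    interpret M: Module.module R "I (Suc i)" by (rule mod)
    interpret d: mod_hom R "I i" "I (Suc i)" "d i"
      by (intro mod_hom.intro mod_hom_axioms.intro mod d)
    have "d i ` carrier (I i) = {\<zero>\<^bsub>I (Suc i)\<^esub>}"
    proof -
      have "carrier (I (Suc i)) = {\<zero>\<^bsub>I (Suc i)\<^esub>}" using 0 by (intro zero) simp
      moreover have "d i ` carrier (I i) \<subseteq> carrier (I (Suc i))" by auto
      moreover have "d i ` carrier (I i) \<noteq> {}"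
        using d.M.zero_closed by auto
      ultimately show ?thesis by (simp only: subset_singleton_iff) simp
    qed
    then show ?case unfolding hom_extends_def using carr by simp
  next
    case (Suc k)
    have IH: "hom_extends R (I (Suc (Suc i))) (d (Suc i) ` carrier (I (Suc i))) t a b"
      using Suc by simp
    interpret d: mod_hom R "I i" "I (Suc i)" "d i"
      by (intro mod_hom.intro mod_hom_axioms.intro mod d)
    show ?case unfolding d_im
    proof (rule hom_extends_kernel[OF mod mod d ext[OF carr] IH])
      \<comment> \<open>Exactness lets the division by \<open>t\<close> take place one step earlier,
        in the injective module \<open>I i\<close>.\<close>
      fix z assume "z \<in> carrier (I (Suc i))" "d (Suc i) z = \<zero>\<^bsub>I (Suc (Suc i))\<^esub>"
      then have "z \<in> d i ` carrier (I i)" unfolding d_im by simp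
      then obtain x where x: "x \<in> carrier (I i)" "z = d i x" by blast
      obtain y where y: "y \<in> carrier (I i)" "t \<odot>\<^bsub>I i\<^esub> y = x"
        using divisible_if_hom_extends[OF mod ext_t x(1)] by blast
      have "d i y \<in> {x \<in> carrier (I (Suc i)). d (Suc i) x = \<zero>\<^bsub>I (Suc (Suc i))\<^esub>}"
        unfolding d_im[symmetric] using y by simp
      moreover have "t \<odot>\<^bsub>I (Suc i)\<^esub> d i y = z" unfolding x(2) y(2)[symmetric] by (rule d.f_smult[OF carr(1) y(1), symmetric])
      ultimately show "\<exists>y\<in>carrier (I (Suc i)). d (Suc i) y = \<zero>\<^bsub>I (Suc (Suc i))\<^esub> \<and> t \<odot>\<^bsub>I (Suc i)\<^esub> y = z"
        by blast
    qed
  qed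
  interpret I0: Module.module R "I 0" by (rule mod)
  have er: "e r = r \<odot>\<^bsub>I 0\<^esub> e \<one>" if "r \<in> carrier R" for r
    using LinearCombinations.module_hom_smult[OF e that, of \<one>] that by (simp add: mult_module_def)
  have e0: "e \<zero> = \<zero>\<^bsub>I 0\<^esub>"
  proof -
    have "e \<one> \<in> carrier (I 0)" using LinearCombinations.module_hom_closed[OF e] by (auto simp: mult_module_def)
    then show ?thesis using er[of \<zero>] by simp
  qed
  have "\<not> hom_extends R (I (Suc 0)) (d 0 ` carrier (I 0)) t a b"
  proof (rule first_cosyzygy_not_hom_extends[OF mod mod d, where e = "e \<one>"])
    show "e \<one> \<in> carrier (I 0)" "d 0 (e \<one>) = \<zero>\<^bsub>I (Suc 0)\<^esub>" using e_im by auto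
    show "r = \<zero>" if "r \<in> carrier R" "r \<odot>\<^bsub>I 0\<^esub> e \<one> = \<zero>\<^bsub>I 0\<^esub>" for r
    proof -
      have "e r = e \<zero>" using er[OF that(1)] that(2) e0 by simp
      then show ?thesis using inj_onD[OF e_inj] that(1) by blast
    qed
    show "\<exists>r\<in>carrier R. x = r \<odot>\<^bsub>I 0\<^esub> e \<one>"
      if x: "x \<in> carrier (I 0)" "d 0 x = \<zero>\<^bsub>I (Suc 0)\<^esub>" for x
    proof -
      have "x \<in> e ` carrier R" unfolding e_im using x by simp
      then obtain r where "r \<in> carrier R" "x = e r" by blast
      moreover from this have "x = r \<odot>\<^bsub>I 0\<^esub> e \<one>" using er[of r] by (simp only:)
      ultimately show ?thesis by blast
    qed
    show "hom_extends R (I 0) (carrier (I 0)) t \<zero> \<zero>" by (rule ext_t)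
  qed
  then show False using ker[of 0] by (rule notE)
qed

end


section \<open>Krull dimension and generators of the maximal ideal\<close>

text \<open>In a Noetherian ring a nonempty chain of ideals contains its union, so Zorn's lemma
  applies to any property of ideals that holds somewhere.\<close>

lemma (in noetherian_ring) maximal_ideal_satisfying:
  assumes "P I" and ideal: "\<And>I. P I \<Longrightarrow> ideal I R"
  obtains M where "P M" "\<forall>K. P K \<longrightarrow> M \<subseteq> K \<longrightarrow> K = M"
proof -
  have "\<exists>M\<in>{I. P I}. \<forall>K\<in>{I. P I}. M \<subseteq> K \<longrightarrow> K = M"
  proof (rule subset_Zorn)
    fix C assume C: "subset.chain {I. P I} C"
    show "\<exists>U\<in>{I. P I}. \<forall>I\<in>C. I \<subseteq> U"
    proof (cases "C = {}")
      case True
      then show ?thesis using assms(1) by blast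
    next
      case False
      moreover have "subset.chain {I. ideal I R} C"
        using C ideal unfolding pred_on.chain_def by blast
      ultimately have "\<Union>C \<in> C" by (rule ideal_chain_is_trivial)
      moreover have "C \<subseteq> {I. P I}" using C unfolding pred_on.chain_def by blast
      ultimately show ?thesis by (meson Union_upper subsetD)
    qed
  qed
  then show thesis using that by auto
qed

lemma (in noetherian_ring) exists_maximalideal_above:
  assumes "ideal I R" "I \<noteq> carrier R"
  obtains M where "maximalideal M R" "I \<subseteq> M"
proof -
  let ?P = "\<lambda>K. ideal K R \<and> K \<noteq> carrier R \<and> I \<subseteq> K"
  have "?P I" "\<And>K. ?P K \<Longrightarrow> ideal K R" using assms by simp_all
  then obtain M where M: "?P M" and max: "\<forall>K. ?P K \<longrightarrow> M \<subseteq> K \<longrightarrow> K = M"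
    by (rule maximal_ideal_satisfying[of ?P])
  have "maximalideal M R"
  proof (rule maximalidealI)
    fix K assume "ideal K R" "M \<subseteq> K"
    then show "K = M \<or> K = carrier R" using max M by auto
  qed (use M in auto)
  then show thesis using that M by blast
qed

lemma (in cring) Units_if_not_mem_maximal:
  assumes "noetherian_ring R" and unique: "\<And>M. maximalideal M R \<Longrightarrow> M = J"
    and x: "x \<in> carrier R" "x \<notin> J"
  shows "x \<in> Units R"
proof (rule ccontr)
  interpret noetherian_ring R by fact
  assume "x \<notin> Units R"
  then have "PIdl x \<noteq> carrier R" using ideal_eq_carrier_iff[OF x(1)] by simp
  then obtain M where "maximalideal M R" "PIdl x \<subseteq> M"
    using exists_maximalideal_above[OF cgenideal_ideal[OF x(1)]] by blast
  then show False using unique cgenideal_self[OF x(1)] x(2) by blast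
qed

lemma (in cring) ideal_add_cgenideal:
  assumes M: "ideal M R" and x: "x \<in> carrier R"
  shows "ideal (M <+>\<^bsub>R\<^esub> PIdl x) R" "M \<subseteq> M <+>\<^bsub>R\<^esub> PIdl x" "x \<in> M <+>\<^bsub>R\<^esub> PIdl x"
proof -
  interpret M: ideal M R by fact
  have "m \<oplus> r \<otimes> x \<in> M <+>\<^bsub>R\<^esub> PIdl x" if "m \<in> M" "r \<in> carrier R" for m r
    using that unfolding set_add_def' cgenideal_def by blast
  note mem = this
  show "ideal (M <+>\<^bsub>R\<^esub> PIdl x) R" by (rule add_ideals[OF M cgenideal_ideal[OF x]])
  show "M \<subseteq> M <+>\<^bsub>R\<^esub> PIdl x"
  proof
    fix m assume "m \<in> M"
    then show "m \<in> M <+>\<^bsub>R\<^esub> PIdl x" using mem[of m \<zero>] x M.Icarr by simp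
  qed
  show "x \<in> M <+>\<^bsub>R\<^esub> PIdl x" using mem[of \<zero> \<one>] x M.zero_closed by simp
qed

text \<open>An ideal \<open>M\<close> maximal among those without powers of \<open>t\<close> is
  prime: if \<open>a\<close> and \<open>b\<close> lie outside, then \<open>M + (a)\<close> and
  \<open>M + (b)\<close> contain powers of \<open>t\<close>, and the product of these powers lies in
  \<open>M + (a b)\<close>. This supplies the lower prime in the proof that the Krull dimension is
  at least 1.\<close>

lemma (in cring) exists_primeideal_not_mem:
  assumes "noetherian_ring R" and t: "t \<in> carrier R" and pow: "\<And>n::nat. t [^] n \<noteq> \<zero>"
  shows "\<exists>Q. primeideal Q R \<and> t \<notin> Q"
proof -
  interpret noetherian_ring R by fact
  let ?P = "\<lambda>I. ideal I R \<and> (\<forall>n::nat. t [^] n \<notin> I)"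
  have "?P {\<zero>}" "\<And>I. ?P I \<Longrightarrow> ideal I R" using zeroideal pow by simp_all
  then obtain M where M: "?P M" and max: "\<forall>I. ?P I \<longrightarrow> M \<subseteq> I \<longrightarrow> I = M"
    by (rule maximal_ideal_satisfying[of ?P])
  have M: "ideal M R" "\<And>n::nat. t [^] n \<notin> M" using M by simp_all
  interpret M: ideal M R by fact
  have pow_in: "\<exists>n::nat. \<exists>m\<in>M. \<exists>r\<in>carrier R. t [^] n = m \<oplus> r \<otimes> x"
    if x: "x \<in> carrier R" "x \<notin> M" for x
  proof (rule ccontr)
    assume no: "\<not> ?thesis"
    note N = ideal_add_cgenideal[OF M(1) x(1)]
    have "M <+>\<^bsub>R\<^esub> PIdl x = M"
      by (rule max[rule_format, OF conjI[OF N(1)] N(2)]) (use no in \<open>auto simp: set_add_def' cgenideal_def\<close>)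
    then show False using N(3) x(2) by simp
  qed
  have "primeideal M R"
  proof (rule primeidealI[OF M(1) is_cring])
    show "carrier R \<noteq> M"
    proof
      assume eq: "carrier R = M"
      have "t [^] (0::nat) \<in> carrier R" using t by (rule nat_pow_closed)
      then show False using M(2)[of 0] unfolding eq by contradiction
    qed
    fix a b assume ab: "a \<in> carrier R" "b \<in> carrier R" "a \<otimes> b \<in> M"
    show "a \<in> M \<or> b \<in> M"
    proof (rule ccontr)
      assume "\<not> (a \<in> M \<or> b \<in> M)"
      then have nM: "a \<notin> M" "b \<notin> M" by simp_all
      obtain n :: nat and m r where 1: "m \<in> M" "r \<in> carrier R" "t [^] n = m \<oplus> r \<otimes> a"
        using pow_in[OF ab(1) nM(1)] by auto
      obtain k :: nat and m' r' where 2: "m' \<in> M" "r' \<in> carrier R" "t [^] k = m' \<oplus> r' \<otimes> b"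
        using pow_in[OF ab(2) nM(2)] by auto
      have "t [^] (n + k) = (m \<oplus> r \<otimes> a) \<otimes> (m' \<oplus> r' \<otimes> b)"
        using t 1 2 by (simp flip: nat_pow_mult)
      also have "\<dots> = m \<otimes> (m' \<oplus> r' \<otimes> b) \<oplus> (r \<otimes> a) \<otimes> m' \<oplus> (r \<otimes> r') \<otimes> (a \<otimes> b)"
        using M.Icarr[OF 1(1)] M.Icarr[OF 2(1)] 1(2) 2(2) ab by algebra
      also have "\<dots> \<in> M"
      proof (intro M.a_closed)
        show "m \<otimes> (m' \<oplus> r' \<otimes> b) \<in> M" using 1 2 ab M.Icarr[OF 2(1)] by (intro M.I_r_closed) auto
        show "r \<otimes> a \<otimes> m' \<in> M" using 1 2 ab by (intro M.I_l_closed) auto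
        show "r \<otimes> r' \<otimes> (a \<otimes> b) \<in> M" by (rule M.I_l_closed[OF ab(3) m_closed[OF 1(2) 2(2)]])
      qed
      finally show False using M(2) by blast
    qed
  qed
  then show ?thesis using M(2)[of 1] t by (metis nat_pow_eone)
qed

lemma (in ideal) unit_mult_mem:
  assumes "cring R" "u \<in> Units R" "x \<in> carrier R" "u \<otimes> x \<in> I"
  shows "x \<in> I"
proof -
  interpret cring R by fact
  have "inv u \<otimes> (u \<otimes> x) \<in> I" by (rule I_l_closed[OF assms(4)]) (use assms(2) in auto)
  moreover have "inv u \<otimes> (u \<otimes> x) = x" 
    using assms(2,3) by (metis Units_closed Units_inv_closed Units_l_inv l_one m_assoc)
  ultimately show ?thesis by simp
qed

lemma (in ideal) add_memD:
  assumes "x \<in> carrier R" "y \<in> I" "x \<oplus> y \<in> I"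
  shows "x \<in> I"
proof -
  have "(x \<oplus> y) \<oplus> (\<ominus> y) \<in> I" 
    by (rule additive_subgroup.a_closed[OF is_additive_subgroup assms(3)
          additive_subgroup.a_inv_closed[OF is_additive_subgroup assms(2)]])
  moreover have "(x \<oplus> y) \<oplus> (\<ominus> y) = x" using assms(1) Icarr[OF assms(2)] by algebra
  ultimately show ?thesis by simp
qed

text \<open>
  \<open>R\<close> is the local ring \<open>\<^bold>C\<close> or a localization of \<open>\<^bold>C\<close>, and \<open>E\<close> is the image of \<open>\<^bold>D\<close> in it.  The condition
  \<open>dependent\<close> is all that is kept of the rank being at most 3; the unit coefficient makes the
  relation survive reduction modulo \<open>t\<close>.
\<close>

locale local_order = cring R + noetherian_ring R for R (structure) +
  fixes J E t
  assumes maximal: "maximalideal J R"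
    and unique: "\<And>M. maximalideal M R \<Longrightarrow> M = J"
    and t_mem: "t \<in> J"
    and nzd: "\<And>r. r \<in> carrier R \<Longrightarrow> r \<otimes> t = \<zero> \<Longrightarrow> r = \<zero>"
    and E_sub: "E \<subseteq> carrier R"
    and E_cases: "\<And>d. d \<in> E \<Longrightarrow> d \<in> Units R \<or> (\<exists>r\<in>carrier R. d = r \<otimes> t)"
    and E_prime: "\<And>d Q. d \<in> E \<Longrightarrow> d \<noteq> \<zero> \<Longrightarrow> primeideal Q R \<Longrightarrow> d \<in> Q \<Longrightarrow> t \<in> Q"
    and dependent: "\<And>x0 x1 x2 x3. x0 \<in> carrier R \<Longrightarrow> x1 \<in> carrier R \<Longrightarrow> x2 \<in> carrier R \<Longrightarrow> x3 \<in> carrier R \<Longrightarrow>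
      \<exists>d0\<in>E. \<exists>d1\<in>E. \<exists>d2\<in>E. \<exists>d3\<in>E. (d0 \<in> Units R \<or> d1 \<in> Units R \<or> d2 \<in> Units R \<or> d3 \<in> Units R) \<and>
        d0 \<otimes> x0 \<oplus> d1 \<otimes> x1 \<oplus> d2 \<otimes> x2 \<oplus> d3 \<otimes> x3 = \<zero>"
begin

section \<open>Units, prime ideals and Krull dimension of a local order\<close>

sublocale J: maximalideal J R by (rule maximal)

lemma t_carr: "t \<in> carrier R" using t_mem J.Icarr by blast

lemma one_notin: "\<one> \<notin> J"
  using J.I_notcarr J.one_imp_carrier by blast

lemma one_neq_zero: "\<one> \<noteq> \<zero>"
  using one_notin J.zero_closed by auto

lemma Units_iff: "x \<in> carrier R \<Longrightarrow> x \<in> Units R \<longleftrightarrow> x \<notin> J"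
proof
  assume "x \<in> carrier R" "x \<notin> J"
  then show "x \<in> Units R" by (intro Units_if_not_mem_maximal[OF noetherian_ring_axioms unique])
next
  assume x: "x \<in> Units R"
  show "x \<notin> J"
  proof
    assume "x \<in> J"
    then have "inv x \<otimes> x \<in> J" by (rule J.I_l_closed) (use x in auto)
    then show False using x one_notin by simp
  qed
qed

lemma local: "local_ring R"
  unfolding local_ring_def by (intro conjI is_cring ex1I[of _ J] maximal unique)

lemma the_maximal: "the_maximal_ideal R = J"
  unfolding the_maximal_ideal_def by (intro the_equality maximal unique)

lemma primeideal_sub:
  assumes "primeideal Q R"
  shows "Q \<subseteq> J"
proof -
  interpret Q: primeideal Q R by fact
  obtain M where "maximalideal M R" "Q \<subseteq> M"
    using exists_maximalideal_above[OF Q.is_ideal Q.I_notcarr[symmetric]] .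
  then show ?thesis using unique by simp
qed

lemma E_nonunit:
  assumes "d \<in> E" "d \<notin> Units R" "ideal I R" "t \<in> I"
  shows "d \<in> I"
proof -
  obtain r where "r \<in> carrier R" "d = r \<otimes> t" using E_cases[OF assms(1)] assms(2) by blast
  then show ?thesis using ideal.I_l_closed[OF assms(3,4)] by simp
qed

text \<open>Horner form allows the coefficients to be stripped one at a time, beginning with the
  constant one. The trailing \<open>x \<otimes> \<zero>\<close> gives all four stages the same shape
  \<open>d \<oplus> x \<otimes> c\<close>.\<close>

lemma horner_dependent:
  assumes "x \<in> carrier R"
  shows "\<exists>d0\<in>E. \<exists>d1\<in>E. \<exists>d2\<in>E. \<exists>d3\<in>E. (d0 \<in> Units R \<or> d1 \<in> Units R \<or> d2 \<in> Units R \<or> d3 \<in> Units R) \<and>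
    d0 \<oplus> x \<otimes> (d1 \<oplus> x \<otimes> (d2 \<oplus> x \<otimes> (d3 \<oplus> x \<otimes> \<zero>))) = \<zero>"
proof -
  obtain d0 d1 d2 d3 where d: "d0 \<in> E" "d1 \<in> E" "d2 \<in> E" "d3 \<in> E"
    and u: "d0 \<in> Units R \<or> d1 \<in> Units R \<or> d2 \<in> Units R \<or> d3 \<in> Units R"
    and eq: "d0 \<otimes> \<one> \<oplus> d1 \<otimes> x \<oplus> d2 \<otimes> (x \<otimes> x) \<oplus> d3 \<otimes> (x \<otimes> x \<otimes> x) = \<zero>"
    using dependent[OF one_closed assms m_closed[OF assms assms] m_closed[OF m_closed[OF assms assms] assms]]
    by (elim bexE conjE) (rule that)
  have "d0 \<in> carrier R" "d1 \<in> carrier R" "d2 \<in> carrier R" "d3 \<in> carrier R" using d E_sub by auto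
  then have "d0 \<otimes> \<one> \<oplus> d1 \<otimes> x \<oplus> d2 \<otimes> (x \<otimes> x) \<oplus> d3 \<otimes> (x \<otimes> x \<otimes> x) =
    d0 \<oplus> x \<otimes> (d1 \<oplus> x \<otimes> (d2 \<oplus> x \<otimes> (d3 \<oplus> x \<otimes> \<zero>)))"
    using assms by algebra
  with eq have "d0 \<oplus> x \<otimes> (d1 \<oplus> x \<otimes> (d2 \<oplus> x \<otimes> (d3 \<oplus> x \<otimes> \<zero>))) = \<zero>" by simp
  with d u show ?thesis by blast
qed

text \<open>The relation starts in \<open>Q\<close> because it is zero; after four steps every
  coefficient is a nonunit, against the choice of the relation. The two facts about chains of primes
  below are instances that differ only in how a single step is justified.\<close>

lemma horner_peel:
  assumes x: "x \<in> carrier R" and "ideal Q R"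
    and step: "\<And>d c. d \<in> E \<Longrightarrow> c \<in> carrier R \<Longrightarrow> d \<oplus> x \<otimes> c \<in> Q \<Longrightarrow> d \<notin> Units R \<and> c \<in> Q"
  shows False
proof -
  obtain d0 d1 d2 d3 where d: "d0 \<in> E" "d1 \<in> E" "d2 \<in> E" "d3 \<in> E"
    and u: "d0 \<in> Units R \<or> d1 \<in> Units R \<or> d2 \<in> Units R \<or> d3 \<in> Units R"
    and eq: "d0 \<oplus> x \<otimes> (d1 \<oplus> x \<otimes> (d2 \<oplus> x \<otimes> (d3 \<oplus> x \<otimes> \<zero>))) = \<zero>"
    using horner_dependent[OF x] by (elim bexE conjE) (rule that)
  have c: "d0 \<in> carrier R" "d1 \<in> carrier R" "d2 \<in> carrier R" "d3 \<in> carrier R" using d E_sub by auto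
  have "d0 \<oplus> x \<otimes> (d1 \<oplus> x \<otimes> (d2 \<oplus> x \<otimes> (d3 \<oplus> x \<otimes> \<zero>))) \<in> Q"
    unfolding eq using assms(2) by (simp add: ideal_def additive_subgroup.zero_closed)
  from step[OF d(1) _ this] x c
  have 0: "d0 \<notin> Units R" "d1 \<oplus> x \<otimes> (d2 \<oplus> x \<otimes> (d3 \<oplus> x \<otimes> \<zero>)) \<in> Q" by auto
  from step[OF d(2) _ 0(2)] x c
  have 1: "d1 \<notin> Units R" "d2 \<oplus> x \<otimes> (d3 \<oplus> x \<otimes> \<zero>) \<in> Q" by auto
  from step[OF d(3) _ 1(2)] x c
  have 2: "d2 \<notin> Units R" "d3 \<oplus> x \<otimes> \<zero> \<in> Q" by auto
  from step[OF d(4) _ 2(2)] have "d3 \<notin> Units R" by auto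
  with 0 1 2 u show False by auto
qed

text \<open>Take \<open>x\<close> in \<open>J\<close> outside \<open>Q\<close>. The constant
  coefficient lies in \<open>J\<close>, so it is a multiple of \<open>t\<close> and vanishes modulo
  \<open>Q\<close>; primality then cancels \<open>x\<close>, and the rest of the relation lies in
  \<open>Q\<close> again.\<close>

lemma prime_with_t:
  assumes "primeideal Q R" "t \<in> Q"
  shows "Q = J"
proof
  interpret Q: primeideal Q R by fact
  show QJ: "Q \<subseteq> J" by (rule primeideal_sub[OF assms(1)])
  show "J \<subseteq> Q"
  proof (rule subsetI, rule ccontr)
    fix x assume x: "x \<in> J" "x \<notin> Q"
    note xc = J.Icarr[OF x(1)]
    show False
    proof (rule horner_peel[OF xc Q.is_ideal])
      fix d c assume d: "d \<in> E" and c: "c \<in> carrier R" and dc: "d \<oplus> x \<otimes> c \<in> Q"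
      have dR: "d \<in> carrier R" using d E_sub by blast
      have "d \<in> J"
        using J.add_memD[OF dR J.I_r_closed[OF x(1) c]] dc QJ by blast
      then have du: "d \<notin> Units R" using Units_iff[OF dR] by blast
      then have "d \<in> Q" using E_nonunit[OF d _ Q.is_ideal assms(2)] by blast
      then have "x \<otimes> c \<in> Q" using Q.add_memD[of "x \<otimes> c" d] dc xc c dR by (simp add: a_comm)
      with du show "d \<notin> Units R \<and> c \<in> Q" using Q.I_prime[OF xc c] x(2) by blast
    qed
  qed
qed

text \<open>If \<open>t\<close> were outside \<open>P\<close>, then \<open>P\<close> would contain
  no nonzero element of \<open>E\<close>, so the constant coefficient, which lies in
  \<open>P\<close>, would be zero. This is the incomparability of primes in an algebraic
  extension.\<close>

lemma t_mem_upper_prime: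
  assumes "primeideal Q R" "primeideal P R" "Q \<subset> P"
  shows "t \<in> P"
proof (rule ccontr)
  interpret Q: primeideal Q R by fact
  interpret P: primeideal P R by fact
  assume t: "t \<notin> P"
  obtain x where x: "x \<in> P" "x \<notin> Q" using assms(3) by blast
  note xc = P.Icarr[OF x(1)]
  show False
  proof (rule horner_peel[OF xc Q.is_ideal])
    fix d c assume d: "d \<in> E" and c: "c \<in> carrier R" and dc: "d \<oplus> x \<otimes> c \<in> Q"
    have dR: "d \<in> carrier R" using d E_sub by blast
    have "d \<in> P"
      using P.add_memD[OF dR P.I_r_closed[OF x(1) c]] dc assms(3) by blast
    then have d0: "d = \<zero>" using E_prime[OF d _ assms(2)] t by blast
    then have "x \<otimes> c \<in> Q" using dc xc c by simp
    moreover have "d \<notin> Units R" using d0 Units_iff J.zero_closed by auto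
    ultimately show "d \<notin> Units R \<and> c \<in> Q" using Q.I_prime[OF xc c] x(2) by blast
  qed
qed

text \<open>The middle prime contains \<open>t\<close>, hence equals \<open>J\<close>, and no prime
  lies above \<open>J\<close>.\<close>

lemma no_long_chain:
  assumes "primeideal P0 R" "primeideal P1 R" "primeideal P2 R" "P0 \<subset> P1" "P1 \<subset> P2"
  shows False
  using t_mem_upper_prime[OF assms(1,2,4)] prime_with_t[OF assms(2)] primeideal_sub[OF assms(3)] assms(5)
  by blast

lemma t_pow_neq_zero: "t [^] (n::nat) \<noteq> \<zero>"
proof (induction n)
  case 0 then show ?case using one_neq_zero by simp
next
  case (Suc n) then show ?case using nzd[of "t [^] n"] t_carr by auto
qed

theorem krull_dim_eq_1: "krull_dim R = 1"
proof -
  let ?S = "{enat n | n. \<exists>P :: nat \<Rightarrow> 'a set. (\<forall>i\<le>n. primeideal (P i) R) \<and> (\<forall>i<n. P i \<subset> P (Suc i))}"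
  obtain Q where Q: "primeideal Q R" "t \<notin> Q"
    using exists_primeideal_not_mem[OF noetherian_ring_axioms t_carr t_pow_neq_zero] by blast
  have JP: "primeideal J R" by (rule maximalideal_prime[OF maximal])
  have "Q \<subset> J" using primeideal_sub[OF Q(1)] Q(2) t_mem by blast
  then have "\<exists>P :: nat \<Rightarrow> 'a set. (\<forall>i\<le>1. primeideal (P i) R) \<and> (\<forall>i<1. P i \<subset> P (Suc i))"
    using Q JP by (intro exI[of _ "\<lambda>i. if i = 0 then Q else J"]) auto
  then have "enat 1 \<in> ?S" by blast
  moreover have "x \<le> enat 1" if x: "x \<in> ?S" for x
  proof -
    obtain n and P :: "nat \<Rightarrow> 'a set" where n: "x = enat n"
      and P: "\<And>i. i \<le> n \<Longrightarrow> primeideal (P i) R" "\<And>i. i < n \<Longrightarrow> P i \<subset> P (Suc i)"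
      using x by blast
    have "\<not> 2 \<le> n"
    proof
      assume "2 \<le> n"
      then show False
        using no_long_chain[of "P 0" "P 1" "P 2"] P(1)[of 0] P(1)[of 1] P(1)[of 2] P(2)[of 0] P(2)[of 1]
        by (simp add: numeral_2_eq_2)
    qed
    then show ?thesis unfolding n by simp
  qed
  ultimately have "Sup ?S = enat 1" by (intro antisym Sup_least Sup_upper)
  then show ?thesis unfolding krull_dim_def by (simp add: one_enat_def)
qed

text \<open>That two classes span J/J^2 becomes an inclusion of ideals,
  \<open>J \<subseteq> gen2 x y\<close>, so that quotient spaces enter only when the dimension is
  computed.\<close>

definition gen2 :: "'a \<Rightarrow> 'a \<Rightarrow> 'a set" where
  "gen2 x y = (PIdl x <+>\<^bsub>R\<^esub> PIdl y) <+>\<^bsub>R\<^esub> J \<cdot> J"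

lemma ideal_J2: "ideal (J \<cdot> J) R"
  by (rule ideal_prod_is_ideal[OF J.is_ideal J.is_ideal])

lemma J2_sub: "J \<cdot> J \<subseteq> J"
  using ideal_prod_inter[OF J.is_ideal J.is_ideal] by blast

lemma gen2_memI: "r \<in> carrier R \<Longrightarrow> s \<in> carrier R \<Longrightarrow> q \<in> J \<cdot> J \<Longrightarrow> r \<otimes> x \<oplus> s \<otimes> y \<oplus> q \<in> gen2 x y"
  unfolding gen2_def set_add_def' cgenideal_def by blast

lemma gen2_memD: "z \<in> gen2 x y \<Longrightarrow> \<exists>r\<in>carrier R. \<exists>s\<in>carrier R. \<exists>q\<in>J \<cdot> J. z = r \<otimes> x \<oplus> s \<otimes> y \<oplus> q"
  unfolding gen2_def set_add_def' cgenideal_def by blast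

lemma ideal_gen2: "x \<in> carrier R \<Longrightarrow> y \<in> carrier R \<Longrightarrow> ideal (gen2 x y) R"
  unfolding gen2_def by (intro add_ideals cgenideal_ideal ideal_J2)

lemma gen2_contains:
  assumes "x \<in> carrier R" "y \<in> carrier R"
  shows "x \<in> gen2 x y" "y \<in> gen2 x y" "J \<cdot> J \<subseteq> gen2 x y"
proof -
  interpret J2: ideal "J \<cdot> J" R by (rule ideal_J2)
  show "x \<in> gen2 x y" using gen2_memI[of \<one> \<zero> \<zero> x y] assms J2.zero_closed by simp
  show "y \<in> gen2 x y" using gen2_memI[of \<zero> \<one> \<zero> x y] assms J2.zero_closed by simp
  show "J \<cdot> J \<subseteq> gen2 x y"
  proof
    fix q assume "q \<in> J \<cdot> J"
    then show "q \<in> gen2 x y" using gen2_memI[of \<zero> \<zero> q x y] assms J2.Icarr by simp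
  qed
qed

text \<open>The choice of \<open>a\<close> and \<open>b\<close> makes coefficients testable. In a
  relation the coefficient of \<open>b\<close> is tested modulo (t, a) + J^2, which absorbs the term
  in \<open>a\<close>; afterwards that of \<open>a\<close> is tested modulo (t) + J^2. A unit
  coefficient would put the element into the ideal that it was chosen to avoid.\<close>

theorem exists_triple:
  assumes no: "\<And>x y. x \<in> J \<Longrightarrow> y \<in> J \<Longrightarrow> \<not> J \<subseteq> gen2 x y"
  shows "\<exists>a b. minimal_multiplicity_triple J R t a b"
proof -
  \<comment> \<open>\<open>gen2 t \<zero>\<close> is the ideal (t) + J^2.\<close>
  obtain a where a: "a \<in> J" "a \<notin> gen2 t \<zero>" using no[OF t_mem J.zero_closed] by blast
  obtain b where b: "b \<in> J" "b \<notin> gen2 t a" using no[OF t_mem a(1)] by blast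
  note carr = t_carr J.Icarr[OF a(1)] J.Icarr[OF b(1)]
  interpret A: ideal "gen2 t \<zero>" R by (rule ideal_gen2) (use carr in auto)
  interpret B: ideal "gen2 t a" R by (rule ideal_gen2) (use carr in auto)
  note At = gen2_contains[OF carr(1) zero_closed] and Bt = gen2_contains[OF carr(1,2)]
  have relation: "\<exists>d1\<in>E. \<exists>d2\<in>E. \<exists>d3\<in>E. \<exists>r\<in>carrier R. (d1 \<in> Units R \<or> d2 \<in> Units R \<or> d3 \<in> Units R) \<and>
    d1 \<otimes> a \<oplus> d2 \<otimes> b \<oplus> d3 \<otimes> x = r \<otimes> t" if x: "x \<in> J" for x
  proof -
    obtain d0 d1 d2 d3 where d: "d0 \<in> E" "d1 \<in> E" "d2 \<in> E" "d3 \<in> E"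
      and u: "d0 \<in> Units R \<or> d1 \<in> Units R \<or> d2 \<in> Units R \<or> d3 \<in> Units R"
      and eq: "d0 \<otimes> \<one> \<oplus> d1 \<otimes> a \<oplus> d2 \<otimes> b \<oplus> d3 \<otimes> x = \<zero>"
      using dependent[OF one_closed carr(2,3) J.Icarr[OF x]] by (elim bexE conjE) (rule that)
    have c: "d0 \<in> carrier R" "d1 \<in> carrier R" "d2 \<in> carrier R" "d3 \<in> carrier R" "x \<in> carrier R"
      using d E_sub J.Icarr[OF x] by auto
    have e: "d0 \<otimes> \<one> \<oplus> d1 \<otimes> a \<oplus> d2 \<otimes> b \<oplus> d3 \<otimes> x = d0 \<oplus> (d1 \<otimes> a \<oplus> d2 \<otimes> b \<oplus> d3 \<otimes> x)"
      using c carr by algebra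
    \<comment> \<open>The other terms lie in \<open>J\<close>, so the coefficient of 1 is a nonunit,
      hence a multiple of \<open>t\<close>, and can move to the right-hand side.\<close>
    have "d0 \<in> J"
      using J.add_memD[OF c(1), of "d1 \<otimes> a \<oplus> d2 \<otimes> b \<oplus> d3 \<otimes> x"] eq[unfolded e] a b x c
      by (auto intro!: J.a_closed J.I_l_closed)
    then have d0u: "d0 \<notin> Units R" using Units_iff[OF c(1)] by blast
    then obtain r where r: "r \<in> carrier R" "d0 = r \<otimes> t" using E_cases[OF d(1)] by blast
    have "d1 \<otimes> a \<oplus> d2 \<otimes> b \<oplus> d3 \<otimes> x = \<ominus> d0"
      using eq[unfolded e] c carr by (simp add: sum_zero_eq_neg a_comm)
    then have "d1 \<otimes> a \<oplus> d2 \<otimes> b \<oplus> d3 \<otimes> x = (\<ominus> r) \<otimes> t" using r carr by (simp add: l_minus)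
    moreover have "\<ominus> r \<in> carrier R" using r by simp
    ultimately show ?thesis using d u d0u by blast
  qed
  have sq: "\<exists>r\<in>carrier R. x = r \<otimes> t" if x: "x \<in> J \<cdot> J" for x
  proof -
    have xJ: "x \<in> J" using x J2_sub by blast
    obtain d1 d2 d3 r where d: "d1 \<in> E" "d2 \<in> E" "d3 \<in> E" "r \<in> carrier R"
      and u: "d1 \<in> Units R \<or> d2 \<in> Units R \<or> d3 \<in> Units R"
      and eq: "d1 \<otimes> a \<oplus> d2 \<otimes> b \<oplus> d3 \<otimes> x = r \<otimes> t" using relation[OF xJ] by (elim bexE conjE) (rule that)
    have c: "d1 \<in> carrier R" "d2 \<in> carrier R" "d3 \<in> carrier R" "x \<in> carrier R"
      using d E_sub J.Icarr[OF xJ] by auto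
    have e1: "d1 \<otimes> a \<oplus> d2 \<otimes> b \<oplus> d3 \<otimes> x = d2 \<otimes> b \<oplus> (d1 \<otimes> a \<oplus> d3 \<otimes> x)"
      "d1 \<otimes> a \<oplus> d2 \<otimes> b \<oplus> d3 \<otimes> x = d1 \<otimes> a \<oplus> (d2 \<otimes> b \<oplus> d3 \<otimes> x)"
      "d1 \<otimes> a \<oplus> d2 \<otimes> b \<oplus> d3 \<otimes> x = d3 \<otimes> x \<oplus> (d1 \<otimes> a \<oplus> d2 \<otimes> b)"
      using c carr by algebra+
    \<comment> \<open>Both test ideals absorb \<open>x\<close>, which lies in J^2. Thus
      \<open>d2\<close> and then \<open>d1\<close> are nonunits, \<open>d3\<close> remains as the
      unit, and \<open>x\<close> is a multiple of \<open>t\<close>.\<close>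
    have "d2 \<otimes> b \<in> gen2 t a"
      by (rule B.add_memD[of _ "d1 \<otimes> a \<oplus> d3 \<otimes> x"])
        (use eq[unfolded e1(1)] Bt x c d carr in \<open>auto intro!: B.a_closed B.I_l_closed\<close>)
    then have d2: "d2 \<notin> Units R" using B.unit_mult_mem[OF is_cring _ carr(3)] b(2) by blast
    then obtain r2 where r2: "r2 \<in> carrier R" "d2 = r2 \<otimes> t" using E_cases[OF d(2)] by blast
    then have d2b: "d2 \<otimes> b = (r2 \<otimes> b) \<otimes> t" using carr by algebra
    have "d1 \<otimes> a \<in> gen2 t \<zero>"
      by (rule A.add_memD[of _ "d2 \<otimes> b \<oplus> d3 \<otimes> x"])
        (use eq[unfolded e1(2)] At x c d d2b r2 carr in \<open>auto intro!: A.a_closed A.I_l_closed\<close>)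
    then have d1: "d1 \<notin> Units R" using A.unit_mult_mem[OF is_cring _ carr(2)] a(2) by blast
    then obtain r1 where r1: "r1 \<in> carrier R" "d1 = r1 \<otimes> t" using E_cases[OF d(1)] by blast
    have "d3 \<otimes> x \<in> PIdl t"
    proof (rule ideal.add_memD[OF cgenideal_ideal[OF carr(1)]])
      show "d1 \<otimes> a \<oplus> d2 \<otimes> b \<in> PIdl t"
      proof -
        have "d1 \<otimes> a \<oplus> d2 \<otimes> b = (r1 \<otimes> a \<oplus> r2 \<otimes> b) \<otimes> t"
          unfolding r1 r2 using r1 r2 carr by algebra
        then show ?thesis using r1 r2 carr by (auto simp: cgenideal_def)
      qed
      show "d3 \<otimes> x \<oplus> (d1 \<otimes> a \<oplus> d2 \<otimes> b) \<in> PIdl t"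
        using eq[unfolded e1(3)] d by (auto simp: cgenideal_def)
    qed (use c in simp)
    then have "x \<in> PIdl t"
      using ideal.unit_mult_mem[OF cgenideal_ideal[OF carr(1)] is_cring _ c(4)] u d1 d2 by blast
    then show ?thesis by (auto simp: cgenideal_def)
  qed
  have "minimal_multiplicity_triple J R t a b"
  proof (unfold_locales)
    show "\<one> \<notin> J" by (rule one_notin)
    show "t \<in> J" "a \<in> J" "b \<in> J" by (rule t_mem a(1) b(1))+
    show "r = \<zero>" if "r \<in> carrier R" "r \<otimes> t = \<zero>" for r using nzd that .
    show "\<exists>r\<in>carrier R. x \<otimes> y = r \<otimes> t" if "x \<in> J" "y \<in> J" for x y
      using sq ideal_prod.prod[OF that] by blast
    show "r2 \<in> J \<and> r3 \<in> J" if r: "r1 \<in> carrier R" "r2 \<in> carrier R" "r3 \<in> carrier R"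
      and eq: "r1 \<otimes> t \<oplus> r2 \<otimes> a \<oplus> r3 \<otimes> b = \<zero>" for r1 r2 r3
    proof -
      have e: "r1 \<otimes> t \<oplus> r2 \<otimes> a \<oplus> r3 \<otimes> b = r3 \<otimes> b \<oplus> (r1 \<otimes> t \<oplus> r2 \<otimes> a)"
        "r1 \<otimes> t \<oplus> r2 \<otimes> a \<oplus> r3 \<otimes> b = r2 \<otimes> a \<oplus> (r1 \<otimes> t \<oplus> r3 \<otimes> b)"
        using r carr by algebra+
      have "r3 \<otimes> b \<in> gen2 t a"
        by (rule B.add_memD[of _ "r1 \<otimes> t \<oplus> r2 \<otimes> a"])
          (use eq[unfolded e(1)] Bt r carr in \<open>auto intro!: B.a_closed B.I_l_closed\<close>)
      then have "r3 \<notin> Units R" using B.unit_mult_mem[OF is_cring _ carr(3)] b(2) by blast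
      then have r3: "r3 \<in> J" using Units_iff[OF r(3)] by blast
      \<comment> \<open>With \<open>r3\<close> in \<open>J\<close> the term \<open>r3 b\<close> lies
        in J^2, so it does not disturb the test of \<open>r2\<close>.\<close>
      have "r3 \<otimes> b \<in> gen2 t \<zero>" using ideal_prod.prod[OF r3 b(1)] At by blast
      then have "r2 \<otimes> a \<in> gen2 t \<zero>"
        by (intro A.add_memD[of "r2 \<otimes> a" "r1 \<otimes> t \<oplus> r3 \<otimes> b"])
          (use eq[unfolded e(2)] At r carr in \<open>auto intro!: A.a_closed A.I_l_closed\<close>)
      then have "r2 \<notin> Units R" using A.unit_mult_mem[OF is_cring _ carr(2)] a(2) by blast
      with r3 show ?thesis using Units_iff[OF r(2)] by blast
    qed
    show "\<exists>r1\<in>carrier R. \<exists>r2\<in>carrier R. \<exists>r3\<in>carrier R. x = r1 \<otimes> t \<oplus> r2 \<otimes> a \<oplus> r3 \<otimes> b"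
      if x: "x \<in> J" for x
    proof -
      obtain d1 d2 d3 r where d: "d1 \<in> E" "d2 \<in> E" "d3 \<in> E" "r \<in> carrier R"
        and u: "d1 \<in> Units R \<or> d2 \<in> Units R \<or> d3 \<in> Units R"
        and eq: "d1 \<otimes> a \<oplus> d2 \<otimes> b \<oplus> d3 \<otimes> x = r \<otimes> t" using relation[OF x] by (elim bexE conjE) (rule that)
      have c: "d1 \<in> carrier R" "d2 \<in> carrier R" "d3 \<in> carrier R" "x \<in> carrier R"
        using d E_sub J.Icarr[OF x] by auto
      \<comment> \<open>Here \<open>x\<close> is any element of \<open>J\<close>. If
        \<open>d3\<close> were a nonunit, \<open>d3 x\<close> would be a multiple of
        \<open>t\<close> and disappear in both tests, so that no coefficient could be a
        unit.\<close>
      have d3: "d3 \<in> Units R"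
      proof (rule ccontr)
        assume nu: "d3 \<notin> Units R"
        then obtain r3 where r3: "r3 \<in> carrier R" "d3 = r3 \<otimes> t" using E_cases[OF d(3)] by blast
        then have d3x: "d3 \<otimes> x = (r3 \<otimes> x) \<otimes> t" using carr c by algebra
        have e1: "d1 \<otimes> a \<oplus> d2 \<otimes> b \<oplus> d3 \<otimes> x = d2 \<otimes> b \<oplus> (d1 \<otimes> a \<oplus> d3 \<otimes> x)"
          "d1 \<otimes> a \<oplus> d2 \<otimes> b \<oplus> d3 \<otimes> x = d1 \<otimes> a \<oplus> (d2 \<otimes> b \<oplus> d3 \<otimes> x)"
          using c carr by algebra+
        have "d2 \<otimes> b \<in> gen2 t a"
          by (rule B.add_memD[of _ "d1 \<otimes> a \<oplus> d3 \<otimes> x"])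
            (use eq[unfolded e1(1)] Bt c d d3x r3 carr in \<open>auto intro!: B.a_closed B.I_l_closed\<close>)
        then have d2: "d2 \<notin> Units R" using B.unit_mult_mem[OF is_cring _ carr(3)] b(2) by blast
        then obtain r2 where r2: "r2 \<in> carrier R" "d2 = r2 \<otimes> t" using E_cases[OF d(2)] by blast
        then have d2b: "d2 \<otimes> b = (r2 \<otimes> b) \<otimes> t" using carr by algebra
        have "d1 \<otimes> a \<in> gen2 t \<zero>"
          by (rule A.add_memD[of _ "d2 \<otimes> b \<oplus> d3 \<otimes> x"])
            (use eq[unfolded e1(2)] At c d d2b d3x r2 r3 carr in \<open>auto intro!: A.a_closed A.I_l_closed\<close>)
        then have "d1 \<notin> Units R" using A.unit_mult_mem[OF is_cring _ carr(2)] a(2) by blast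
        with nu d2 u show False by blast
      qed
      have i: "inv d3 \<in> carrier R" "inv d3 \<otimes> d3 = \<one>" using d3 by auto
      have "x = inv d3 \<otimes> d3 \<otimes> x" using i c by simp
      also have "\<dots> = inv d3 \<otimes> ((d1 \<otimes> a \<oplus> d2 \<otimes> b \<oplus> d3 \<otimes> x) \<ominus> d1 \<otimes> a \<ominus> d2 \<otimes> b)"
        using c i(1) carr by algebra
      also have "\<dots> = (inv d3 \<otimes> r) \<otimes> t \<oplus> (\<ominus> (inv d3 \<otimes> d1)) \<otimes> a \<oplus> (\<ominus> (inv d3 \<otimes> d2)) \<otimes> b"
        unfolding eq using c i(1) d carr by algebra
      finally have "x = (inv d3 \<otimes> r) \<otimes> t \<oplus> (\<ominus> (inv d3 \<otimes> d1)) \<otimes> a \<oplus> (\<ominus> (inv d3 \<otimes> d2)) \<otimes> b" .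
      moreover have "inv d3 \<otimes> r \<in> carrier R" "\<ominus> (inv d3 \<otimes> d1) \<in> carrier R" "\<ominus> (inv d3 \<otimes> d2) \<in> carrier R"
        using c i d by auto
      ultimately show ?thesis by blast
    qed
  qed
  then show ?thesis by blast
qed

text \<open>Nakayama's lemma without generators. Let \<open>M\<close> be maximal among the ideals
  properly inside \<open>J\<close>; the zero ideal is one of them because \<open>t\<close> is not
  zero. Then J = M + (x) and J^2 is contained in M + Jx. If \<open>x\<close> lies in J^2, then (1 -
  j) x lies in \<open>M\<close> for some \<open>j\<close> in \<open>J\<close>, and 1 - j is a
  unit.\<close>

lemma J_not_sub_J2: "\<not> J \<subseteq> J \<cdot> J"
proof
  assume JJ: "J \<subseteq> J \<cdot> J"
  have "t \<noteq> \<zero>" using nzd[of \<one>] one_neq_zero by auto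
  then have "{\<zero>} \<subset> J" using t_mem J.zero_closed by auto
  let ?P = "\<lambda>I. ideal I R \<and> I \<subset> J"
  have "?P {\<zero>}" "\<And>I. ?P I \<Longrightarrow> ideal I R" using zeroideal \<open>{\<zero>} \<subset> J\<close> by simp_all
  then obtain M where M: "?P M" and max: "\<forall>I. ?P I \<longrightarrow> M \<subseteq> I \<longrightarrow> I = M"
    by (rule maximal_ideal_satisfying[of ?P])
  have M: "ideal M R" "M \<subset> J" using M by simp_all
  interpret M: ideal M R by fact
  obtain x where x: "x \<in> J" "x \<notin> M" using M(2) by blast
  note xc = J.Icarr[OF x(1)]
  note N = ideal_add_cgenideal[OF M(1) xc]
  have "M <+>\<^bsub>R\<^esub> PIdl x \<subseteq> J"
    using M(2) x(1) by (auto simp: set_add_def' cgenideal_def intro!: J.a_closed J.I_l_closed)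
  then have eqJ: "M <+>\<^bsub>R\<^esub> PIdl x = J" using max[rule_format, of "M <+>\<^bsub>R\<^esub> PIdl x"] N x(2) by blast
  have prod: "\<exists>m\<in>M. \<exists>j\<in>J. s = m \<oplus> j \<otimes> x" if "s \<in> J \<cdot> J" for s
    using that
  proof (induction rule: ideal_prod.induct)
    case (prod i j)
    obtain m r where m: "m \<in> M" "r \<in> carrier R" "j = m \<oplus> r \<otimes> x"
      using prod(2) unfolding eqJ[symmetric] set_add_def' cgenideal_def by blast
    have "i \<otimes> j = i \<otimes> m \<oplus> (i \<otimes> r) \<otimes> x"
      unfolding m using m M.Icarr xc J.Icarr[OF prod(1)] by algebra
    moreover have "i \<otimes> m \<in> M" "i \<otimes> r \<in> J"
      using m J.Icarr[OF prod(1)] prod by (auto intro: M.I_l_closed J.I_r_closed)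
    ultimately show ?case by blast
  next
    case (sum s1 s2)
    then obtain m1 j1 m2 j2 where m: "m1 \<in> M" "j1 \<in> J" "s1 = m1 \<oplus> j1 \<otimes> x"
      "m2 \<in> M" "j2 \<in> J" "s2 = m2 \<oplus> j2 \<otimes> x" by blast
    have "s1 \<oplus> s2 = (m1 \<oplus> m2) \<oplus> (j1 \<oplus> j2) \<otimes> x"
      unfolding m(3,6) using m M.Icarr J.Icarr xc by algebra
    then show ?case using m by (blast intro: M.a_closed J.a_closed)
  qed
  obtain m j where m: "m \<in> M" "j \<in> J" "x = m \<oplus> j \<otimes> x" using prod x JJ by blast
  note mc = M.Icarr[OF m(1)] J.Icarr[OF m(2)]
  have "(\<one> \<ominus> j) \<otimes> x = x \<ominus> j \<otimes> x" using mc xc by algebra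
  also have "\<dots> = (m \<oplus> j \<otimes> x) \<ominus> j \<otimes> x" using m(3) by simp
  also have "\<dots> = m" using mc xc by algebra
  finally have 1: "(\<one> \<ominus> j) \<otimes> x \<in> M" using m by simp
  have "\<one> \<ominus> j \<notin> J"
  proof
    assume "\<one> \<ominus> j \<in> J"
    then have "\<one> \<ominus> j \<oplus> j \<in> J" using m by (intro J.a_closed)
    moreover have "\<one> \<ominus> j \<oplus> j = \<one>" using mc by algebra
    ultimately show False using one_notin by simp
  qed
  then have "\<one> \<ominus> j \<in> Units R" using Units_iff mc by simp
  then show False using M.unit_mult_mem[OF is_cring _ xc 1] x by blast
qed

end


section \<open>The cotangent space\<close>

text \<open>Scalars are cosets of \<open>J\<close> but vectors are cosets of J^2. The union over
  representatives is a single coset because (j + a)(q + x) - a x = (j + a) q + j x lies in J^2 for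
  \<open>x\<close> and \<open>j\<close> in \<open>J\<close> and \<open>q\<close> in J^2.\<close>

lemma (in cring) cotangent_smult:
  assumes J: "ideal J R" and a: "a \<in> carrier R" and x: "x \<in> J"
  shows "rcoset_mult R (J \<cdot> J) (J +> a) ((J \<cdot> J) +> x) = (J \<cdot> J) +> (a \<otimes> x)"
proof -
  interpret J: ideal J R by fact
  have J2: "ideal (J \<cdot> J) R" by (rule ideal_prod_is_ideal[OF J J])
  interpret J2: ideal "J \<cdot> J" R by fact
  have xc: "x \<in> carrier R" by (rule J.Icarr[OF x])
  have eq: "(J \<cdot> J) +> (a' \<otimes> b) = (J \<cdot> J) +> (a \<otimes> x)"
    if ab: "a' \<in> J +> a" "b \<in> (J \<cdot> J) +> x" for a' b
  proof -
    obtain j where j: "j \<in> J" "a' = j \<oplus> a" using ab(1) by (auto simp: a_r_coset_def')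
    obtain q where q: "q \<in> J \<cdot> J" "b = q \<oplus> x" using ab(2) by (auto simp: a_r_coset_def')
    note c = J.Icarr[OF j(1)] J2.Icarr[OF q(1)]
    have "a' \<otimes> b \<ominus> a \<otimes> x = (j \<oplus> a) \<otimes> q \<oplus> j \<otimes> x"
      unfolding j q using c a xc by algebra
    moreover have "(j \<oplus> a) \<otimes> q \<in> J \<cdot> J" by (rule J2.I_l_closed[OF q(1)]) (use c a in simp)
    moreover have "j \<otimes> x \<in> J \<cdot> J" by (rule ideal_prod.prod[OF j(1) x])
    ultimately have "a' \<otimes> b \<ominus> a \<otimes> x \<in> J \<cdot> J" using J2.a_closed by simp
    then show ?thesis
      using quotient_eq_iff_same_a_r_cos[OF J2, of "a' \<otimes> b" "a \<otimes> x"] j q c a xc by simp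
  qed
  have "a \<in> J +> a" "x \<in> (J \<cdot> J) +> x" using J.a_rcos_self J2.a_rcos_self a xc by auto
  then show ?thesis unfolding rcoset_mult_def using eq by blast
qed

lemma (in cring) vectorspace_cotangent_space:
  assumes "maximalideal J R"
  shows "vectorspace (R Quot J) (cotangent_space R J)"
proof -
  interpret J: maximalideal J R by fact
  have J2: "ideal (J \<cdot> J) R" by (rule ideal_prod_is_ideal[OF J.is_ideal J.is_ideal])
  interpret J2: ideal "J \<cdot> J" R by fact
  let ?V = "cotangent_space R J"
  let ?c = "\<lambda>x. (J \<cdot> J) +> x"
  have zero: "?c \<zero> = J \<cdot> J" by (rule a_rcos_zero[OF J2 J2.zero_closed])
  have V: "carrier ?V = ?c ` J" "\<zero>\<^bsub>?V\<^esub> = ?c \<zero>" "(\<oplus>\<^bsub>?V\<^esub>) = (<+>\<^bsub>R\<^esub>)"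
    "(\<odot>\<^bsub>?V\<^esub>) = rcoset_mult R (J \<cdot> J)"
    unfolding zero by (simp_all add: cotangent_space_def Let_def FactRing_def)
  have add: "?c x <+>\<^bsub>R\<^esub> ?c y = ?c (x \<oplus> y)" if "x \<in> J" "y \<in> J" for x y
    using J2.a_rcos_sum that J.Icarr by simp
  have Q: "A \<in> carrier (R Quot J) \<longleftrightarrow> (\<exists>a\<in>carrier R. A = J +> a)" for A
    by (auto simp: FactRing_simps)
  have Qop: "(J +> a) \<oplus>\<^bsub>R Quot J\<^esub> (J +> b) = J +> (a \<oplus> b)"
    "(J +> a) \<otimes>\<^bsub>R Quot J\<^esub> (J +> b) = J +> (a \<otimes> b)" if "a \<in> carrier R" "b \<in> carrier R" for a b
    using that by (simp_all add: FactRing_def J.a_rcos_sum J.rcoset_mult_add)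
  have smult: "rcoset_mult R (J \<cdot> J) (J +> a) (?c x) = ?c (a \<otimes> x)"
    if "a \<in> carrier R" "x \<in> J" for a x by (rule cotangent_smult[OF J.is_ideal that])
  have group: "abelian_group ?V"
  proof (rule abelian_groupI)
    show "\<zero>\<^bsub>?V\<^esub> \<in> carrier ?V" unfolding V using J.zero_closed by blast
    fix U assume "U \<in> carrier ?V"
    then obtain x where x: "x \<in> J" "U = ?c x" unfolding V by blast
    note xc = J.Icarr[OF x(1)]
    show "\<zero>\<^bsub>?V\<^esub> \<oplus>\<^bsub>?V\<^esub> U = U"
      unfolding V(2,3) x add[OF J.zero_closed x(1)] using xc by simp
    have "?c (\<ominus> x) <+>\<^bsub>R\<^esub> ?c x = ?c \<zero>"
      unfolding add[OF J.a_inv_closed[OF x(1)] x(1)] using xc by (simp add: l_neg)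
    then show "\<exists>W\<in>carrier ?V. W \<oplus>\<^bsub>?V\<^esub> U = \<zero>\<^bsub>?V\<^esub>"
      unfolding V x using J.a_inv_closed[OF x(1)] by blast
    fix W assume "W \<in> carrier ?V"
    then obtain y where y: "y \<in> J" "W = ?c y" unfolding V by blast
    note yc = J.Icarr[OF y(1)]
    show "U \<oplus>\<^bsub>?V\<^esub> W \<in> carrier ?V"
      unfolding V x y add[OF x(1) y(1)] using J.a_closed[OF x(1) y(1)] by blast
    show "U \<oplus>\<^bsub>?V\<^esub> W = W \<oplus>\<^bsub>?V\<^esub> U"
      unfolding V x y add[OF x(1) y(1)] add[OF y(1) x(1)] using xc yc by (simp add: a_comm)
    fix Z assume "Z \<in> carrier ?V"
    then obtain z where z: "z \<in> J" "Z = ?c z" unfolding V by blast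
    note zc = J.Icarr[OF z(1)]
    show "U \<oplus>\<^bsub>?V\<^esub> W \<oplus>\<^bsub>?V\<^esub> Z = U \<oplus>\<^bsub>?V\<^esub> (W \<oplus>\<^bsub>?V\<^esub> Z)"
      unfolding V x y z add[OF x(1) y(1)] add[OF y(1) z(1)]
        add[OF J.a_closed[OF x(1) y(1)] z(1)] add[OF x(1) J.a_closed[OF y(1) z(1)]]
      using xc yc zc by (simp add: a_assoc)
  qed
  have "Module.module (R Quot J) ?V"
  proof (rule moduleI)
    show "cring (R Quot J)" by (rule J.quotient_is_cring[OF is_cring])
    show "abelian_group ?V" by (rule group)
    fix A U assume "A \<in> carrier (R Quot J)" "U \<in> carrier ?V"
    then obtain a x where a: "a \<in> carrier R" "A = J +> a" and x: "x \<in> J" "U = ?c x"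
      unfolding V Q by blast
    note xc = J.Icarr[OF x(1)]
    have ax: "a \<otimes> x \<in> J" by (rule J.I_l_closed[OF x(1) a(1)])
    show "A \<odot>\<^bsub>?V\<^esub> U \<in> carrier ?V" unfolding V a x smult[OF a(1) x(1)] using ax by blast
    {
      fix B assume "B \<in> carrier (R Quot J)"
      then obtain b where b: "b \<in> carrier R" "B = J +> b" unfolding Q by blast
      have bx: "b \<otimes> x \<in> J" by (rule J.I_l_closed[OF x(1) b(1)])
      show "(A \<oplus>\<^bsub>R Quot J\<^esub> B) \<odot>\<^bsub>?V\<^esub> U = A \<odot>\<^bsub>?V\<^esub> U \<oplus>\<^bsub>?V\<^esub> B \<odot>\<^bsub>?V\<^esub> U"
        unfolding V a(2) b(2) x(2) Qop(1)[OF a(1) b(1)] smult[OF a(1) x(1)] smult[OF b(1) x(1)]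
          smult[OF add.m_closed[OF a(1) b(1)] x(1)] add[OF ax bx]
        using a b xc by (simp add: l_distr)
      show "(A \<otimes>\<^bsub>R Quot J\<^esub> B) \<odot>\<^bsub>?V\<^esub> U = A \<odot>\<^bsub>?V\<^esub> (B \<odot>\<^bsub>?V\<^esub> U)"
        unfolding V a(2) b(2) x(2) Qop(2)[OF a(1) b(1)] smult[OF b(1) x(1)]
          smult[OF m_closed[OF a(1) b(1)] x(1)] smult[OF a(1) bx]
        using a b xc by (simp add: m_assoc)
    }
    fix W assume "W \<in> carrier ?V"
    then obtain y where y: "y \<in> J" "W = ?c y" unfolding V by blast
    note yc = J.Icarr[OF y(1)]
    have ay: "a \<otimes> y \<in> J" by (rule J.I_l_closed[OF y(1) a(1)])
    show "A \<odot>\<^bsub>?V\<^esub> (U \<oplus>\<^bsub>?V\<^esub> W) = A \<odot>\<^bsub>?V\<^esub> U \<oplus>\<^bsub>?V\<^esub> A \<odot>\<^bsub>?V\<^esub> W"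
      unfolding V a(2) x(2) y(2) add[OF x(1) y(1)] smult[OF a(1) x(1)] smult[OF a(1) y(1)]
        smult[OF a(1) J.a_closed[OF x(1) y(1)]] add[OF ax ay]
      using a xc yc by (simp add: r_distr)
  next
    fix U assume "U \<in> carrier ?V"
    then obtain x where x: "x \<in> J" "U = ?c x" unfolding V by blast
    have one: "\<one>\<^bsub>R Quot J\<^esub> = J +> \<one>" by (simp add: FactRing_def)
    show "\<one>\<^bsub>R Quot J\<^esub> \<odot>\<^bsub>?V\<^esub> U = U"
      unfolding V x one smult[OF one_closed x(1)] using J.Icarr[OF x(1)] by simp
  qed
  then show ?thesis by (intro vectorspace.intro J.quotient_is_field[OF is_cring])
qed

context local_order
begin

text \<open>The dimension is the least size of a finite spanning set, so the classes of
  \<open>x\<close> and \<open>y\<close> bound it. In dimension 0 the empty set spans, so every class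
  is zero, which is excluded by \<open>J_not_sub_J2\<close>.\<close>

lemma embedding_dim_bounds:
  assumes x: "x \<in> J" and y: "y \<in> J" and gen: "J \<subseteq> gen2 x y"
  shows "embedding_dim R \<le> 2" "embedding_dim R \<noteq> 0"
proof -
  let ?K = "R Quot J" and ?V = "cotangent_space R J"
  interpret V: vectorspace ?K ?V by (rule vectorspace_cotangent_space[OF maximal])
  interpret J2: ideal "J \<cdot> J" R by (rule ideal_J2)
  let ?c = "\<lambda>x. (J \<cdot> J) +> x"
  have V: "carrier ?V = ?c ` J" "\<zero>\<^bsub>?V\<^esub> = J \<cdot> J" "(\<oplus>\<^bsub>?V\<^esub>) = (<+>\<^bsub>R\<^esub>)"
    "(\<odot>\<^bsub>?V\<^esub>) = rcoset_mult R (J \<cdot> J)"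
    by (simp_all add: cotangent_space_def Let_def FactRing_def)
  have dim: "embedding_dim R = V.dim"
    by (simp add: embedding_dim_def Let_def the_maximal)
  let ?S = "{?c x, ?c y}"
  have S: "?S \<subseteq> carrier ?V" unfolding V using x y by blast
  interpret span: LinearCombinations.submodule ?K "V.span ?S" ?V by (rule V.span_is_submodule[OF S])
  have Kc: "J +> r \<in> carrier ?K" if "r \<in> carrier R" for r using that by (auto simp: FactRing_simps)
  have "carrier ?V \<subseteq> V.span ?S"
  proof
    fix Z assume "Z \<in> carrier ?V"
    then obtain z where z: "z \<in> J" "Z = ?c z" unfolding V by blast
    then have "z \<in> gen2 x y" using gen by blast
    from gen2_memD[OF this] obtain r s q where r: "r \<in> carrier R" and s: "s \<in> carrier R"
      and q: "q \<in> J \<cdot> J" and zeq: "z = r \<otimes> x \<oplus> s \<otimes> y \<oplus> q" by blast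
    note c = r s J.Icarr[OF x] J.Icarr[OF y] J2.Icarr[OF q]
    have "z \<ominus> (r \<otimes> x \<oplus> s \<otimes> y) = q" unfolding zeq using c by algebra
    then have "Z = ?c (r \<otimes> x \<oplus> s \<otimes> y)"
      unfolding z using quotient_eq_iff_same_a_r_cos[OF ideal_J2, of z "r \<otimes> x \<oplus> s \<otimes> y"]
        q J.Icarr[OF z(1)] c by simp
    also have "\<dots> = ?c (r \<otimes> x) <+>\<^bsub>R\<^esub> ?c (s \<otimes> y)" using J2.a_rcos_sum c by simp
    also have "\<dots> = (J +> r) \<odot>\<^bsub>?V\<^esub> ?c x \<oplus>\<^bsub>?V\<^esub> (J +> s) \<odot>\<^bsub>?V\<^esub> ?c y"
      unfolding V cotangent_smult[OF J.is_ideal r x] cotangent_smult[OF J.is_ideal s y] by (rule refl)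
    also have "\<dots> \<in> V.span ?S"
    proof -
      have "?c x \<in> V.span ?S" "?c y \<in> V.span ?S" using V.in_own_span[OF S] by blast+
      then show ?thesis by (intro span.m_closed span.smult_closed Kc r s)
    qed
    finally show "Z \<in> V.span ?S" .
  qed
  then have spanS: "V.span ?S = carrier ?V" using V.span_is_subset2[OF S] by blast
  let ?P = "\<lambda>n. \<exists>A. finite A \<and> card A = n \<and> A \<subseteq> carrier ?V \<and> V.span A = carrier ?V"
  have P: "?P (card ?S)" by (rule exI[of _ ?S]) (use S spanS in simp)
  have "V.dim \<le> card ?S" unfolding V.dim_def by (rule Least_le) (rule P)
  \<comment> \<open>Only an inequality, since the two classes may coincide.\<close>
  also have "card ?S \<le> 2" by (simp add: card_insert_if)
  finally show "embedding_dim R \<le> 2" unfolding dim .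
  have "?P V.dim" unfolding V.dim_def by (rule LeastI) (rule P)
  then obtain A where A: "finite A" "card A = V.dim" "A \<subseteq> carrier ?V" "V.span A = carrier ?V" by blast
  show "embedding_dim R \<noteq> 0"
  proof
    assume "embedding_dim R = 0"
    then have "A = {}" using A(1,2) dim by simp
    then have "V.span {} = carrier ?V" using A(4) by simp
    moreover have "V.span {} = {\<zero>\<^bsub>?V\<^esub>}"
      by (auto simp: V.span_def V.lincomb_def)
    ultimately have *: "?c ` J = {J \<cdot> J}" using V by simp
    have "J \<subseteq> J \<cdot> J"
    proof
      fix z assume z: "z \<in> J"
      then have "?c z = J \<cdot> J" using * by blast
      then show "z \<in> J \<cdot> J" using J2.rcos_const_imp_mem[OF J.Icarr[OF z]] by blast
    qed
    then show False using J_not_sub_J2 by contradiction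
  qed
qed

text \<open>Embedding dimension 1 would equal the Krull dimension, which is regularity; so both
  bounds of \<open>embedding_dim_bounds\<close> together leave only 2.\<close>

theorem plane_curve_singularity_if_no_triple:
  assumes "\<not> regular_local_ring R" "\<And>a b. \<not> minimal_multiplicity_triple J R t a b"
  shows "plane_curve_singularity R"
proof -
  obtain x y where "x \<in> J" "y \<in> J" "J \<subseteq> gen2 x y"
    using exists_triple assms(2) by blast
  note ed = embedding_dim_bounds[OF this]
  have "enat (embedding_dim R) \<noteq> 1"
    using assms(1) krull_dim_eq_1 local noetherian_ring_axioms unfolding regular_local_ring_def by simp
  then have "embedding_dim R \<noteq> 1" by (auto simp: one_enat_def)
  with ed have "embedding_dim R = 2" by linarith
  then show ?thesis
    unfolding plane_curve_singularity_def using krull_dim_eq_1 local noetherian_ring_axioms by simp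
qed

end


section \<open>Localization and discrete valuation rings\<close>

text \<open>Serves the operations of \<open>localization_at\<close>, which are unions over
  representatives: once these all give the same fraction, the union is that fraction.\<close>

lemma UN_pairs_const:
  assumes "A \<noteq> {}" "B \<noteq> {}"
    and "\<And>a s b u. (a, s) \<in> A \<Longrightarrow> (b, u) \<in> B \<Longrightarrow> f a s b u = x"
  shows "(\<Union>(a, s)\<in>A. \<Union>(b, u)\<in>B. f a s b u) = x"
proof (rule SUP_eq_const[OF assms(1)])
  fix p assume p: "p \<in> A"
  have "(\<Union>q\<in>B. case q of (b, u) \<Rightarrow> f (fst p) (snd p) b u) = x"
  proof (rule SUP_eq_const[OF assms(2)])
    fix q assume "q \<in> B"
    then show "(case q of (b, u) \<Rightarrow> f (fst p) (snd p) b u) = x"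
      using assms(3)[of "fst p" "snd p" "fst q" "snd q"] p by (simp add: case_prod_beta)
  qed
  then show "(case p of (a, s) \<Rightarrow> \<Union>(b, u)\<in>B. f a s b u) = x"
    by (simp add: case_prod_beta)
qed

section \<open>Arithmetic of fractions in a localization\<close>

context primeideal
begin

lemma compl_mult: "w \<in> carrier R - I \<Longrightarrow> v \<in> carrier R - I \<Longrightarrow> w \<otimes> v \<in> carrier R - I"
  using I_prime by blast

lemma one_compl: "\<one> \<in> carrier R - I"
  using I_notcarr one_imp_carrier by blast

lemma loc_frac_self:
  assumes "a \<in> carrier R" "s \<in> carrier R - I"
  shows "(a, s) \<in> loc_frac R I a s"
  unfolding loc_frac_def using assms one_compl by (auto simp: r_neg a_minus_def intro!: bexI[of _ \<one>])

lemma loc_frac_memD: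
  assumes "(b, u) \<in> loc_frac R I a s"
  obtains w where "b \<in> carrier R" "u \<in> carrier R - I" "w \<in> carrier R - I"
    "w \<otimes> (a \<otimes> u \<ominus> b \<otimes> s) = \<zero>"
  using assms unfolding loc_frac_def by auto

text \<open>Transitivity of the relation between pairs that defines a fraction.\<close>

lemma loc_frac_sub:
  assumes a: "a \<in> carrier R" and s: "s \<in> carrier R - I"
    and b: "b \<in> carrier R" and u: "u \<in> carrier R - I"
    and w: "w \<in> carrier R - I" and eq: "w \<otimes> (a \<otimes> u \<ominus> b \<otimes> s) = \<zero>"
  shows "loc_frac R I a s \<subseteq> loc_frac R I b u"
proof (rule subrelI)
  fix c v assume "(c, v) \<in> loc_frac R I a s"
  then obtain x where c: "c \<in> carrier R" and v: "v \<in> carrier R - I" and x: "x \<in> carrier R - I"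
    and xeq: "x \<otimes> (a \<otimes> v \<ominus> c \<otimes> s) = \<zero>" by (rule loc_frac_memD)
  note carr = a b c DiffD1[OF s] DiffD1[OF u] DiffD1[OF v] DiffD1[OF w] DiffD1[OF x]
  \<comment> \<open>From \<open>s (b v - c u) = u (a v - c s) - v (a u - b s)\<close>; the factor
    \<open>s\<close> on the left is the reason for the witness \<open>w x s\<close>.\<close>
  have "(w \<otimes> x \<otimes> s) \<otimes> (b \<otimes> v \<ominus> c \<otimes> u) =
    (w \<otimes> u) \<otimes> (x \<otimes> (a \<otimes> v \<ominus> c \<otimes> s)) \<ominus> (x \<otimes> v) \<otimes> (w \<otimes> (a \<otimes> u \<ominus> b \<otimes> s))"
    using carr by algebra
  also have "\<dots> = \<zero>" unfolding eq xeq using carr by algebra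
  finally have "(w \<otimes> x \<otimes> s) \<otimes> (b \<otimes> v \<ominus> c \<otimes> u) = \<zero>" .
  moreover have "w \<otimes> x \<otimes> s \<in> carrier R - I" by (intro compl_mult w x s)
  ultimately show "(c, v) \<in> loc_frac R I b u"
    unfolding loc_frac_def using c v by blast
qed

lemma loc_frac_eqI:
  assumes a: "a \<in> carrier R" and s: "s \<in> carrier R - I"
    and b: "b \<in> carrier R" and u: "u \<in> carrier R - I"
    and w: "w \<in> carrier R - I" and eq: "w \<otimes> (a \<otimes> u \<ominus> b \<otimes> s) = \<zero>"
  shows "loc_frac R I a s = loc_frac R I b u"
proof
  show "loc_frac R I a s \<subseteq> loc_frac R I b u" by (rule loc_frac_sub[OF assms])
  have "w \<otimes> (b \<otimes> s \<ominus> a \<otimes> u) = \<ominus> (w \<otimes> (a \<otimes> u \<ominus> b \<otimes> s))"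
    using a b DiffD1[OF s] DiffD1[OF u] DiffD1[OF w] by algebra
  then have "w \<otimes> (b \<otimes> s \<ominus> a \<otimes> u) = \<zero>" using eq by simp
  then show "loc_frac R I b u \<subseteq> loc_frac R I a s" by (rule loc_frac_sub[OF b u a s w])
qed

lemma loc_frac_eqD:
  assumes "a \<in> carrier R" "s \<in> carrier R - I" "loc_frac R I a s = loc_frac R I b u"
  obtains w where "w \<in> carrier R - I" "w \<otimes> (b \<otimes> s \<ominus> a \<otimes> u) = \<zero>"
proof -
  have "(a, s) \<in> loc_frac R I b u" using loc_frac_self[OF assms(1,2)] assms(3) by simp
  then show thesis by (rule loc_frac_memD) (rule that)
qed

lemma loc_frac_mult:
  assumes a: "a \<in> carrier R" and s: "s \<in> carrier R - I"
    and b: "b \<in> carrier R" and u: "u \<in> carrier R - I"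
  shows "loc_frac R I a s \<otimes>\<^bsub>localization_at R I\<^esub> loc_frac R I b u = loc_frac R I (a \<otimes> b) (s \<otimes> u)"
proof -
  have eq: "loc_frac R I (a' \<otimes> b') (s' \<otimes> u') = loc_frac R I (a \<otimes> b) (s \<otimes> u)"
    if ab: "(a', s') \<in> loc_frac R I a s" "(b', u') \<in> loc_frac R I b u" for a' s' b' u'
  proof -
    obtain w where a': "a' \<in> carrier R" and s': "s' \<in> carrier R - I" and w: "w \<in> carrier R - I"
      and weq: "w \<otimes> (a \<otimes> s' \<ominus> a' \<otimes> s) = \<zero>" using ab(1) by (rule loc_frac_memD)
    obtain x where b': "b' \<in> carrier R" and u': "u' \<in> carrier R - I" and x: "x \<in> carrier R - I"
      and xeq: "x \<otimes> (b \<otimes> u' \<ominus> b' \<otimes> u) = \<zero>" using ab(2) by (rule loc_frac_memD)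
    note carr = a b a' b' DiffD1[OF s] DiffD1[OF u] DiffD1[OF s'] DiffD1[OF u'] DiffD1[OF w] DiffD1[OF x]
    \<comment> \<open>The representatives are exchanged one after the other, so that each summand on
      the right contains one of the two expressions known to vanish.\<close>
    have "(w \<otimes> x) \<otimes> ((a' \<otimes> b') \<otimes> (s \<otimes> u) \<ominus> (a \<otimes> b) \<otimes> (s' \<otimes> u')) =
      \<ominus> ((x \<otimes> b' \<otimes> u) \<otimes> (w \<otimes> (a \<otimes> s' \<ominus> a' \<otimes> s))) \<ominus> (w \<otimes> a \<otimes> s') \<otimes> (x \<otimes> (b \<otimes> u' \<ominus> b' \<otimes> u))"
      using carr by algebra
    also have "\<dots> = \<zero>" unfolding weq xeq using carr by algebra
    finally show ?thesis
      by (intro loc_frac_eqI[of _ _ _ _ "w \<otimes> x"] compl_mult s s' u u' w x m_closed a b a' b')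
  qed
  have "loc_frac R I a s \<noteq> {}" "loc_frac R I b u \<noteq> {}"
    using loc_frac_self[OF a s] loc_frac_self[OF b u] by blast+
  from UN_pairs_const[OF this eq] show ?thesis
    by (simp only: localization_at_def monoid.simps ring.simps)
qed

lemma loc_frac_add:
  assumes a: "a \<in> carrier R" and s: "s \<in> carrier R - I"
    and b: "b \<in> carrier R" and u: "u \<in> carrier R - I"
  shows "loc_frac R I a s \<oplus>\<^bsub>localization_at R I\<^esub> loc_frac R I b u =
    loc_frac R I (a \<otimes> u \<oplus> b \<otimes> s) (s \<otimes> u)"
proof -
  have eq: "loc_frac R I (a' \<otimes> u' \<oplus> b' \<otimes> s') (s' \<otimes> u') = loc_frac R I (a \<otimes> u \<oplus> b \<otimes> s) (s \<otimes> u)"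
    if ab: "(a', s') \<in> loc_frac R I a s" "(b', u') \<in> loc_frac R I b u" for a' s' b' u'
  proof -
    obtain w where a': "a' \<in> carrier R" and s': "s' \<in> carrier R - I" and w: "w \<in> carrier R - I"
      and weq: "w \<otimes> (a \<otimes> s' \<ominus> a' \<otimes> s) = \<zero>" using ab(1) by (rule loc_frac_memD)
    obtain x where b': "b' \<in> carrier R" and u': "u' \<in> carrier R - I" and x: "x \<in> carrier R - I"
      and xeq: "x \<otimes> (b \<otimes> u' \<ominus> b' \<otimes> u) = \<zero>" using ab(2) by (rule loc_frac_memD)
    note carr = a b a' b' DiffD1[OF s] DiffD1[OF u] DiffD1[OF s'] DiffD1[OF u'] DiffD1[OF w] DiffD1[OF x]
    have "(w \<otimes> x) \<otimes> ((a' \<otimes> u' \<oplus> b' \<otimes> s') \<otimes> (s \<otimes> u) \<ominus> (a \<otimes> u \<oplus> b \<otimes> s) \<otimes> (s' \<otimes> u')) =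
      \<ominus> ((x \<otimes> u \<otimes> u') \<otimes> (w \<otimes> (a \<otimes> s' \<ominus> a' \<otimes> s))) \<ominus> (w \<otimes> s \<otimes> s') \<otimes> (x \<otimes> (b \<otimes> u' \<ominus> b' \<otimes> u))"
      using carr by algebra
    also have "\<dots> = \<zero>" unfolding weq xeq using carr by algebra
    finally show ?thesis using carr
      by (intro loc_frac_eqI[of _ _ _ _ "w \<otimes> x"] compl_mult s s' u u' w x) auto
  qed
  have "loc_frac R I a s \<noteq> {}" "loc_frac R I b u \<noteq> {}"
    using loc_frac_self[OF a s] loc_frac_self[OF b u] by blast+
  from UN_pairs_const[OF this eq] show ?thesis
    by (simp only: localization_at_def monoid.simps ring.simps)
qed

lemma loc_frac_carrier: "a \<in> carrier R \<Longrightarrow> s \<in> carrier R - I \<Longrightarrow> loc_frac R I a s \<in> carrier (localization_at R I)"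
  unfolding localization_at_def by auto

lemma loc_frac_cases:
  assumes "x \<in> carrier (localization_at R I)"
  obtains a s where "a \<in> carrier R" "s \<in> carrier R - I" "x = loc_frac R I a s"
  using assms unfolding localization_at_def by auto

lemma loc_one: "\<one>\<^bsub>localization_at R I\<^esub> = loc_frac R I \<one> \<one>"
  and loc_zero: "\<zero>\<^bsub>localization_at R I\<^esub> = loc_frac R I \<zero> \<one>"
  by (simp_all add: localization_at_def)

lemma loc_frac_hom: "(\<lambda>a. loc_frac R I a \<one>) \<in> ring_hom R (localization_at R I)"
proof (rule ring_hom_memI)
  fix x y assume x: "x \<in> carrier R" and y: "y \<in> carrier R"
  show "loc_frac R I x \<one> \<in> carrier (localization_at R I)" by (rule loc_frac_carrier[OF x one_compl])
  show "loc_frac R I (x \<otimes> y) \<one> = loc_frac R I x \<one> \<otimes>\<^bsub>localization_at R I\<^esub> loc_frac R I y \<one>"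
    unfolding loc_frac_mult[OF x one_compl y one_compl] by simp
  show "loc_frac R I (x \<oplus> y) \<one> = loc_frac R I x \<one> \<oplus>\<^bsub>localization_at R I\<^esub> loc_frac R I y \<one>"
    unfolding loc_frac_add[OF x one_compl y one_compl] using x y by simp
qed (simp add: loc_one)

lemma loc_frac_same:
  assumes s: "s \<in> carrier R - I"
  shows "loc_frac R I s s = \<one>\<^bsub>localization_at R I\<^esub>"
  unfolding loc_one
  by (rule loc_frac_eqI[OF _ s one_closed one_compl one_compl]) (use s in \<open>auto simp: a_minus_def r_neg\<close>)

lemma loc_frac_Units:
  assumes s: "s \<in> carrier R - I"
  shows "loc_frac R I s \<one> \<in> Units (localization_at R I)"
proof -
  have sc: "s \<in> carrier R" using s by simp
  have "loc_frac R I \<one> s \<otimes>\<^bsub>localization_at R I\<^esub> loc_frac R I s \<one> = \<one>\<^bsub>localization_at R I\<^esub>"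
    "loc_frac R I s \<one> \<otimes>\<^bsub>localization_at R I\<^esub> loc_frac R I \<one> s = \<one>\<^bsub>localization_at R I\<^esub>"
    using loc_frac_mult[OF one_closed s sc one_compl] loc_frac_mult[OF sc one_compl one_closed s]
      loc_frac_same[OF s] sc by simp_all
  then show ?thesis
    unfolding Units_def using loc_frac_carrier[OF one_closed s] loc_frac_carrier[OF sc one_compl] by blast
qed

lemma loc_frac_mult_denominator:
  assumes a: "a \<in> carrier R" and s: "s \<in> carrier R - I"
  shows "loc_frac R I a s \<otimes>\<^bsub>localization_at R I\<^esub> loc_frac R I s \<one> = loc_frac R I a \<one>"
proof -
  have sc: "s \<in> carrier R" using s by simp
  have "loc_frac R I a s \<otimes>\<^bsub>localization_at R I\<^esub> loc_frac R I s \<one> = loc_frac R I (a \<otimes> s) s"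
    unfolding loc_frac_mult[OF a s sc one_compl] using sc by simp
  also have "\<dots> = loc_frac R I a \<one>"
    by (rule loc_frac_eqI[OF _ s a one_compl one_compl]) (use a sc in \<open>auto simp: a_minus_def r_neg\<close>)
  finally show ?thesis .
qed

text \<open>An inverse \<open>c / s\<close> of \<open>t / 1\<close> would give
  \<open>w s = w c t\<close> for some \<open>w\<close> outside \<open>I\<close>. The right side lies
  in \<open>I\<close>, while a product of elements outside the prime \<open>I\<close> does
  not.\<close>

lemma loc_frac_not_Units:
  assumes t: "t \<in> I"
  shows "loc_frac R I t \<one> \<notin> Units (localization_at R I)"
proof
  note tc = Icarr[OF t]
  assume "loc_frac R I t \<one> \<in> Units (localization_at R I)"
  then obtain y where "y \<in> carrier (localization_at R I)"
    and ty: "loc_frac R I t \<one> \<otimes>\<^bsub>localization_at R I\<^esub> y = \<one>\<^bsub>localization_at R I\<^esub>"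
    unfolding Units_def by blast
  then obtain c s where c: "c \<in> carrier R" and s: "s \<in> carrier R - I" and y: "y = loc_frac R I c s"
    using loc_frac_cases by blast
  have sc: "s \<in> carrier R" using s by simp
  have "loc_frac R I \<one> \<one> = loc_frac R I (t \<otimes> c) s"
    using ty unfolding y loc_frac_mult[OF tc one_compl c s] loc_one using sc by simp
  then obtain w where w: "w \<in> carrier R - I" and weq: "w \<otimes> (t \<otimes> c \<otimes> \<one> \<ominus> \<one> \<otimes> s) = \<zero>"
    by (rule loc_frac_eqD[OF one_closed one_compl])
  have wc: "w \<in> carrier R" using w by simp
  have "w \<otimes> s = (w \<otimes> c) \<otimes> t \<ominus> w \<otimes> (t \<otimes> c \<otimes> \<one> \<ominus> \<one> \<otimes> s)" using wc sc c tc by algebra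
  also have "\<dots> = (w \<otimes> c) \<otimes> t" unfolding weq using wc c tc by algebra
  also have "\<dots> \<in> I" by (rule I_l_closed[OF t]) (use wc c in simp)
  finally show False using compl_mult[OF w s] by simp
qed

text \<open>If \<open>(c t) / s\<close> is zero, then \<open>w c t = 0\<close> for some
  \<open>w\<close> outside \<open>I\<close>. Cancelling \<open>t\<close> gives
  \<open>w c = 0\<close>, and the same \<open>w\<close> shows that \<open>c / s\<close> is
  zero.\<close>

lemma loc_frac_nonzerodivisor:
  assumes t: "t \<in> carrier R" and nzd: "\<And>c. c \<in> carrier R \<Longrightarrow> c \<otimes> t = \<zero> \<Longrightarrow> c = \<zero>"
    and x: "x \<in> carrier (localization_at R I)"
    and xt: "x \<otimes>\<^bsub>localization_at R I\<^esub> loc_frac R I t \<one> = \<zero>\<^bsub>localization_at R I\<^esub>"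
  shows "x = \<zero>\<^bsub>localization_at R I\<^esub>"
proof -
  obtain c s where c: "c \<in> carrier R" and s: "s \<in> carrier R - I" and xeq: "x = loc_frac R I c s"
    using x by (rule loc_frac_cases)
  have sc: "s \<in> carrier R" using s by simp
  have "loc_frac R I \<zero> \<one> = loc_frac R I (c \<otimes> t) s"
    using xt unfolding xeq loc_frac_mult[OF c s t one_compl] loc_zero using sc by simp
  then obtain w where w: "w \<in> carrier R - I" and weq: "w \<otimes> (c \<otimes> t \<otimes> \<one> \<ominus> \<zero> \<otimes> s) = \<zero>"
    by (rule loc_frac_eqD[OF zero_closed one_compl])
  have wc: "w \<in> carrier R" using w by simp
  have "(w \<otimes> c) \<otimes> t = w \<otimes> (c \<otimes> t \<otimes> \<one> \<ominus> \<zero> \<otimes> s)" using wc sc c t by algebra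
  then have wc0: "w \<otimes> c = \<zero>" using nzd[of "w \<otimes> c"] weq wc c by simp
  show ?thesis unfolding xeq loc_zero
  proof (rule loc_frac_eqI[OF c s zero_closed one_compl w])
    have "w \<otimes> (c \<otimes> \<one> \<ominus> \<zero> \<otimes> s) = w \<otimes> c" using wc sc c by algebra
    then show "w \<otimes> (c \<otimes> \<one> \<ominus> \<zero> \<otimes> s) = \<zero>" using wc0 by simp
  qed
qed

text \<open>All denominators are already invertible, so \<open>c / s\<close> is the image of
  \<open>c\<close> times the inverse of \<open>s\<close>. Applied to a local ring and its maximal
  ideal.\<close>

lemma loc_frac_bij:
  assumes units: "carrier R - I \<subseteq> Units R"
  shows "bij_betw (\<lambda>a. loc_frac R I a \<one>) (carrier R) (carrier (localization_at R I))"
proof (rule bij_betw_imageI)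
  show "inj_on (\<lambda>a. loc_frac R I a \<one>) (carrier R)"
  proof (rule inj_onI)
    fix a b assume a: "a \<in> carrier R" and b: "b \<in> carrier R" and eq: "loc_frac R I a \<one> = loc_frac R I b \<one>"
    obtain w where w: "w \<in> carrier R - I" and weq: "w \<otimes> (b \<otimes> \<one> \<ominus> a \<otimes> \<one>) = \<zero>"
      using loc_frac_eqD[OF a one_compl eq] .
    have wu: "w \<in> Units R" using w units by blast
    have "w \<otimes> (b \<otimes> \<one> \<ominus> a \<otimes> \<one>) = w \<otimes> \<zero>" unfolding weq using w by simp
    then have "b \<otimes> \<one> \<ominus> a \<otimes> \<one> = \<zero>"
      using Units_l_cancel[OF wu, of "b \<otimes> \<one> \<ominus> a \<otimes> \<one>" \<zero>] a b by blast
    then show "a = b" using a b by simp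
  qed
  show "(\<lambda>a. loc_frac R I a \<one>) ` carrier R = carrier (localization_at R I)"
  proof (intro equalityI subsetI)
    fix x assume "x \<in> carrier (localization_at R I)"
    then obtain c s where c: "c \<in> carrier R" and s: "s \<in> carrier R - I" and xeq: "x = loc_frac R I c s"
      by (rule loc_frac_cases)
    have su: "s \<in> Units R" using s units by blast
    have i: "inv s \<in> carrier R" "inv s \<otimes> s = \<one>" "s \<in> carrier R" using su by auto
    have "x = loc_frac R I (c \<otimes> inv s) \<one>" unfolding xeq
    proof (rule loc_frac_eqI[OF c s _ one_compl one_compl])
      show "c \<otimes> inv s \<in> carrier R" using c i by simp
      have "\<one> \<otimes> (c \<otimes> \<one> \<ominus> c \<otimes> inv s \<otimes> s) = c \<ominus> c \<otimes> (inv s \<otimes> s)" using c i(1,3) by algebra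
      also have "\<dots> = \<zero>" unfolding i(2) using c by algebra
      finally show "\<one> \<otimes> (c \<otimes> \<one> \<ominus> c \<otimes> inv s \<otimes> s) = \<zero>" .
    qed
    then show "x \<in> (\<lambda>a. loc_frac R I a \<one>) ` carrier R" using c i by blast
  qed (use loc_frac_carrier[OF _ one_compl] in auto)
qed

end

text \<open>For local \<open>C\<close> the Gorenstein hypothesis speaks of the localization of
  \<open>C\<close> at its maximal ideal. Carrying a triple from \<open>C\<close> to the localization
  is simpler than carrying injective modules back.\<close>

lemma (in minimal_multiplicity_triple) image_under_iso:
  assumes S: "cring S" and h: "h \<in> ring_hom R S" and bij: "bij_betw h (carrier R) (carrier S)"
  shows "minimal_multiplicity_triple (h ` J) S (h t) (h a) (h b)"
proof -
  interpret S: cring S by fact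
  interpret h: ring_hom_ring R S h
    by (intro ring_hom_ringI2 ring_axioms S.ring_axioms h)
  have surj: "\<exists>x\<in>carrier R. y = h x" if "y \<in> carrier S" for y
    using bij that unfolding bij_betw_def by blast
  have inj: "x = y" if "x \<in> carrier R" "y \<in> carrier R" "h x = h y" for x y
    using bij that unfolding bij_betw_def inj_on_def by blast
  have "ideal (h ` J) S"
  proof (rule idealI[OF S.ring_axioms])
    show "subgroup (h ` J) (add_monoid S)"
    proof (rule S.add.subgroupI)
      show "h ` J \<subseteq> carrier S" using Icarr by auto
      show "h ` J \<noteq> {}" using mem by blast
      fix x assume "x \<in> h ` J"
      then obtain x' where x': "x' \<in> J" "x = h x'" by blast
      have "\<ominus>\<^bsub>S\<^esub> x = h (\<ominus> x')" unfolding x' using Icarr[OF x'(1)] by simp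
      then show "\<ominus>\<^bsub>S\<^esub> x \<in> h ` J"
        using additive_subgroup.a_inv_closed[OF is_additive_subgroup x'(1)] by blast
      fix y assume "y \<in> h ` J"
      then obtain y' where y': "y' \<in> J" "y = h y'" by blast
      have "x \<oplus>\<^bsub>S\<^esub> y = h (x' \<oplus> y')" unfolding x' y' using Icarr[OF x'(1)] Icarr[OF y'(1)] by simp
      then show "x \<oplus>\<^bsub>S\<^esub> y \<in> h ` J"
        using additive_subgroup.a_closed[OF is_additive_subgroup x'(1) y'(1)] by blast
    qed
    fix x y assume "x \<in> h ` J" and y: "y \<in> carrier S"
    then obtain x' where x': "x' \<in> J" "x = h x'" by blast
    obtain y' where y': "y' \<in> carrier R" "y = h y'" using surj[OF y] by blast
    have "y \<otimes>\<^bsub>S\<^esub> x = h (y' \<otimes> x')" unfolding x' y' using Icarr[OF x'(1)] y'(1) by simp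
    then show "y \<otimes>\<^bsub>S\<^esub> x \<in> h ` J" using I_l_closed[OF x'(1) y'(1)] by blast
    then show "x \<otimes>\<^bsub>S\<^esub> y \<in> h ` J"
      using S.m_comm[OF y, of x] Icarr[OF x'(1)] x'(2) by simp
  qed
  moreover have "minimal_multiplicity_triple_axioms (h ` J) S (h t) (h a) (h b)"
  proof
    show "\<one>\<^bsub>S\<^esub> \<notin> h ` J"
    proof
      assume "\<one>\<^bsub>S\<^esub> \<in> h ` J"
      then obtain x where x: "x \<in> J" "h x = \<one>\<^bsub>S\<^esub>" by force
      then have "x = \<one>" using inj[OF Icarr[OF x(1)] one_closed] by simp
      then show False using one_notin x by simp
    qed
    show "h t \<in> h ` J" "h a \<in> h ` J" "h b \<in> h ` J" using mem by blast+
  next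
    fix x assume "x \<in> h ` J"
    then obtain x' where x': "x' \<in> J" "x = h x'" by blast
    obtain r1 r2 r3 where r: "r1 \<in> carrier R" "r2 \<in> carrier R" "r3 \<in> carrier R"
      "x' = r1 \<otimes> t \<oplus> r2 \<otimes> a \<oplus> r3 \<otimes> b" using gen[OF x'(1)] by (elim bexE) (rule that)
    have "x = h r1 \<otimes>\<^bsub>S\<^esub> h t \<oplus>\<^bsub>S\<^esub> h r2 \<otimes>\<^bsub>S\<^esub> h a \<oplus>\<^bsub>S\<^esub> h r3 \<otimes>\<^bsub>S\<^esub> h b"
      unfolding x'(2) r(4) using r(1-3) carr by simp
    then show "\<exists>r1\<in>carrier S. \<exists>r2\<in>carrier S. \<exists>r3\<in>carrier S.
      x = r1 \<otimes>\<^bsub>S\<^esub> h t \<oplus>\<^bsub>S\<^esub> r2 \<otimes>\<^bsub>S\<^esub> h a \<oplus>\<^bsub>S\<^esub> r3 \<otimes>\<^bsub>S\<^esub> h b" using r(1-3) by (blast intro: h.hom_closed)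
  next
    fix x y assume "x \<in> h ` J" "y \<in> h ` J"
    then obtain x' y' where x': "x' \<in> J" "x = h x'" and y': "y' \<in> J" "y = h y'" by blast
    obtain r where r: "r \<in> carrier R" "x' \<otimes> y' = r \<otimes> t" using sq[OF x'(1) y'(1)] by blast
    have "x \<otimes>\<^bsub>S\<^esub> y = h (x' \<otimes> y')" unfolding x' y' using Icarr[OF x'(1)] Icarr[OF y'(1)] by simp
    also have "\<dots> = h r \<otimes>\<^bsub>S\<^esub> h t" unfolding r(2) using r(1) carr by simp
    finally show "\<exists>r\<in>carrier S. x \<otimes>\<^bsub>S\<^esub> y = r \<otimes>\<^bsub>S\<^esub> h t" using r(1) by (blast intro: h.hom_closed)
  next
    fix r assume "r \<in> carrier S" and rt: "r \<otimes>\<^bsub>S\<^esub> h t = \<zero>\<^bsub>S\<^esub>"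
    then obtain r' where r': "r' \<in> carrier R" "r = h r'" using surj by blast
    have "h (r' \<otimes> t) = h \<zero>" using rt r' carr by simp
    then have "r' \<otimes> t = \<zero>" using inj r' carr by simp
    then have "r' = \<zero>" by (rule nzd[OF r'(1)])
    then show "r = \<zero>\<^bsub>S\<^esub>" unfolding r' by simp
  next
    fix r1 r2 r3 assume "r1 \<in> carrier S" "r2 \<in> carrier S" "r3 \<in> carrier S"
      and eq: "r1 \<otimes>\<^bsub>S\<^esub> h t \<oplus>\<^bsub>S\<^esub> r2 \<otimes>\<^bsub>S\<^esub> h a \<oplus>\<^bsub>S\<^esub> r3 \<otimes>\<^bsub>S\<^esub> h b = \<zero>\<^bsub>S\<^esub>"
    then obtain s1 s2 s3 where s: "s1 \<in> carrier R" "s2 \<in> carrier R" "s3 \<in> carrier R"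
      and rs: "r1 = h s1" "r2 = h s2" "r3 = h s3" using surj by metis
    have "h (s1 \<otimes> t \<oplus> s2 \<otimes> a \<oplus> s3 \<otimes> b) = h \<zero>" using eq unfolding rs using s carr by simp
    then have "s1 \<otimes> t \<oplus> s2 \<otimes> a \<oplus> s3 \<otimes> b = \<zero>" using inj s carr by simp
    then show "r2 \<in> h ` J \<and> r3 \<in> h ` J" using rel[OF s] rs by blast
  qed
  ultimately show ?thesis by (intro minimal_multiplicity_triple.intro S)
qed

section \<open>Discrete valuation rings with a chosen uniformizer\<close>

locale discrete_valuation = principal_domain R for R (structure) +
  fixes t
  assumes t_carr: "t \<in> carrier R" and t_nonzero: "t \<noteq> \<zero>"
    and maximal: "maximalideal (PIdl t) R"
    and unique: "\<And>M. maximalideal M R \<Longrightarrow> M = PIdl t"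

lemma discrete_valuation_ring_uniformizer:
  fixes R (structure)
  assumes "discrete_valuation_ring R"
  shows "\<exists>t. discrete_valuation R t"
proof -
  interpret principal_domain R using assms by (simp add: discrete_valuation_ring_def)
  have "\<exists>!J. maximalideal J R"
    using assms by (simp add: discrete_valuation_ring_def local_ring_def)
  then obtain J where J: "maximalideal J R" and unique: "\<forall>M. maximalideal M R \<longrightarrow> M = J" by auto
  obtain t where t: "t \<in> carrier R" "J = PIdl t"
    using exists_gen J unfolding maximalideal_def by blast
  have t0: "t \<noteq> \<zero>"
  proof
    assume "t = \<zero>"
    then have "J = {\<zero>}" unfolding t(2) cgenideal_def by (auto intro: exI[of _ "\<zero>"])
    then have "field R" using zeromaximalideal_fieldI J by simp
    then show False using assms by (simp add: discrete_valuation_ring_def)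
  qed
  have "discrete_valuation R t"
  proof (intro discrete_valuation.intro discrete_valuation_axioms.intro principal_domain_axioms)
    show "t \<noteq> \<zero>" by (rule t0)
    show "t \<in> carrier R" by (rule t(1))
    show "maximalideal (PIdl t) R" using J unfolding t(2) .
    show "M = PIdl t" if "maximalideal M R" for M
      using unique that unfolding t(2) by blast
  qed
  then show ?thesis by blast
qed

context discrete_valuation
begin

lemma Units_or_multiple:
  assumes "x \<in> carrier R"
  shows "x \<in> Units R \<or> (\<exists>r\<in>carrier R. x = r \<otimes> t)"
  using Units_if_not_mem_maximal[OF noetherian_ring_axioms unique assms] by (auto simp: cgenideal_def)

lemma t_not_Units: "t \<notin> Units R"
  using ideal_eq_carrier_iff[OF t_carr] maximalideal.I_notcarr[OF maximal] by simp

lemma one_minus_Units: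
  assumes "r \<in> carrier R"
  shows "\<one> \<ominus> r \<otimes> t \<in> Units R"
proof (rule ccontr)
  assume "\<one> \<ominus> r \<otimes> t \<notin> Units R"
  then obtain q where q: "q \<in> carrier R" "\<one> \<ominus> r \<otimes> t = q \<otimes> t"
    using Units_or_multiple[of "\<one> \<ominus> r \<otimes> t"] assms t_carr by auto
  have "\<one> = (\<one> \<ominus> r \<otimes> t) \<oplus> r \<otimes> t" using assms t_carr by algebra
  also have "\<dots> = (q \<oplus> r) \<otimes> t" unfolding q(2) using assms t_carr q(1) by algebra
  finally have one: "\<one> = (q \<oplus> r) \<otimes> t" .
  have "t \<in> Units R"
    using one[symmetric] assms t_carr q(1) unfolding Units_def
    by (auto simp: m_comm intro!: bexI[of _ "q \<oplus> r"])
  then show False using t_not_Units by contradiction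
qed

text \<open>Phrased with sums and products alone, which a subring shares literally with the ambient
  ring; additive and multiplicative inverses are defined through the carrier.\<close>

lemma inverse_of_one_minus:
  assumes "r \<in> carrier R"
  shows "\<exists>v\<in>carrier R. \<exists>w\<in>carrier R. v \<otimes> w = \<one> \<and> w \<oplus> r \<otimes> t = \<one>"
proof -
  note u = one_minus_Units[OF assms]
  have "(\<one> \<ominus> r \<otimes> t) \<oplus> r \<otimes> t = \<one>" using assms t_carr by algebra
  then show ?thesis using Units_l_inv[OF u] Units_inv_closed[OF u] Units_closed[OF u] by blast
qed

text \<open>A nonzero prime of a principal domain has an irreducible generator, so it is maximal and
  therefore equals \<open>PIdl t\<close>.\<close>

lemma t_mem_prime:
  assumes Q: "primeideal Q R" and x: "x \<in> Q" "x \<noteq> \<zero>"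
  shows "t \<in> Q"
proof -
  interpret Q: primeideal Q R by fact
  obtain p where p: "p \<in> carrier R" "Q = PIdl p" using exists_gen[OF Q.is_ideal] by blast
  have "p \<noteq> \<zero>" using x unfolding p(2) cgenideal_def by auto
  then have "ring_prime p" using primeideal_iff_prime[of p] p Q by simp
  then have "ring_irreducible p" using primeness_condition[OF p(1)] by simp
  then have "maximalideal (PIdl p) R" by (rule irreducible_imp_maximalideal[OF p(1)])
  then have "PIdl p = PIdl t" by (rule unique)
  then show ?thesis unfolding p(2) using cgenideal_self[OF t_carr] by simp
qed

text \<open>Let \<open>g\<close> generate the ideal of \<open>x\<close> and \<open>y\<close>, with
  \<open>x = x' g\<close> and \<open>y = y' g\<close>. Cancelling \<open>g\<close> in
  \<open>g = r x + s y\<close> gives \<open>r x' + s y' = 1\<close>. As 1 is not a multiple of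
  \<open>t\<close>, one of the cofactors is a unit.\<close>

lemma divides_total:
  assumes x: "x \<in> carrier R" and y: "y \<in> carrier R"
  shows "(\<exists>r\<in>carrier R. x = r \<otimes> y) \<or> (\<exists>r\<in>carrier R. y = r \<otimes> x)"
proof -
  note N = ideal_add_cgenideal[OF cgenideal_ideal[OF x] y]
  obtain g where g: "g \<in> carrier R" "PIdl x <+>\<^bsub>R\<^esub> PIdl y = PIdl g" using exists_gen[OF N(1)] by blast
  have "x \<in> PIdl g" "y \<in> PIdl g" using N cgenideal_self[OF x] unfolding g(2) by blast+
  then obtain x' y' where x': "x' \<in> carrier R" "x = x' \<otimes> g" and y': "y' \<in> carrier R" "y = y' \<otimes> g"
    unfolding cgenideal_def by blast
  have "g \<in> PIdl x <+>\<^bsub>R\<^esub> PIdl y" unfolding g(2) by (rule cgenideal_self[OF g(1)])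
  then obtain r s where r: "r \<in> carrier R" "s \<in> carrier R" "g = r \<otimes> x \<oplus> s \<otimes> y"
    unfolding set_add_def' cgenideal_def by blast
  show ?thesis
  proof (cases "g = \<zero>")
    case True
    then have "x = \<zero> \<otimes> y" using x' y by simp
    then show ?thesis by blast
  next
    case False
    have "(r \<otimes> x' \<oplus> s \<otimes> y') \<otimes> g = r \<otimes> (x' \<otimes> g) \<oplus> s \<otimes> (y' \<otimes> g)"
      using r(1,2) x'(1) y'(1) g(1) by algebra
    also have "\<dots> = \<one> \<otimes> g" using r(3) g(1) unfolding x'(2)[symmetric] y'(2)[symmetric] by simp
    finally have one: "r \<otimes> x' \<oplus> s \<otimes> y' = \<one>"
      using m_rcancel[OF False g(1)] r(1,2) x'(1) y'(1) by simp
    have "x' \<in> Units R \<or> y' \<in> Units R"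
    proof (rule ccontr)
      assume "\<not> ?thesis"
      then obtain p q where p: "p \<in> carrier R" "x' = p \<otimes> t" and q: "q \<in> carrier R" "y' = q \<otimes> t"
        using Units_or_multiple[OF x'(1)] Units_or_multiple[OF y'(1)] by blast
      have "(r \<otimes> p \<oplus> s \<otimes> q) \<otimes> t = \<one>"
        using one unfolding p(2) q(2) using r(1,2) p(1) q(1) t_carr by algebra
      then have "\<one> \<ominus> (r \<otimes> p \<oplus> s \<otimes> q) \<otimes> t = \<zero>" by (simp add: a_minus_def r_neg)
      then have "\<zero> \<in> Units R"
        using one_minus_Units[of "r \<otimes> p \<oplus> s \<otimes> q"] r(1,2) p(1) q(1) by simp
      then have "inv \<zero> \<otimes> \<zero> = \<one>" "inv \<zero> \<in> carrier R" by (rule Units_l_inv, rule Units_inv_closed)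
      then show False using one_not_zero by simp
    qed
    then show ?thesis
    proof
      assume u: "x' \<in> Units R"
      have "y = (y' \<otimes> inv x') \<otimes> x"
        unfolding x'(2) y'(2) using u x'(1) y'(1) g(1)
        by (metis Units_inv_closed Units_l_inv l_one m_assoc m_closed)
      then show ?thesis using u y'(1) by blast
    next
      assume u: "y' \<in> Units R"
      have "x = (x' \<otimes> inv y') \<otimes> y"
        unfolding x'(2) y'(2) using u x'(1) y'(1) g(1)
        by (metis Units_inv_closed Units_l_inv l_one m_assoc m_closed)
      then show ?thesis using u x'(1) by blast
    qed
  qed
qed

text \<open>The divisor is an entry of the list itself; dividing a list of coefficients by it
  therefore turns one of them into 1.\<close>

lemma exists_common_divisor:
  assumes "xs \<noteq> []" "set xs \<subseteq> carrier R"
  shows "\<exists>g\<in>set xs. \<forall>x\<in>set xs. \<exists>r\<in>carrier R. x = r \<otimes> g"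
  using assms
proof (induction xs rule: list_nonempty_induct)
  case (single x)
  then have "x = \<one> \<otimes> x" by simp
  then show ?case by auto
next
  case (cons x xs)
  then obtain g where g: "g \<in> set xs" and div: "\<forall>y\<in>set xs. \<exists>r\<in>carrier R. y = r \<otimes> g" by auto
  have xc: "x \<in> carrier R" and gc: "g \<in> carrier R" using cons g by auto
  from divides_total[OF xc gc] show ?case
  proof
    assume "\<exists>r\<in>carrier R. x = r \<otimes> g"
    then show ?thesis using g div by auto
  next
    assume "\<exists>r\<in>carrier R. g = r \<otimes> x"
    then obtain r where r: "r \<in> carrier R" "g = r \<otimes> x" by blast
    have "\<exists>q\<in>carrier R. y = q \<otimes> x" if "y \<in> set (x # xs)" for y
    proof (cases "y = x")
      case True
      then have "y = \<one> \<otimes> x" using xc by simp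
      then show ?thesis by blast
    next
      case False
      then obtain q where q: "q \<in> carrier R" "y = q \<otimes> g" using div \<open>y \<in> set (x # xs)\<close> by auto
      then have "y = (q \<otimes> r) \<otimes> x" using r xc by (simp add: m_assoc)
      then show ?thesis using q r by blast
    qed
    then show ?thesis by auto
  qed
qed

end


section \<open>Cubic rings\<close>

locale cubic_order = cring L for L :: "'a ring" (structure) +
  fixes K D C :: "'a set" and t :: 'a
  assumes K: "subfield K L" and D: "subring D L"
    and K_eq: "K = {a \<otimes> inv b | a b. a \<in> D \<and> b \<in> D - {\<zero>}}"
    and dim: "dimension 3 K (carrier L)"
    and C: "subring C L" and DC: "D \<subseteq> C"
    and dv: "discrete_valuation (L\<lparr>carrier := D\<rparr>) t"
begin

abbreviation S where "S \<equiv> L\<lparr>carrier := C\<rparr>"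
abbreviation V where "V \<equiv> L\<lparr>carrier := D\<rparr>"

sublocale V: discrete_valuation V t by (rule dv)

lemmas D_sub = subringE[OF D] and C_sub = subringE[OF C]

sublocale S: cring S
  using subcring_iff[OF C_sub(1)] subcringI'[OF C] by blast

lemma D_in_K: "D \<subseteq> K"
proof
  fix a assume a: "a \<in> D"
  have "\<one> \<in> D - {\<zero>}" using D_sub(3) subfieldE(6)[OF K] by simp
  moreover have "a = a \<otimes> inv \<one>" using a D_sub(1) by auto
  ultimately show "a \<in> K" unfolding K_eq using a by blast
qed

text \<open>\<open>L\<close> may have zero divisors, but nonzero elements of the subfield
  \<open>K\<close> are invertible in it.\<close>

lemma nonzero_cancel:
  assumes d: "d \<in> K" "d \<noteq> \<zero>" and x: "x \<in> carrier L" "d \<otimes> x = \<zero>"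
  shows "x = \<zero>"
proof -
  note i = subfield_m_inv[OF K, of d]
  have dc: "d \<in> carrier L" using d subfieldE(3)[OF K] by blast
  have ic: "inv d \<in> carrier L" using i(1) d subfieldE(3)[OF K] by blast
  have "x = (inv d \<otimes> d) \<otimes> x" using i(3) d x by simp
  also have "\<dots> = inv d \<otimes> (d \<otimes> x)" using ic dc x(1) by (rule m_assoc)
  also have "\<dots> = \<zero>" unfolding x(2) using ic by simp
  finally show ?thesis .
qed

lemma t_mem: "t \<in> D" "t \<noteq> \<zero>"
  using V.t_carr V.t_nonzero by auto

section \<open>Linear relations over \<open>D\<close> with a coefficient 1\<close>

lemma clear_denominators:
  assumes "set ks \<subseteq> K"
  shows "\<exists>b\<in>D. b \<noteq> \<zero> \<and> (\<forall>k\<in>set ks. b \<otimes> k \<in> D)"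
  using assms
proof (induction ks)
  case Nil
  then show ?case using t_mem by auto
next
  case (Cons k ks)
  then obtain b where b: "b \<in> D" "b \<noteq> \<zero>" and bk: "\<forall>k\<in>set ks. b \<otimes> k \<in> D" by auto
  obtain a c where a: "a \<in> D" and c: "c \<in> D" "c \<noteq> \<zero>" and k: "k = a \<otimes> inv c"
    using Cons(2) unfolding K_eq by auto
  have cK: "c \<in> K - {\<zero>}" using c D_in_K by blast
  have carr: "a \<in> carrier L" "b \<in> carrier L" "c \<in> carrier L" "inv c \<in> carrier L"
    using a b(1) c(1) D_sub(1) subfield_m_inv(1)[OF K cK] subfieldE(3)[OF K] by blast+
  have "(c \<otimes> b) \<otimes> k = b \<otimes> a \<otimes> (c \<otimes> inv c)" unfolding k using carr by algebra
  also have "\<dots> = b \<otimes> a" unfolding subfield_m_inv(2)[OF K cK] using carr by simp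
  finally have 1: "(c \<otimes> b) \<otimes> k \<in> D" using D_sub(6)[OF b(1) a] by simp
  have 2: "(c \<otimes> b) \<otimes> k' \<in> D" if "k' \<in> set ks" for k'
  proof -
    have k'c: "k' \<in> carrier L" using that Cons(2) subfieldE(3)[OF K] by auto
    have "(c \<otimes> b) \<otimes> k' = c \<otimes> (b \<otimes> k')" using carr k'c by (simp add: m_assoc)
    then show ?thesis using D_sub(6)[OF c(1)] bk that by simp
  qed
  have "c \<otimes> b \<noteq> \<zero>" using nonzero_cancel[of c b] cK carr b by blast
  then show ?case using 1 2 D_sub(6)[OF c(1) b(1)] by auto
qed

text \<open>Four elements of a 3-dimensional space are dependent over \<open>K\<close>. After
  multiplication by a common denominator, the relation is divided by a coefficient that divides all
  others.\<close>

lemma primitive_relation: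
  assumes "set xs \<subseteq> carrier L" "length xs = 4"
  shows "\<exists>ds. length ds = 4 \<and> set ds \<subseteq> D \<and> \<one> \<in> set ds \<and> combine ds xs = \<zero>"
proof -
  have "dependent K xs"
    using independent_length_le_dimension[OF K dim, of xs] assms by auto
  then obtain ks where ks: "length ks = length xs" "combine ks xs = \<zero>" "set ks \<subseteq> K" "set ks \<noteq> {\<zero>}"
    using dependent_imp_non_trivial_combine[OF K assms(1)] by blast
  have ksc: "set ks \<subseteq> carrier L" using ks(3) subfieldE(3)[OF K] by blast
  obtain b where b: "b \<in> D" "b \<noteq> \<zero>" and bk: "\<forall>k\<in>set ks. b \<otimes> k \<in> D"
    using clear_denominators[OF ks(3)] by blast
  have bc: "b \<in> carrier L" using b(1) D_sub(1) by blast
  define es where "es = map ((\<otimes>) b) ks"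
  have es: "length es = 4" "set es \<subseteq> D" using ks(1) assms(2) bk by (auto simp: es_def)
  have es0: "combine es xs = \<zero>"
    unfolding es_def combine_r_distr[OF ksc assms(1) bc, symmetric] ks(2) using bc by simp
  have "es \<noteq> []" "set es \<subseteq> carrier V" using es by auto
  from V.exists_common_divisor[OF this] obtain g where g: "g \<in> set es"
    and div: "\<forall>e\<in>set es. \<exists>r\<in>D. e = r \<otimes> g" by auto
  have gD: "g \<in> D" using g es by blast
  have gc: "g \<in> carrier L" using gD D_sub(1) by blast
  \<comment> \<open>A zero divisor \<open>g\<close> would make all coefficients vanish, against the
    nontriviality of the relation over \<open>K\<close>.\<close>
  have g0: "g \<noteq> \<zero>"
  proof
    assume g0: "g = \<zero>"
    have "k = \<zero>" if "k \<in> set ks" for k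
    proof -
      have "b \<otimes> k \<in> set es" using that by (simp add: es_def)
      then obtain r where "r \<in> D" "b \<otimes> k = r \<otimes> g" using div by blast
      then have "b \<otimes> k = \<zero>" using g0 D_sub(1) by auto
      moreover have "k \<in> carrier L" using ksc that by blast
      ultimately show ?thesis using nonzero_cancel[of b k] b D_in_K by blast
    qed
    then have "set ks \<subseteq> {\<zero>}" by auto
    moreover have "set ks \<noteq> {}" using ks(1) assms(2) by auto
    ultimately have "set ks = {\<zero>}" unfolding subset_singleton_iff by simp
    then show False using ks(4) by simp
  qed
  from div have "\<forall>e\<in>set es. \<exists>r. r \<in> D \<and> e = r \<otimes> g" by blast
  from bchoice[OF this] obtain r where r: "\<forall>e\<in>set es. r e \<in> D \<and> e = r e \<otimes> g" by blast
  define ds where "ds = map r es"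
  have ds: "length ds = 4" "set ds \<subseteq> D" using es r by (auto simp: ds_def)
  have dsc: "set ds \<subseteq> carrier L" using ds D_sub(1) by blast
  have "es = map ((\<otimes>) g) ds"
    unfolding ds_def map_map
  proof (rule map_idI[symmetric])
    fix e assume e: "e \<in> set es"
    have "r e \<in> carrier L" using r e D_sub(1) by blast
    then show "((\<otimes>) g \<circ> r) e = e" using r e gc m_comm[of g "r e"] by simp
  qed
  then have "g \<otimes> combine ds xs = \<zero>"
    using es0 combine_r_distr[OF dsc assms(1) gc] by simp
  then have "combine ds xs = \<zero>"
    using nonzero_cancel[of g "combine ds xs"] gD g0 D_in_K combine_in_carrier[OF dsc assms(1)] by blast
  \<comment> \<open>The quotient of \<open>g\<close> by itself: \<open>r g\<close> satisfies
    \<open>g = r g \<otimes> g\<close>, and \<open>g\<close> can be cancelled.\<close>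
  moreover have "\<one> \<in> set ds"
  proof -
    have rg: "r g \<in> carrier L" "g = r g \<otimes> g" using r g D_sub(1) by blast+
    have "g \<otimes> (r g \<ominus> \<one>) = r g \<otimes> g \<ominus> g" using rg(1) gc by algebra
    also have "\<dots> = \<zero>" unfolding rg(2)[symmetric] using gc by (simp add: a_minus_def r_neg)
    finally have "r g \<ominus> \<one> = \<zero>" using nonzero_cancel[of g "r g \<ominus> \<one>"] gD g0 D_in_K rg by blast
    then have "r g = \<one>" using rg(1) by simp
    then show ?thesis using g by (auto simp: ds_def intro: rev_image_eqI)
  qed
  ultimately show ?thesis using ds by blast
qed

lemma primitive_relation4:
  assumes "x0 \<in> carrier L" "x1 \<in> carrier L" "x2 \<in> carrier L" "x3 \<in> carrier L"
  obtains d0 d1 d2 d3 where "d0 \<in> D" "d1 \<in> D" "d2 \<in> D" "d3 \<in> D" "\<one> \<in> {d0, d1, d2, d3}"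
    "d0 \<otimes> x0 \<oplus> d1 \<otimes> x1 \<oplus> d2 \<otimes> x2 \<oplus> d3 \<otimes> x3 = \<zero>"
proof -
  obtain ds where ds: "length ds = 4" "set ds \<subseteq> D" "\<one> \<in> set ds" "combine ds [x0, x1, x2, x3] = \<zero>"
    using primitive_relation[of "[x0, x1, x2, x3]"] assms by auto
  obtain d0 d1 d2 d3 where d: "ds = [d0, d1, d2, d3]"
    using ds(1) by (auto simp: numeral_eq_Suc length_Suc_conv)
  have c: "d0 \<in> carrier L" "d1 \<in> carrier L" "d2 \<in> carrier L" "d3 \<in> carrier L"
    using ds(2) D_sub(1) unfolding d by auto
  have "d0 \<otimes> x0 \<oplus> d1 \<otimes> x1 \<oplus> d2 \<otimes> x2 \<oplus> d3 \<otimes> x3 = combine ds [x0, x1, x2, x3]"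
    unfolding d combine.simps using c assms by algebra
  then show thesis using that[of d0 d1 d2 d3] ds(2-4) unfolding d by simp
qed

text \<open>The generator \<open>e\<close> is redundant: e = c' t + p with c' = m + d e, so (1 - d
  t) e = t m + p lies in \<open>A\<close>, and 1 - d t is a unit of \<open>D\<close>.\<close>

lemma nakayama_step:
  assumes A: "LinearCombinations.submodule V A (mult_module L C)" and PA: "P \<subseteq> A"
    and e: "e \<in> C"
    and tC: "\<And>c. c \<in> C \<Longrightarrow> \<exists>c'\<in>C. \<exists>p\<in>P. c = c' \<otimes> t \<oplus> p"
    and gen: "\<And>c. c \<in> C \<Longrightarrow> \<exists>m\<in>A. \<exists>d\<in>D. c = m \<oplus> d \<otimes> e"
  shows "A = C"
proof -
  have A_add: "x \<oplus> y \<in> A" if "x \<in> A" "y \<in> A" for x y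
    using submodule.m_closed[OF A that] by (simp add: mult_module_def)
  have A_smult: "d \<otimes> x \<in> A" if "d \<in> D" "x \<in> A" for d x
    using submodule.smult_closed[OF A _ that(2), of d] that(1) by (simp add: mult_module_def)
  have AC: "A \<subseteq> C" using submodule.subset[OF A] by (simp add: mult_module_def)
  obtain c' p where c': "c' \<in> C" "p \<in> P" "e = c' \<otimes> t \<oplus> p" using tC[OF e] by blast
  obtain m d where m: "m \<in> A" "d \<in> D" "c' = m \<oplus> d \<otimes> e" using gen[OF c'(1)] by blast
  have carr: "e \<in> carrier L" "c' \<in> carrier L" "p \<in> carrier L" "m \<in> carrier L" "d \<in> carrier L" "t \<in> carrier L"
    using e c'(1) m(1,2) c'(2) PA AC C_sub(1) D_sub(1) t_mem(1) by blast+
  \<comment> \<open>Here \<open>w\<close> stands for 1 - d t, and \<open>v\<close> is its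
    inverse.\<close>
  obtain v w where v: "v \<in> D" and wD: "w \<in> D" and vw: "v \<otimes> w = \<one>" and wdt: "w \<oplus> d \<otimes> t = \<one>"
    using V.inverse_of_one_minus[of d] m(2) by auto
  have w: "w \<in> carrier L" "v \<in> carrier L" using v wD D_sub(1) by auto
  have "w \<otimes> e \<oplus> d \<otimes> t \<otimes> e = (w \<oplus> d \<otimes> t) \<otimes> e" using w(1) carr by algebra
  also have "\<dots> = (m \<oplus> d \<otimes> e) \<otimes> t \<oplus> p" unfolding wdt using c'(3) m(3) carr by simp
  also have "\<dots> = (t \<otimes> m \<oplus> p) \<oplus> d \<otimes> t \<otimes> e" using carr by algebra
  finally have "w \<otimes> e = t \<otimes> m \<oplus> p" using w(1) carr by simp
  then have "v \<otimes> (w \<otimes> e) \<in> A" using A_smult[OF v] A_add A_smult[OF t_mem(1) m(1)] c'(2) PA by auto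
  moreover have "v \<otimes> (w \<otimes> e) = e" using m_assoc[OF w(2,1) carr(1)] vw carr(1) by simp
  ultimately have eA: "e \<in> A" by simp
  have "C \<subseteq> A"
  proof
    fix c assume "c \<in> C"
    then obtain m d where "m \<in> A" "d \<in> D" "c = m \<oplus> d \<otimes> e" using gen by blast
    then show "c \<in> A" using A_add A_smult eA by simp
  qed
  with AC show ?thesis by blast
qed

lemma submodule_extend:
  assumes A: "LinearCombinations.submodule V A (mult_module L C)" and e: "e \<in> C"
  shows "LinearCombinations.submodule V {m \<oplus> d \<otimes> e | m d. m \<in> A \<and> d \<in> D} (mult_module L C)"
proof -
  have A_add: "x \<oplus> y \<in> A" if "x \<in> A" "y \<in> A" for x y
    using submodule.m_closed[OF A that] by (simp add: mult_module_def)
  have A_smult: "d \<otimes> x \<in> A" if "d \<in> D" "x \<in> A" for d x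
    using submodule.smult_closed[OF A _ that(2), of d] that(1) by (simp add: mult_module_def)
  have A0: "\<zero> \<in> A" using submodule.zero_closed[OF A] by (simp add: mult_module_def)
  have AC: "A \<subseteq> C" using submodule.subset[OF A] by (simp add: mult_module_def)
  have ec: "e \<in> carrier L" using e C_sub(1) by blast
  have Ac: "x \<in> carrier L" if "x \<in> A" for x using that AC C_sub(1) by blast
  have Dc: "x \<in> carrier L" if "x \<in> D" for x using that D_sub(1) by blast
  let ?N = "{m \<oplus> d \<otimes> e | m d. m \<in> A \<and> d \<in> D}"
  show ?thesis
  proof (rule LinearCombinations.submodule.intro)
    show "Module.module V (mult_module L C)" by (rule submodule.module[OF A])
    show "?N \<subseteq> carrier (mult_module L C)"
    proof
      fix x assume "x \<in> ?N"
      then obtain m d where md: "m \<in> A" "d \<in> D" "x = m \<oplus> d \<otimes> e" by blast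
      have "d \<otimes> e \<in> C" using C_sub(6) md(2) DC e by blast
      then show "x \<in> carrier (mult_module L C)"
        using C_sub(7)[of m "d \<otimes> e"] md(1) AC md(3) by (auto simp: mult_module_def)
    qed
    have "\<zero> = \<zero> \<oplus> \<zero> \<otimes> e" using ec by simp
    then show "\<zero>\<^bsub>mult_module L C\<^esub> \<in> ?N"
      using A0 D_sub(2) by (auto simp: mult_module_def)
  next
    fix x y assume "x \<in> ?N" "y \<in> ?N"
    then obtain m d m' d' where md: "m \<in> A" "d \<in> D" "x = m \<oplus> d \<otimes> e"
      and md': "m' \<in> A" "d' \<in> D" "y = m' \<oplus> d' \<otimes> e" by blast
    have "x \<oplus> y = (m \<oplus> m') \<oplus> (d \<oplus> d') \<otimes> e"
      unfolding md(3) md'(3) using Ac[OF md(1)] Ac[OF md'(1)] Dc[OF md(2)] Dc[OF md'(2)] ec by algebra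
    moreover have "m \<oplus> m' \<in> A" "d \<oplus> d' \<in> D"
      using A_add[OF md(1) md'(1)] D_sub(7)[OF md(2) md'(2)] .
    ultimately have "x \<oplus> y \<in> ?N" by blast
    then show "x \<oplus>\<^bsub>mult_module L C\<^esub> y \<in> ?N" by (simp add: mult_module_def)
  next
    fix r x assume "r \<in> carrier V" "x \<in> ?N"
    then obtain m d where r: "r \<in> D" and md: "m \<in> A" "d \<in> D" "x = m \<oplus> d \<otimes> e" by auto
    have "r \<otimes> x = r \<otimes> m \<oplus> (r \<otimes> d) \<otimes> e"
      unfolding md(3) using Ac[OF md(1)] Dc[OF md(2)] Dc[OF r] ec by algebra
    moreover have "r \<otimes> m \<in> A" "r \<otimes> d \<in> D"
      using A_smult[OF r md(1)] D_sub(6)[OF r md(2)] .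
    ultimately have "r \<otimes> x \<in> ?N" by blast
    then show "r \<odot>\<^bsub>mult_module L C\<^esub> x \<in> ?N" by (simp add: mult_module_def)
  qed
qed

text \<open>The last hypothesis says that \<open>A\<close> and \<open>B\<close> together generate
  \<open>C\<close>. In the induction on \<open>B\<close> an element \<open>e\<close> is first
  adjoined to \<open>A\<close>, so that the induction hypothesis gives A + De = C, and is then
  removed by \<open>nakayama_step\<close>. The set \<open>P\<close> stays fixed while
  \<open>A\<close> grows.\<close>

lemma nakayama:
  assumes "finite B"
    and tC: "\<And>c. c \<in> C \<Longrightarrow> \<exists>c'\<in>C. \<exists>p\<in>P. c = c' \<otimes> t \<oplus> p"
    and "LinearCombinations.submodule V A (mult_module L C)" "P \<subseteq> A" "B \<subseteq> C"
    and "\<And>N. LinearCombinations.submodule V N (mult_module L C) \<Longrightarrow> A \<subseteq> N \<Longrightarrow> B \<subseteq> N \<Longrightarrow> N = C"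
  shows "A = C"
  using assms(1,3-)
proof (induction B arbitrary: A rule: finite_induct)
  case empty
  then show ?case by blast
next
  case (insert e B)
  have e: "e \<in> C" and BC: "B \<subseteq> C" using insert.prems by auto
  have ec: "e \<in> carrier L" using e C_sub(1) by blast
  have AC: "A \<subseteq> C" using submodule.subset[OF insert.prems(1)] by (simp add: mult_module_def)
  let ?A = "{m \<oplus> d \<otimes> e | m d. m \<in> A \<and> d \<in> D}"
  have A_sub: "A \<subseteq> ?A"
  proof
    fix m assume m: "m \<in> A"
    then have "m = m \<oplus> \<zero> \<otimes> e" using AC C_sub(1) ec by auto
    then show "m \<in> ?A" using m D_sub(2) by blast
  qed
  have "\<zero> \<in> A" using submodule.zero_closed[OF insert.prems(1)] by (simp add: mult_module_def)
  moreover have "e = \<zero> \<oplus> \<one> \<otimes> e" using ec by simp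
  ultimately have e_mem: "e \<in> ?A" using D_sub(3) by blast
  have "?A = C"
  proof (rule insert.IH)
    show "LinearCombinations.submodule V ?A (mult_module L C)"
      by (rule submodule_extend[OF insert.prems(1) e])
    show "P \<subseteq> ?A" using insert.prems(2) A_sub by (rule subset_trans)
    show "B \<subseteq> C" by (rule BC)
    fix N assume N: "LinearCombinations.submodule V N (mult_module L C)" "?A \<subseteq> N" "B \<subseteq> N"
    show "N = C"
      by (rule insert.prems(4)[OF N(1)]) (use N A_sub e_mem in blast)+
  qed
  then have gen: "\<exists>m\<in>A. \<exists>d\<in>D. c = m \<oplus> d \<otimes> e" if "c \<in> C" for c using that by blast
  show ?case by (rule nakayama_step[OF insert.prems(1,2) e tC gen])
qed

text \<open>If \<open>t\<close> were outside \<open>P\<close>, maximality would give C = P + tC. As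
  \<open>C\<close> is finitely generated over \<open>D\<close>, Nakayama's lemma applied to the
  submodule \<open>P\<close> would yield P = C.\<close>

lemma uniformizer_mem_maximal:
  assumes P: "maximalideal P S" and fg: "finitely_generated_module V (mult_module L C)"
  shows "t \<in> P"
proof (rule ccontr)
  assume tP: "t \<notin> P"
  interpret P: maximalideal P S by fact
  have tC: "t \<in> carrier S" using t_mem(1) DC by auto
  note N = S.ideal_add_cgenideal[OF P.is_ideal tC]
  have eq: "P <+>\<^bsub>S\<^esub> PIdl\<^bsub>S\<^esub> t = carrier S"
    using P.I_maximal[OF N(1,2)] N(3) tP ideal.Icarr[OF N(1)] by blast
  have decomp: "\<exists>c'\<in>C. \<exists>p\<in>P. c = c' \<otimes> t \<oplus> p" if "c \<in> C" for c
  proof -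
    have "c \<in> P <+>\<^bsub>S\<^esub> PIdl\<^bsub>S\<^esub> t" unfolding eq using \<open>c \<in> C\<close> by simp
    then obtain p c' where p: "p \<in> P" "c' \<in> C" "c = p \<oplus> c' \<otimes> t"
      unfolding set_add_def' cgenideal_def by auto
    have "p \<in> carrier L" "c' \<otimes> t \<in> carrier L"
      using P.Icarr[OF p(1)] C_sub(1) C_sub(6)[OF p(2)] tC by auto
    then show ?thesis using p a_comm by blast
  qed
  have mod: "Module.module V (mult_module L C)"
    using fg by (simp add: finitely_generated_module_def)
  obtain B where B: "finite B" "B \<subseteq> C" and span: "LinearCombinations.module.span V (mult_module L C) B = C"
    using fg unfolding finitely_generated_module_def by (auto simp: mult_module_def)
  have "P = C"
  proof (rule nakayama[OF B(1) decomp _ subset_refl B(2)])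
    show "LinearCombinations.submodule V P (mult_module L C)"
    proof (rule LinearCombinations.submodule.intro)
      show "Module.module V (mult_module L C)" by (rule mod)
      show "P \<subseteq> carrier (mult_module L C)" using P.Icarr by (auto simp: mult_module_def)
      show "\<zero>\<^bsub>mult_module L C\<^esub> \<in> P" using P.zero_closed by (simp add: mult_module_def)
      show "v \<oplus>\<^bsub>mult_module L C\<^esub> w \<in> P" if "v \<in> P" "w \<in> P" for v w
        using P.a_closed[OF that] by (simp add: mult_module_def)
      show "c \<odot>\<^bsub>mult_module L C\<^esub> v \<in> P" if "c \<in> carrier V" "v \<in> P" for c v
        using P.I_l_closed[OF that(2), of c] that(1) DC by (auto simp: mult_module_def)
    qed
    fix N assume N: "LinearCombinations.submodule V N (mult_module L C)" "B \<subseteq> N"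
    have "C \<subseteq> N" using LinearCombinations.module.span_is_subset[OF mod N(2,1)] span by simp
    moreover have "N \<subseteq> C" using submodule.subset[OF N(1)] by (simp add: mult_module_def)
    ultimately show "N = C" by blast
  qed
  then show False using P.I_notcarr by simp
qed

text \<open>Covers the localization map and the identity of \<open>C\<close> at once. Since
  \<open>h\<close> may have a kernel, relations are found in \<open>L\<close> and then pushed
  forward to \<open>R\<close>; a coefficient 1 remains a unit there.\<close>

lemma local_orderI:
  assumes R: "cring R" "noetherian_ring R" and J: "maximalideal J R"
    and unique: "\<And>M. maximalideal M R \<Longrightarrow> M = J"
    and h: "h \<in> ring_hom S R"
    and frac: "\<And>r. r \<in> carrier R \<Longrightarrow> \<exists>c\<in>C. \<exists>s\<in>C. h s \<in> Units R \<and> r \<otimes>\<^bsub>R\<^esub> h s = h c"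
    and nzd: "\<And>r. r \<in> carrier R \<Longrightarrow> r \<otimes>\<^bsub>R\<^esub> h t = \<zero>\<^bsub>R\<^esub> \<Longrightarrow> r = \<zero>\<^bsub>R\<^esub>"
    and t: "h t \<notin> Units R"
  shows "local_order R J (h ` D) (h t)"
proof -
  interpret R: cring R by fact
  interpret R: noetherian_ring R by fact
  have h_closed: "h x \<in> carrier R" if "x \<in> C" for x using ring_hom_closed[OF h] that by simp
  have h_add: "h (x \<oplus> y) = h x \<oplus>\<^bsub>R\<^esub> h y" if "x \<in> C" "y \<in> C" for x y
    using ring_hom_add[OF h, of x y] that by simp
  have h_mult: "h (x \<otimes> y) = h x \<otimes>\<^bsub>R\<^esub> h y" if "x \<in> C" "y \<in> C" for x y
    using ring_hom_mult[OF h, of x y] that by simp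
  have h_one: "h \<one> = \<one>\<^bsub>R\<^esub>" using ring_hom_one[OF h] by simp
  interpret h: ring_hom_ring S R h by (intro ring_hom_ringI2 S.ring_axioms R.ring_axioms h)
  have h_zero: "h \<zero> = \<zero>\<^bsub>R\<^esub>" using h.hom_zero by simp
  have DC': "d \<in> C" if "d \<in> D" for d using that DC by blast
  have hD: "h \<in> ring_hom V R"
    by (rule ring_hom_memI) (use h_one in \<open>simp_all add: h_closed h_add h_mult DC'\<close>)
  interpret hD: ring_hom_ring V R h by (intro ring_hom_ringI2 V.ring_axioms R.ring_axioms hD)
  note tC = DC'[OF t_mem(1)]
  have tc: "h t \<in> carrier R" by (rule h_closed[OF tC])
  have Units: "h d \<in> Units R" if d: "d \<in> Units V" for d
  proof -
    obtain v where v: "v \<in> D" "v \<otimes> d = \<one>" using d unfolding Units_def by auto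
    have dD: "d \<in> D" using V.Units_closed[OF d] by simp
    have "h v \<otimes>\<^bsub>R\<^esub> h d = \<one>\<^bsub>R\<^esub>" using h_mult[OF DC'[OF v(1)] DC'[OF dD]] v(2) h_one by simp
    moreover note vc = h_closed[OF DC'[OF v(1)]] and dc = h_closed[OF DC'[OF dD]]
    moreover have "h d \<otimes>\<^bsub>R\<^esub> h v = h v \<otimes>\<^bsub>R\<^esub> h d" by (rule R.m_comm[OF dc vc])
    ultimately show ?thesis unfolding Units_def by auto
  qed
  show ?thesis
  proof (intro local_order.intro local_order_axioms.intro R J)
    show "M = J" if "maximalideal M R" for M by (rule unique[OF that])
    show "h t \<in> J" using R.Units_if_not_mem_maximal[OF R(2) unique tc] t by blast
    show "r = \<zero>\<^bsub>R\<^esub>" if "r \<in> carrier R" "r \<otimes>\<^bsub>R\<^esub> h t = \<zero>\<^bsub>R\<^esub>" for r by (rule nzd[OF that])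
    show "h ` D \<subseteq> carrier R" using h_closed DC' by blast
    show "d \<in> Units R \<or> (\<exists>r\<in>carrier R. d = r \<otimes>\<^bsub>R\<^esub> h t)" if "d \<in> h ` D" for d
    proof -
      obtain x where x: "x \<in> D" "d = h x" using \<open>d \<in> h ` D\<close> by blast
      show ?thesis
      proof (cases "x \<in> Units V")
        case True
        then show ?thesis using Units x by blast
      next
        case False
        then obtain r where r: "r \<in> D" "x = r \<otimes> t" using V.Units_or_multiple[of x] x(1) by auto
        have "d = h r \<otimes>\<^bsub>R\<^esub> h t" unfolding x(2) r(2) by (rule h_mult[OF DC'[OF r(1)] tC])
        then show ?thesis using h_closed[OF DC'[OF r(1)]] by blast
      qed
    qed
    show "h t \<in> Q" if d: "d \<in> h ` D" "d \<noteq> \<zero>\<^bsub>R\<^esub>" and Q: "primeideal Q R" and dQ: "d \<in> Q" for d Q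
    proof -
      obtain x where x: "x \<in> D" "d = h x" using d(1) by blast
      \<comment> \<open>The contraction of \<open>Q\<close> to \<open>D\<close> is a nonzero prime
        of a discrete valuation ring, hence contains \<open>t\<close>.\<close>
      have "primeideal {r \<in> carrier V. h r \<in> Q} V" by (rule hD.primeideal_vimage[OF V.is_cring Q])
      moreover have "x \<in> {r \<in> carrier V. h r \<in> Q}" using x dQ by simp
      moreover have "x \<noteq> \<zero>\<^bsub>V\<^esub>" using d(2) x(2) h_zero by auto
      ultimately have "t \<in> {r \<in> carrier V. h r \<in> Q}" by (rule V.t_mem_prime)
      then show ?thesis by simp
    qed
    fix x0 x1 x2 x3
    assume x: "x0 \<in> carrier R" "x1 \<in> carrier R" "x2 \<in> carrier R" "x3 \<in> carrier R"
    obtain c0 s0 where 0: "c0 \<in> C" "s0 \<in> C" "h s0 \<in> Units R" "x0 \<otimes>\<^bsub>R\<^esub> h s0 = h c0" using frac[OF x(1)] by blast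
    obtain c1 s1 where 1: "c1 \<in> C" "s1 \<in> C" "h s1 \<in> Units R" "x1 \<otimes>\<^bsub>R\<^esub> h s1 = h c1" using frac[OF x(2)] by blast
    obtain c2 s2 where 2: "c2 \<in> C" "s2 \<in> C" "h s2 \<in> Units R" "x2 \<otimes>\<^bsub>R\<^esub> h s2 = h c2" using frac[OF x(3)] by blast
    obtain c3 s3 where 3: "c3 \<in> C" "s3 \<in> C" "h s3 \<in> Units R" "x3 \<otimes>\<^bsub>R\<^esub> h s3 = h c3" using frac[OF x(4)] by blast
    \<comment> \<open>Each \<open>?y\<close> is a numerator over the common denominator: its image
      is the corresponding \<open>x\<close> times \<open>?u\<close>. A relation between the
      numerators becomes one between the \<open>x\<close> after cancelling the unit
      \<open>?u\<close>, with the same coefficients.\<close>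
    let ?y0 = "c0 \<otimes> (s1 \<otimes> (s2 \<otimes> s3))" and ?y1 = "c1 \<otimes> (s0 \<otimes> (s2 \<otimes> s3))"
      and ?y2 = "c2 \<otimes> (s0 \<otimes> (s1 \<otimes> s3))" and ?y3 = "c3 \<otimes> (s0 \<otimes> (s1 \<otimes> s2))"
    note cs = 0(1,2) 1(1,2) 2(1,2) 3(1,2)
    have yC: "?y0 \<in> C" "?y1 \<in> C" "?y2 \<in> C" "?y3 \<in> C" using cs by (auto intro!: C_sub(6))
    have y: "?y0 \<in> carrier L" "?y1 \<in> carrier L" "?y2 \<in> carrier L" "?y3 \<in> carrier L"
      using yC C_sub(1) by blast+
    obtain d0 d1 d2 d3 where d: "d0 \<in> D" "d1 \<in> D" "d2 \<in> D" "d3 \<in> D" and one: "\<one> \<in> {d0, d1, d2, d3}"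
      and eq: "d0 \<otimes> ?y0 \<oplus> d1 \<otimes> ?y1 \<oplus> d2 \<otimes> ?y2 \<oplus> d3 \<otimes> ?y3 = \<zero>"
      by (rule primitive_relation4[OF y])
    note dC = d[THEN DC']
    note carr = x cs[THEN h_closed] dC[THEN h_closed]
    let ?u = "h s0 \<otimes>\<^bsub>R\<^esub> h s1 \<otimes>\<^bsub>R\<^esub> h s2 \<otimes>\<^bsub>R\<^esub> h s3"
    let ?r = "h d0 \<otimes>\<^bsub>R\<^esub> x0 \<oplus>\<^bsub>R\<^esub> h d1 \<otimes>\<^bsub>R\<^esub> x1 \<oplus>\<^bsub>R\<^esub> h d2 \<otimes>\<^bsub>R\<^esub> x2 \<oplus>\<^bsub>R\<^esub> h d3 \<otimes>\<^bsub>R\<^esub> x3"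
    have hy: "h ?y0 = (x0 \<otimes>\<^bsub>R\<^esub> h s0) \<otimes>\<^bsub>R\<^esub> (h s1 \<otimes>\<^bsub>R\<^esub> (h s2 \<otimes>\<^bsub>R\<^esub> h s3))"
      "h ?y1 = (x1 \<otimes>\<^bsub>R\<^esub> h s1) \<otimes>\<^bsub>R\<^esub> (h s0 \<otimes>\<^bsub>R\<^esub> (h s2 \<otimes>\<^bsub>R\<^esub> h s3))"
      "h ?y2 = (x2 \<otimes>\<^bsub>R\<^esub> h s2) \<otimes>\<^bsub>R\<^esub> (h s0 \<otimes>\<^bsub>R\<^esub> (h s1 \<otimes>\<^bsub>R\<^esub> h s3))"
      "h ?y3 = (x3 \<otimes>\<^bsub>R\<^esub> h s3) \<otimes>\<^bsub>R\<^esub> (h s0 \<otimes>\<^bsub>R\<^esub> (h s1 \<otimes>\<^bsub>R\<^esub> h s2))"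
      unfolding 0(4) 1(4) 2(4) 3(4) using cs by (simp_all add: h_mult C_sub(6))
    have "?r \<otimes>\<^bsub>R\<^esub> ?u = h d0 \<otimes>\<^bsub>R\<^esub> h ?y0 \<oplus>\<^bsub>R\<^esub> h d1 \<otimes>\<^bsub>R\<^esub> h ?y1 \<oplus>\<^bsub>R\<^esub> h d2 \<otimes>\<^bsub>R\<^esub> h ?y2 \<oplus>\<^bsub>R\<^esub> h d3 \<otimes>\<^bsub>R\<^esub> h ?y3"
      unfolding hy using carr by algebra
    also have "\<dots> = h (d0 \<otimes> ?y0 \<oplus> d1 \<otimes> ?y1 \<oplus> d2 \<otimes> ?y2 \<oplus> d3 \<otimes> ?y3)"
      using dC yC by (simp only: h_add h_mult C_sub(6,7))
    also have "\<dots> = \<zero>\<^bsub>R\<^esub>" unfolding eq by (rule h_zero)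
    finally have "?r \<otimes>\<^bsub>R\<^esub> ?u = \<zero>\<^bsub>R\<^esub>" .
    moreover have u: "?u \<in> Units R" using 0(3) 1(3) 2(3) 3(3) by (intro R.Units_m_closed)
    moreover have rc: "?r \<in> carrier R" using carr by simp
    ultimately have r0: "?r = \<zero>\<^bsub>R\<^esub>"
      using R.m_comm[OF rc R.Units_closed[OF u]] R.Units_l_cancel[OF u rc R.zero_closed] R.Units_closed[OF u]
      by simp
    have "h d0 \<in> Units R \<or> h d1 \<in> Units R \<or> h d2 \<in> Units R \<or> h d3 \<in> Units R"
      using one h_one R.Units_one_closed by auto
    then show "\<exists>d0\<in>h ` D. \<exists>d1\<in>h ` D. \<exists>d2\<in>h ` D. \<exists>d3\<in>h ` D.
      (d0 \<in> Units R \<or> d1 \<in> Units R \<or> d2 \<in> Units R \<or> d3 \<in> Units R) \<and>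
      d0 \<otimes>\<^bsub>R\<^esub> x0 \<oplus>\<^bsub>R\<^esub> d1 \<otimes>\<^bsub>R\<^esub> x1 \<oplus>\<^bsub>R\<^esub> d2 \<otimes>\<^bsub>R\<^esub> x2 \<oplus>\<^bsub>R\<^esub> d3 \<otimes>\<^bsub>R\<^esub> x3 = \<zero>\<^bsub>R\<^esub>"
      using r0 d by (intro bexI[of _ "h d0"] bexI[of _ "h d1"] bexI[of _ "h d2"] bexI[of _ "h d3"] conjI) auto
  qed
qed

section \<open>Application to the local rings of \<open>C\<close>\<close>

lemma uniformizer_nonzerodivisor:
  assumes "c \<in> C" "c \<otimes> t = \<zero>"
  shows "c = \<zero>"
proof (rule nonzero_cancel)
  show "t \<in> K" "t \<noteq> \<zero>" using t_mem D_in_K by auto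
  show "c \<in> carrier L" using assms(1) C_sub(1) by blast
  then show "t \<otimes> c = \<zero>" using assms(2) m_comm[of t c] t_mem(1) D_sub(1) by auto
qed

end


lemma gorenstein_no_triple:
  assumes "gorenstein_local_ring U R"
  shows "\<not> minimal_multiplicity_triple J R t a b"
  using assms minimal_multiplicity_triple.not_finite_injective_dim[of J R t a b U]
  unfolding gorenstein_local_ring_def by blast

context cubic_order
begin

lemma localization_plane_curve:
  assumes P: "maximalideal P S" and t: "t \<in> P"
    and gor: "gorenstein_local_ring U (localization_at S P)"
    and not_regular: "\<not> regular_local_ring (localization_at S P)"
  shows "plane_curve_singularity (localization_at S P)"
proof -
  let ?R = "localization_at S P" and ?h = "\<lambda>a. loc_frac S P a \<one>"
  interpret P: primeideal P S by (rule S.maximalideal_prime[OF P])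
  have R: "cring ?R" "noetherian_ring ?R" and ex: "\<exists>!J. maximalideal J ?R"
    using gor by (simp_all add: gorenstein_local_ring_def local_ring_def)
  obtain J where J: "maximalideal J ?R" and unique: "\<And>M. maximalideal M ?R \<Longrightarrow> M = J"
    using ex by (rule ex1E) (rule that, assumption, blast)
  have "local_order ?R J (?h ` D) (?h t)"
  proof (rule local_orderI[OF R J unique])
    show "?h \<in> ring_hom S ?R" using P.loc_frac_hom by simp
    show "?h t \<notin> Units ?R" using P.loc_frac_not_Units[OF t] by simp
  next
    fix r assume "r \<in> carrier ?R"
    then obtain c s where c: "c \<in> carrier S" and s: "s \<in> carrier S - P" and r: "r = loc_frac S P c s"
      by (rule P.loc_frac_cases)
    show "\<exists>c\<in>C. \<exists>s\<in>C. ?h s \<in> Units ?R \<and> r \<otimes>\<^bsub>?R\<^esub> ?h s = ?h c"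
      using P.loc_frac_Units[OF s] P.loc_frac_mult_denominator[OF c s] c s unfolding r by auto
  next
    fix r assume r: "r \<in> carrier ?R" "r \<otimes>\<^bsub>?R\<^esub> ?h t = \<zero>\<^bsub>?R\<^esub>"
    show "r = \<zero>\<^bsub>?R\<^esub>"
    proof (rule P.loc_frac_nonzerodivisor[OF P.Icarr[OF t] _ r(1)])
      show "c = \<zero>\<^bsub>S\<^esub>" if "c \<in> carrier S" "c \<otimes>\<^bsub>S\<^esub> t = \<zero>\<^bsub>S\<^esub>" for c
        using uniformizer_nonzerodivisor[of c] that by simp
    qed (use r(2) in simp)
  qed
  then show ?thesis
    by (rule local_order.plane_curve_singularity_if_no_triple[OF _ not_regular gorenstein_no_triple[OF gor]])
qed

text \<open>The order structure is taken on \<open>C\<close> itself through the identity map,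
  whereas the Gorenstein property is known for the localization; \<open>loc_frac_bij\<close> and
  \<open>image_under_iso\<close> bridge the two.\<close>

lemma local_plane_curve:
  assumes J: "maximalideal J S" and unique: "\<And>M. maximalideal M S \<Longrightarrow> M = J" and t: "t \<in> J"
    and noetherian: "noetherian_ring S"
    and gor: "gorenstein_local_ring U (localization_at S J)"
    and not_regular: "\<not> regular_local_ring S"
  shows "plane_curve_singularity S"
proof -
  interpret J: primeideal J S by (rule S.maximalideal_prime[OF J])
  have R: "cring (localization_at S J)"
    using gor by (simp add: gorenstein_local_ring_def local_ring_def)
  have t_not_unit: "t \<notin> Units S"
  proof
    assume u: "t \<in> Units S"
    have "inv\<^bsub>S\<^esub> t \<otimes>\<^bsub>S\<^esub> t \<in> J" by (rule J.I_l_closed[OF t S.Units_inv_closed[OF u]])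
    then have "\<one>\<^bsub>S\<^esub> \<in> J" unfolding S.Units_l_inv[OF u] .
    then show False using J.one_compl by blast
  qed
  have order: "local_order S J ((\<lambda>x. x) ` D) t"
  proof (rule local_orderI[OF S.is_cring noetherian J])
    show "M = J" if "maximalideal M S" for M by (rule unique[OF that])
    show "(\<lambda>x. x) \<in> ring_hom S S" by (simp add: ring_hom_def)
    show "\<exists>c\<in>C. \<exists>s\<in>C. s \<in> Units S \<and> r \<otimes>\<^bsub>S\<^esub> s = c" if "r \<in> carrier S" for r
      using that C_sub(3) S.Units_one_closed S.r_one[OF that] by (intro bexI[of _ r] bexI[of _ \<one>]) auto
    show "r = \<zero>\<^bsub>S\<^esub>" if "r \<in> carrier S" "r \<otimes>\<^bsub>S\<^esub> t = \<zero>\<^bsub>S\<^esub>" for r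
      using uniformizer_nonzerodivisor[of r] that by simp
  qed (rule t_not_unit)
  have "carrier S - J \<subseteq> Units S"
    using S.Units_if_not_mem_maximal[OF noetherian unique] by blast
  then have bij: "bij_betw (\<lambda>a. loc_frac S J a \<one>\<^bsub>S\<^esub>) (carrier S) (carrier (localization_at S J))"
    by (rule J.loc_frac_bij)
  have "\<not> minimal_multiplicity_triple J S t a b" for a b
    using minimal_multiplicity_triple.image_under_iso[OF _ R J.loc_frac_hom bij]
      gorenstein_no_triple[OF gor] by blast
  then show ?thesis
    by (rule local_order.plane_curve_singularity_if_no_triple[OF order not_regular])
qed

end

text \<open>A plane curve singularity is a local ring, so \<open>C\<close> is treated directly when
  it is local and through its localizations otherwise. Nonregularity is what makes the point
  singular: a regular local ring of dimension 1 has embedding dimension 1.\<close>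

theorem corollary3p2:
  fixes L :: "'a ring" and K D C :: "'a set" and U :: "'b itself"
  assumes "complete_dvr (L\<lparr>carrier := D\<rparr>)"
    and "cubic_ring L K D C"
    and "finitely_generated_module (L\<lparr>carrier := D\<rparr>) (mult_module L (integral_closure_in L D))"
    and "gorenstein_ring U (L\<lparr>carrier := C\<rparr>)"
  shows "(local_ring (L\<lparr>carrier := C\<rparr>) \<and> \<not> regular_local_ring (L\<lparr>carrier := C\<rparr>) \<longrightarrow>
            plane_curve_singularity (L\<lparr>carrier := C\<rparr>)) \<and>
         (\<forall>P. maximalideal P (L\<lparr>carrier := C\<rparr>) \<and>
              \<not> regular_local_ring (localization_at (L\<lparr>carrier := C\<rparr>) P) \<longrightarrow>
            plane_curve_singularity (localization_at (L\<lparr>carrier := C\<rparr>) P))"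
proof -
  let ?S = "L\<lparr>carrier := C\<rparr>"
  obtain t where t: "discrete_valuation (L\<lparr>carrier := D\<rparr>) t"
    using assms(1) discrete_valuation_ring_uniformizer unfolding complete_dvr_def by blast
  interpret cubic_order L K D C t
    using assms(2) t
    unfolding cubic_ring_def semisimple_cring_def is_fraction_field_def
      cubic_order_def cubic_order_axioms_def by blast
  have fg: "finitely_generated_module (L\<lparr>carrier := D\<rparr>) (mult_module L C)"
    using assms(2) unfolding cubic_ring_def free_module_of_rank_def finitely_generated_module_def by blast
  have noetherian: "noetherian_ring ?S"
    and gor: "\<And>P. maximalideal P ?S \<Longrightarrow> gorenstein_local_ring U (localization_at ?S P)"
    using assms(4) by (simp_all add: gorenstein_ring_def)
  show ?thesis
  proof (intro conjI impI allI; elim conjE)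
    assume local: "local_ring ?S" and not_regular: "\<not> regular_local_ring ?S"
    have "\<exists>!J. maximalideal J ?S" using local by (simp add: local_ring_def)
    then obtain J where J: "maximalideal J ?S" and unique: "\<And>M. maximalideal M ?S \<Longrightarrow> M = J"
      by (rule ex1E) (rule that, assumption, blast)
    show "plane_curve_singularity ?S"
      by (rule local_plane_curve[OF J unique uniformizer_mem_maximal[OF J fg] noetherian gor[OF J] not_regular])
  next
    fix P assume P: "maximalideal P ?S" and not_regular: "\<not> regular_local_ring (localization_at ?S P)"
    show "plane_curve_singularity (localization_at ?S P)"
      by (rule localization_plane_curve[OF P uniformizer_mem_maximal[OF P fg] gor[OF P] not_regular])
  qed
qed

end
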